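(* Let $X$ be a Banach sequence lattice such that $\varphi_X(n)\varphi_{X'}(n)\le Cn$ for all $n$ (some constant $C$) and $\|\mathrm{id}:X_n\to\ell_2^n\|\le\frac1{\sqrt n}\|\mathrm{id}:X_n\to\ell_1^n\|$ for all $n$. Then for every index set $J$ with $\Lambda_T\subset J$, $$\lim_{n\to\infty}\frac{K(B_{X_n},J)}{\sqrt{\frac{\log n}{n}}}=1.$$
   Context: A Banach sequence lattice $X$ over $\mathbb{N}$ is a Banach space of complex sequences such that $|y|\le|x|$ coordinatewise and $x\in X$ imply $y\in X$, $\|y\|\le\|x\|$. $X_n$ is $\mathbb{C}^n$ with $\|z\|=\|\sum_{k\le n}|z_k|e_k\|_X$. $X'$ is the Köthe dual (sequences $x$ with $\|x\|_{X'}=\sup\{\sum|x_ky_k|:\|y\|_X\le1\}<\infty$). $\varphi_X(n)=\|\sum_{j=1}^ne_j\|_X$. $\Lambda_T$ is the set of all finitely supported multi-indices with entries in $\{0,1\}$; an index set is a subset of $\mathbb{N}_0^{(\mathbb{N})}$. For an index set $J$, $H_\infty^J(B_{X_n})$ is the space of bounded holomorphic $f$ on the open unit ball $B_{X_n}$ with Taylor coefficients $c_\alpha(f)=\partial^\alpha f(0)/\alpha!=0$ for $\alpha\notin J$, and the Bohr radius is $K(B_{X_n},J)=\sup\{r\in(0,1):\sup_{z\in rB_{X_n}}\sum_{\alpha\in J}|c_\alpha(f)z^\alpha|\le\sup_{B_{X_n}}|f|\ \forall f\in H_\infty^J(B_{X_n})\}$. *)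

theory Defs
  imports "HOL-Analysis.Analysis"
begin

definition unitv :: "nat \<Rightarrow> nat \<Rightarrow> complex" where
  "unitv j = (\<lambda>k. if k = j then 1 else 0)"

definition banach_seq_lattice :: "(nat \<Rightarrow> complex) set \<Rightarrow> ((nat \<Rightarrow> complex) \<Rightarrow> real) \<Rightarrow> bool" where
  "banach_seq_lattice X nX \<longleftrightarrow>
     (\<lambda>k. 0) \<in> X
   \<and> (\<forall>x\<in>X. \<forall>y\<in>X. (\<lambda>k. x k + y k) \<in> X)
   \<and> (\<forall>x\<in>X. \<forall>c::complex. (\<lambda>k. c * x k) \<in> X)
   \<and> (\<forall>x\<in>X. nX x = 0 \<longleftrightarrow> x = (\<lambda>k. 0))
   \<and> (\<forall>x\<in>X. \<forall>c::complex. nX (\<lambda>k. c * x k) = cmod c * nX x)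
   \<and> (\<forall>x\<in>X. \<forall>y\<in>X. nX (\<lambda>k. x k + y k) \<le> nX x + nX y)
   \<and> (\<forall>s::nat \<Rightarrow> nat \<Rightarrow> complex. (\<forall>m. s m \<in> X) \<longrightarrow>
        (\<forall>e>0. \<exists>N. \<forall>m\<ge>N. \<forall>p\<ge>N. nX (\<lambda>k. s m k - s p k) < e) \<longrightarrow>
        (\<exists>y\<in>X. (\<lambda>m. nX (\<lambda>k. s m k - y k)) \<longlonglongrightarrow> 0))
   \<and> (\<forall>x\<in>X. \<forall>y. (\<forall>k. cmod (y k) \<le> cmod (x k)) \<longrightarrow> y \<in> X \<and> nX y \<le> nX x)
   \<and> (\<forall>j. unitv j \<in> X)"

text \<open>phi_X(n) = norm of e_1 + ... + e_n (here indices 0..n-1).\<close>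
definition phiX :: "((nat \<Rightarrow> complex) \<Rightarrow> real) \<Rightarrow> nat \<Rightarrow> real" where
  "phiX nX n = nX (\<lambda>k. if k < n then 1 else 0)"

definition koethe_norm :: "(nat \<Rightarrow> complex) set \<Rightarrow> ((nat \<Rightarrow> complex) \<Rightarrow> real)
    \<Rightarrow> (nat \<Rightarrow> complex) \<Rightarrow> ennreal" where
  "koethe_norm X nX x = (SUP y \<in> {y \<in> X. nX y \<le> 1}. (\<Sum>\<^sub>\<infinity>k\<in>UNIV. ennreal (cmod (x k * y k))))"

definition phiX_dual :: "(nat \<Rightarrow> complex) set \<Rightarrow> ((nat \<Rightarrow> complex) \<Rightarrow> real) \<Rightarrow> nat \<Rightarrow> real" where
  "phiX_dual X nX n = enn2real (koethe_norm X nX (\<lambda>k. if k < n then 1 else 0))"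

text \<open>C^n is represented by sequences supported in {..<n}.\<close>
definition Cn :: "nat \<Rightarrow> (nat \<Rightarrow> complex) set" where
  "Cn n = {z. \<forall>k\<ge>n. z k = 0}"

definition normXn :: "((nat \<Rightarrow> complex) \<Rightarrow> real) \<Rightarrow> nat \<Rightarrow> (nat \<Rightarrow> complex) \<Rightarrow> real" where
  "normXn nX n z = nX (\<lambda>k. if k < n then complex_of_real (cmod (z k)) else 0)"

definition ballXn :: "((nat \<Rightarrow> complex) \<Rightarrow> real) \<Rightarrow> nat \<Rightarrow> (nat \<Rightarrow> complex) set" where
  "ballXn nX n = {z \<in> Cn n. normXn nX n z < 1}"

definition id_norm_l1 :: "((nat \<Rightarrow> complex) \<Rightarrow> real) \<Rightarrow> nat \<Rightarrow> real" where
  "id_norm_l1 nX n = (SUP z \<in> {z \<in> Cn n. normXn nX n z \<le> 1}. (\<Sum>k<n. cmod (z k)))"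

definition id_norm_l2 :: "((nat \<Rightarrow> complex) \<Rightarrow> real) \<Rightarrow> nat \<Rightarrow> real" where
  "id_norm_l2 nX n = (SUP z \<in> {z \<in> Cn n. normXn nX n z \<le> 1}. sqrt (\<Sum>k<n. (cmod (z k))\<^sup>2))"

definition multi_indices :: "(nat \<Rightarrow> nat) set" where
  "multi_indices = {\<alpha>. finite {k. \<alpha> k \<noteq> 0}}"

definition Lambda_T :: "(nat \<Rightarrow> nat) set" where
  "Lambda_T = {\<alpha> \<in> multi_indices. \<forall>k. \<alpha> k \<le> 1}"

definition MI :: "nat \<Rightarrow> (nat \<Rightarrow> nat) set" where
  "MI n = {\<alpha>. \<forall>k\<ge>n. \<alpha> k = 0}"

definition monomial :: "nat \<Rightarrow> (nat \<Rightarrow> nat) \<Rightarrow> (nat \<Rightarrow> complex) \<Rightarrow> complex" where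
  "monomial n \<alpha> z = (\<Prod>k<n. z k ^ \<alpha> k)"

text \<open>Holomorphy on an open subset U of C^n: continuous and holomorphic in each variable
  separately (equivalent to complex Frechet differentiability by Osgood's lemma).\<close>
definition holo_n :: "nat \<Rightarrow> (nat \<Rightarrow> complex) set \<Rightarrow> ((nat \<Rightarrow> complex) \<Rightarrow> complex) \<Rightarrow> bool" where
  "holo_n n U f \<longleftrightarrow> continuous_on U f \<and>
     (\<forall>z\<in>U. \<forall>k<n. (\<lambda>t. f (z(k := t))) field_differentiable (at (z k)))"

definition pderiv_k :: "nat \<Rightarrow> ((nat \<Rightarrow> complex) \<Rightarrow> complex) \<Rightarrow> (nat \<Rightarrow> complex) \<Rightarrow> complex" where
  "pderiv_k k f z = deriv (\<lambda>t. f (z(k := t))) (z k)"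

definition pderiv_multi :: "nat \<Rightarrow> (nat \<Rightarrow> nat) \<Rightarrow> ((nat \<Rightarrow> complex) \<Rightarrow> complex)
    \<Rightarrow> (nat \<Rightarrow> complex) \<Rightarrow> complex" where
  "pderiv_multi n \<alpha> f = foldr (\<lambda>k g. (pderiv_k k ^^ \<alpha> k) g) [0..<n] f"

definition taylor_coeff :: "nat \<Rightarrow> ((nat \<Rightarrow> complex) \<Rightarrow> complex) \<Rightarrow> (nat \<Rightarrow> nat) \<Rightarrow> complex" where
  "taylor_coeff n f \<alpha> = pderiv_multi n \<alpha> f (\<lambda>k. 0) / of_nat (\<Prod>k<n. fact (\<alpha> k))"

definition H_inf_J :: "((nat \<Rightarrow> complex) \<Rightarrow> real) \<Rightarrow> nat \<Rightarrow> (nat \<Rightarrow> nat) set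
    \<Rightarrow> ((nat \<Rightarrow> complex) \<Rightarrow> complex) set" where
  "H_inf_J nX n J = {f. holo_n n (ballXn nX n) f \<and> bounded (f ` ballXn nX n) \<and>
      (\<forall>\<alpha>\<in>MI n. \<alpha> \<notin> J \<longrightarrow> taylor_coeff n f \<alpha> = 0)}"

definition bohr_radius :: "((nat \<Rightarrow> complex) \<Rightarrow> real) \<Rightarrow> nat \<Rightarrow> (nat \<Rightarrow> nat) set \<Rightarrow> real" where
  "bohr_radius nX n J = Sup {r. 0 < r \<and> r < 1 \<and>
     (\<forall>f\<in>H_inf_J nX n J.
        (SUP z \<in> (\<lambda>w k. complex_of_real r * w k) ` ballXn nX n.
           (\<Sum>\<^sub>\<infinity>\<alpha>\<in>J \<inter> MI n. ennreal (cmod (taylor_coeff n f \<alpha> * monomial n \<alpha> z))))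
        \<le> ennreal (SUP w \<in> ballXn nX n. cmod (f w)))}"

end

theory Submission
  imports Defs "HOL-Complex_Analysis.Complex_Analysis" "HOL-Real_Asymp.Real_Asymp"
begin

text \<open>
  Lower bound. If \<open>f\<close> is bounded by \<open>B\<close> on the ball and \<open>w\<close> lies in it, then
  \<open>z \<mapsto> f (w z)\<close> is a function on the polydisc, so only polydiscs matter. Its homogeneous parts are
  bounded by \<open>2 (B - |c\<^sub>0|)\<close>, and it remains to estimate coefficient sums of \<open>m\<close>-homogeneous polynomials
  up to a factor \<open>n\<^sup>\<delta>\<close>. Few multi-indices are not squarefree, so for those Cauchy--Schwarz suffices. For the
  squarefree ones a random colouring of the variables splits off a part that is linear in each of \<open>k\<close> blocks
  (\<open>k\<close> fixed and large); Blei's inequality for the \<open>k\<close>-linear part, whose exponent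
  \<open>p = 2k / (k + 1)\<close> is close to \<open>2\<close>, combined with Bonami's inequality for the remaining \<open>m - k\<close>
  variables costs only \<open>3\<^bsup>m/k\<^esup>\<close>. Signs can be used in place of torus variables because setting
  \<open>z \<in> {-1, 1}\<^sup>n\<close> leaves the squarefree coefficients of top degree intact.

  Upper bound. The hypothesis on the two identity maps forces the constant vector with entries \<open>L / n\<close>,
  \<open>L\<close> being the norm of the identity into \<open>\<ell>\<^sub>1\<close>, into the closed unit ball, which in turn lies
  in the Euclidean ball of radius \<open>L / sqrt n\<close>. A squarefree polynomial of degree about \<open>ln n\<close> with
  random signs is small on that Euclidean ball but has a large coefficient sum at the constant vector.
\<close>

section \<open>Averages over roots of unity\<close>

text \<open>Everything is measured against a loss of \<open>sqrt n\<close>. At the radius sqrt (ln n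
  / n), Parseval and Cauchy-Schwarz over all indices of degree m lose about (1 - x)^(-n/2) x^(-m/2)
  with x = ln n / n. The radius cancels the second factor; the first is about \<open>sqrt n\<close>
  in every degree. The lower bound must therefore save \<open>sqrt n\<close>, up to powers of ln n
  and m and up to q^m with q close to 1. Non-squarefree indices save it because they number at most
  n times the indices of degree m - 2. For squarefree ones, Blei's inequality bounds a sum over at
  most n^k tuples with the factor n^((k-1)/2) instead of n^(k/2), and that is the saving. Leftover
  powers of ln n are beaten only by q^m, so degrees below a small multiple of ln n need a separate
  estimate that is small by a power of n.

  The upper bound meets this at degree m near ln n: the size of the net of the Euclidean ball costs
  the random polynomial an extra \<open>sqrt n\<close>, which the factor e^(-m/2) in sqrt (m!) just
  absorbs.\<close>

lemma sum_cis_roots: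
  fixes N :: nat and t :: int
  assumes "N > 0"
  shows "(\<Sum>l<N. cis (2 * pi * real l * of_int t / real N)) = (if int N dvd t then of_nat N else 0)"
proof -
  define w where "w = cis (2 * pi * of_int t / real N)"
  have pw: "cis (2 * pi * real l * of_int t / real N) = w ^ l" for l
    by (simp add: w_def Complex.DeMoivre mult_ac)
  have wN: "w ^ N = 1"
  proof -
    have "w ^ N = cis (2 * pi * of_int t)"
      using assms by (simp add: w_def Complex.DeMoivre)
    also have "\<dots> = 1"
      by (simp add: cis_multiple_2pi)
    finally show ?thesis .
  qed
  show ?thesis
  proof (cases "int N dvd t")
    case True
    then obtain q where q: "t = int N * q" by blast
    have "2 * pi * of_int t / real N = 2 * pi * of_int q"
      using assms by (simp add: q)
    then have "w = 1"
      unfolding w_def by (simp only:) (rule cis_multiple_2pi, simp)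
    then show ?thesis using True by (simp add: pw)
  next
    case False
    have "w \<noteq> 1"
    proof
      assume "w = 1"
      then have "cos (2 * pi * of_int t / real N) = 1"
        by (simp add: w_def complex_eq_iff)
      then obtain q :: int where "2 * pi * of_int t / real N = of_int q * 2 * pi"
        by (auto simp: cos_one_2pi_int)
      then have "of_int t = (of_int q * real N)"
        using assms by (simp add: field_simps)
      then have "t = q * int N"
        by (metis (mono_tags, lifting) of_int_eq_iff of_int_mult of_int_of_nat_eq)
      with False show False by simp
    qed
    then have "(\<Sum>l<N. w ^ l) = 0"
      using wN by (simp add: geometric_sum)
    with False show ?thesis by (simp add: pw)
  qed
qed

lemma int_dvd_diff_iff: "a < N \<Longrightarrow> b < N \<Longrightarrow> int N dvd int a - int b \<longleftrightarrow> a = b"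
  by (simp flip: mod_eq_dvd_iff)

text \<open>Unimodularity is asked of all coordinates, but \<open>monomial n\<close> reads only the
  first \<open>n\<close>, so \<open>M\<close> bounds the polynomial on the n-dimensional
  torus.\<close>

definition torus_bounded :: "nat \<Rightarrow> (nat \<Rightarrow> nat) set \<Rightarrow> ((nat \<Rightarrow> nat) \<Rightarrow> complex) \<Rightarrow> real \<Rightarrow> bool" where
  "torus_bounded n F a M \<longleftrightarrow>
     (\<forall>z. (\<forall>j. cmod (z j) = 1) \<longrightarrow> cmod (\<Sum>\<alpha>\<in>F. a \<alpha> * monomial n \<alpha> z) \<le> M)"

lemma torus_boundedD:
  "torus_bounded n F a M \<Longrightarrow> (\<And>j. cmod (z j) = 1) \<Longrightarrow> cmod (\<Sum>\<alpha>\<in>F. a \<alpha> * monomial n \<alpha> z) \<le> M"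
  by (simp add: torus_bounded_def)

lemma torus_bounded_nonneg: "torus_bounded n F a M \<Longrightarrow> 0 \<le> M"
  using torus_boundedD[of n F a M "\<lambda>_. 1"] by (meson norm_ge_zero norm_one order_trans)

lemma MI_eqI: "\<alpha> \<in> MI n \<Longrightarrow> \<beta> \<in> MI n \<Longrightarrow> (\<And>j. j < n \<Longrightarrow> \<alpha> j = \<beta> j) \<Longrightarrow> \<alpha> = \<beta>"
  by (rule ext) (metis (mono_tags) MI_def mem_Collect_eq not_le)

text \<open>Parseval without integration: \<open>N\<close> exceeds every exponent occurring in
  \<open>F\<close>, so distinct monomials stay orthogonal on the finite grid of N-th roots of unity,
  and the mean square over the grid is the sum on the left.\<close>

lemma torus_coeff_l2_le:
  assumes F: "finite F" "F \<subseteq> MI n" and bd: "torus_bounded n F a M"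
  shows "(\<Sum>\<alpha>\<in>F. (cmod (a \<alpha>))\<^sup>2) \<le> M\<^sup>2"
proof -
  define N where "N = Suc (Max (insert 0 ((\<lambda>(\<alpha>, j). \<alpha> j) ` (F \<times> {..<n}))))"
  have N: "\<alpha> j < N" if "\<alpha> \<in> F" "j < n" for \<alpha> j
    unfolding N_def using that F
    by (intro le_imp_less_Suc Max_ge) auto
  have N0: "N > 0" by (simp add: N_def)
  define G where "G = PiE {..<n} (\<lambda>_. {..<N})"
  have finG: "finite G" by (simp add: G_def finite_PiE)
  have cardG: "card G = N ^ n" by (simp add: G_def card_PiE)
  define z where "z g = (\<lambda>j. cis (2 * pi * real (g j) / real N))" for g :: "nat \<Rightarrow> nat"
  define p where "p g = (\<Sum>\<alpha>\<in>F. a \<alpha> * monomial n \<alpha> (z g))" for g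
  have zz: "monomial n \<alpha> (z g) * cnj (monomial n \<beta> (z g)) =
      (\<Prod>j<n. cis (2 * pi * real (g j) * of_int (int (\<alpha> j) - int (\<beta> j)) / real N))" for \<alpha> \<beta> g
    unfolding monomial_def z_def cnj_prod prod.distrib[symmetric]
    by (intro prod.cong refl) (simp add: Complex.DeMoivre cis_cnj cis_mult algebra_simps diff_divide_distrib)
  have orth: "(\<Sum>g\<in>G. monomial n \<alpha> (z g) * cnj (monomial n \<beta> (z g))) = (if \<alpha> = \<beta> then of_nat (N ^ n) else 0)"
    if ab: "\<alpha> \<in> F" "\<beta> \<in> F" for \<alpha> \<beta>
  proof -
    have "(\<Sum>g\<in>G. monomial n \<alpha> (z g) * cnj (monomial n \<beta> (z g))) =
        (\<Prod>j<n. \<Sum>l<N. cis (2 * pi * real l * of_int (int (\<alpha> j) - int (\<beta> j)) / real N))"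
      unfolding zz G_def by (rule prod_sum_PiE [symmetric]) auto
    also have "\<dots> = (\<Prod>j<n. if \<alpha> j = \<beta> j then of_nat N else 0)"
    proof (intro prod.cong refl)
      fix j assume "j \<in> {..<n}"
      then have "\<alpha> j < N" "\<beta> j < N" using N ab by auto
      then have "int N dvd (int (\<alpha> j) - int (\<beta> j)) \<longleftrightarrow> \<alpha> j = \<beta> j"
        by (rule int_dvd_diff_iff)
      then show "(\<Sum>l<N. cis (2 * pi * real l * of_int (int (\<alpha> j) - int (\<beta> j)) / real N)) =
          (if \<alpha> j = \<beta> j then of_nat N else (0::complex))"
        unfolding sum_cis_roots[OF N0] by simp
    qed
    also have "\<dots> = (if \<alpha> = \<beta> then of_nat (N ^ n) else 0)"
    proof (cases "\<alpha> = \<beta>")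
      case False
      then obtain j where "j < n" "\<alpha> j \<noteq> \<beta> j"
        using MI_eqI ab F(2) by (meson subsetD)
      then have "(\<Prod>j<n. if \<alpha> j = \<beta> j then of_nat N else (0::complex)) = 0"
        by (intro prod_zero) auto
      with False show ?thesis by simp
    qed simp
    finally show ?thesis .
  qed
  have "(\<Sum>g\<in>G. p g * cnj (p g)) =
      (\<Sum>g\<in>G. \<Sum>\<alpha>\<in>F. \<Sum>\<beta>\<in>F. a \<alpha> * cnj (a \<beta>) * (monomial n \<alpha> (z g) * cnj (monomial n \<beta> (z g))))"
    by (simp add: p_def sum_product mult_ac)
  also have "\<dots> = (\<Sum>\<alpha>\<in>F. \<Sum>\<beta>\<in>F. a \<alpha> * cnj (a \<beta>) * (\<Sum>g\<in>G. monomial n \<alpha> (z g) * cnj (monomial n \<beta> (z g))))"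
    unfolding sum_distrib_left
    by (subst sum.swap, rule sum.cong[OF refl], subst sum.swap, rule refl)
  also have "\<dots> = (\<Sum>\<alpha>\<in>F. \<Sum>\<beta>\<in>F. if \<alpha> = \<beta> then a \<alpha> * cnj (a \<beta>) * of_nat (N ^ n) else 0)"
    using orth by (intro sum.cong refl) (auto simp: if_distrib cong: if_cong)
  also have "\<dots> = (\<Sum>\<alpha>\<in>F. a \<alpha> * cnj (a \<alpha>) * of_nat (N ^ n))"
    using F by (simp add: sum.delta)
  finally have "(\<Sum>g\<in>G. p g * cnj (p g)) = (\<Sum>\<alpha>\<in>F. a \<alpha> * cnj (a \<alpha>)) * of_nat (N ^ n)"
    by (simp add: sum_distrib_right)
  then have "complex_of_real (\<Sum>g\<in>G. (cmod (p g))\<^sup>2) = complex_of_real ((\<Sum>\<alpha>\<in>F. (cmod (a \<alpha>))\<^sup>2) * real (N ^ n))"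
    by (simp only: complex_norm_square of_real_sum of_real_mult of_real_of_nat_eq)
  then have "(\<Sum>\<alpha>\<in>F. (cmod (a \<alpha>))\<^sup>2) * real (N ^ n) = (\<Sum>g\<in>G. (cmod (p g))\<^sup>2)"
    by (metis of_real_eq_iff)
  also have "\<dots> \<le> (\<Sum>g\<in>G. M\<^sup>2)"
  proof (intro sum_mono power_mono)
    show "cmod (p g) \<le> M" for g
      unfolding p_def by (rule torus_boundedD[OF bd]) (simp add: z_def)
  qed simp
  also have "\<dots> = M\<^sup>2 * real (N ^ n)" by (simp add: cardG)
  finally show ?thesis using N0 by simp
qed

text \<open>Rotating the variables of \<open>V\<close> by the N-th roots of unity and averaging
  against the character of index \<open>d\<close> isolates the part of degree \<open>d\<close> in
  \<open>V\<close>. This is an average of values bounded by \<open>M\<close>, so \<open>M\<close> is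
  kept. \<open>N\<close> exceeds \<open>d\<close> and all occurring degrees, so nothing is
  aliased.\<close>

lemma torus_bounded_block_degree:
  assumes F: "finite F" and bd: "torus_bounded n F a M" and V: "finite V" "V \<subseteq> {..<n}"
  shows "torus_bounded n {\<alpha> \<in> F. (\<Sum>j\<in>V. \<alpha> j) = d} a M"
  unfolding torus_bounded_def
proof (intro allI impI)
  fix z :: "nat \<Rightarrow> complex" assume z: "\<forall>j. cmod (z j) = 1"
  define N where "N = Suc (d + Max (insert 0 ((\<lambda>\<alpha>. \<Sum>j\<in>V. \<alpha> j) ` F)))"
  have N0: "N > 0" by (simp add: N_def)
  have N: "(\<Sum>j\<in>V. \<alpha> j) < N" "d < N" if "\<alpha> \<in> F" for \<alpha>
  proof -
    have "(\<Sum>j\<in>V. \<alpha> j) \<le> Max (insert 0 ((\<lambda>\<alpha>. \<Sum>j\<in>V. \<alpha> j) ` F))"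
      using that F by (intro Max_ge) auto
    then show "(\<Sum>j\<in>V. \<alpha> j) < N" "d < N" by (auto simp: N_def)
  qed
  define y where "y l = (\<lambda>j. if j \<in> V then cis (2 * pi * real l / real N) * z j else z j)" for l :: nat
  define p where "p l = (\<Sum>\<alpha>\<in>F. a \<alpha> * monomial n \<alpha> (y l))" for l
  have mono: "monomial n \<alpha> (y l) = cis (2 * pi * real l / real N) ^ (\<Sum>j\<in>V. \<alpha> j) * monomial n \<alpha> z" for \<alpha> l
  proof -
    have "monomial n \<alpha> (y l) = (\<Prod>j<n. (if j \<in> V then cis (2 * pi * real l / real N) ^ \<alpha> j else 1) * z j ^ \<alpha> j)"
      unfolding monomial_def by (intro prod.cong refl) (auto simp: y_def power_mult_distrib)
    also have "\<dots> = (\<Prod>j\<in>{..<n}. if j \<in> V then cis (2 * pi * real l / real N) ^ \<alpha> j else 1) * monomial n \<alpha> z"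
      by (simp add: prod.distrib monomial_def)
    also have "(\<Prod>j\<in>{..<n}. if j \<in> V then cis (2 * pi * real l / real N) ^ \<alpha> j else 1) =
        (\<Prod>j\<in>V. cis (2 * pi * real l / real N) ^ \<alpha> j)"
      using V by (simp add: prod.inter_restrict[symmetric] Int_absorb1)
    finally show ?thesis by (simp add: power_sum)
  qed
  have bp: "cmod (p l) \<le> M" for l
    unfolding p_def by (rule torus_boundedD[OF bd]) (use z in \<open>auto simp: y_def norm_mult\<close>)
  have "(\<Sum>l<N. p l * cis (- (2 * pi * real l * real d / real N))) =
      (\<Sum>l<N. \<Sum>\<alpha>\<in>F. a \<alpha> * monomial n \<alpha> z * cis (2 * pi * real l * of_int (int (\<Sum>j\<in>V. \<alpha> j) - int d) / real N))"
    unfolding p_def mono sum_distrib_right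
    by (intro sum.cong refl) (simp add: Complex.DeMoivre cis_mult mult_ac algebra_simps diff_divide_distrib flip: of_nat_sum)
  also have "\<dots> = (\<Sum>\<alpha>\<in>F. a \<alpha> * monomial n \<alpha> z * (\<Sum>l<N. cis (2 * pi * real l * of_int (int (\<Sum>j\<in>V. \<alpha> j) - int d) / real N)))"
    unfolding sum_distrib_left by (rule sum.swap)
  also have "\<dots> = (\<Sum>\<alpha>\<in>F. if (\<Sum>j\<in>V. \<alpha> j) = d then of_nat N * (a \<alpha> * monomial n \<alpha> z) else 0)"
  proof (intro sum.cong refl)
    fix \<alpha> assume "\<alpha> \<in> F"
    then have "int N dvd int (\<Sum>j\<in>V. \<alpha> j) - int d \<longleftrightarrow> (\<Sum>j\<in>V. \<alpha> j) = d"
      using N[of \<alpha>] by (intro int_dvd_diff_iff)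
    then show "a \<alpha> * monomial n \<alpha> z * (\<Sum>l<N. cis (2 * pi * real l * of_int (int (\<Sum>j\<in>V. \<alpha> j) - int d) / real N)) =
        (if (\<Sum>j\<in>V. \<alpha> j) = d then of_nat N * (a \<alpha> * monomial n \<alpha> z) else 0)"
      unfolding sum_cis_roots[OF N0] by simp
  qed
  also have "\<dots> = of_nat N * (\<Sum>\<alpha>\<in>{\<alpha> \<in> F. (\<Sum>j\<in>V. \<alpha> j) = d}. a \<alpha> * monomial n \<alpha> z)"
    unfolding sum_distrib_left using F by (simp add: sum.inter_filter)
  finally have eq: "of_nat N * (\<Sum>\<alpha>\<in>{\<alpha> \<in> F. (\<Sum>j\<in>V. \<alpha> j) = d}. a \<alpha> * monomial n \<alpha> z) =
      (\<Sum>l<N. p l * cis (- (2 * pi * real l * real d / real N)))" ..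
  have "real N * cmod (\<Sum>\<alpha>\<in>{\<alpha> \<in> F. (\<Sum>j\<in>V. \<alpha> j) = d}. a \<alpha> * monomial n \<alpha> z) =
      cmod (\<Sum>l<N. p l * cis (- (2 * pi * real l * real d / real N)))"
    unfolding eq[symmetric] by (simp add: norm_mult)
  also have "\<dots> \<le> (\<Sum>l<N. M)"
    by (rule sum_norm_le) (simp add: norm_mult bp)
  also have "\<dots> = real N * M" by simp
  finally show "cmod (\<Sum>\<alpha>\<in>{\<alpha> \<in> F. (\<Sum>j\<in>V. \<alpha> j) = d}. a \<alpha> * monomial n \<alpha> z) \<le> M"
    using N0 by simp
qed

section \<open>Hypercontractivity on the discrete cube\<close>

text \<open>A point of the cube {-1,1}^V is encoded by the set of its coordinates equal to -1.
  Adding a variable is then \<open>insert\<close>, which suits induction over finite sets.\<close>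

definition cube_mean :: "'a set \<Rightarrow> ('a set \<Rightarrow> real) \<Rightarrow> real" where
  "cube_mean V f = (\<Sum>X\<in>Pow V. f X) / 2 ^ card V"

definition walsh :: "'a set \<Rightarrow> 'a set \<Rightarrow> real" where
  "walsh S X = (\<Prod>j\<in>S. if j \<in> X then - 1 else 1)"

lemma cube_mean_mono:
  "(\<And>X. X \<subseteq> V \<Longrightarrow> f X \<le> g X) \<Longrightarrow> cube_mean V f \<le> cube_mean V g"
  unfolding cube_mean_def by (intro divide_right_mono sum_mono) auto

lemma cube_mean_add: "cube_mean V (\<lambda>X. f X + g X) = cube_mean V f + cube_mean V g"
  by (simp add: cube_mean_def sum.distrib add_divide_distrib)

lemma cube_mean_diff: "cube_mean V (\<lambda>X. f X - g X) = cube_mean V f - cube_mean V g"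
  by (simp add: cube_mean_def sum_subtractf diff_divide_distrib)

lemma cube_mean_cmult: "cube_mean V (\<lambda>X. c * f X) = c * cube_mean V f"
  by (simp add: cube_mean_def sum_distrib_left)

lemma cube_mean_const: "finite V \<Longrightarrow> cube_mean V (\<lambda>X. c) = c"
  by (simp add: cube_mean_def card_Pow)

lemma cube_mean_sum: "cube_mean V (\<lambda>X. \<Sum>i\<in>I. f i X) = (\<Sum>i\<in>I. cube_mean V (f i))"
  unfolding cube_mean_def sum_divide_distrib[symmetric] by (subst sum.swap) simp

lemma cube_mean_nonneg: "(\<And>X. X \<subseteq> V \<Longrightarrow> 0 \<le> f X) \<Longrightarrow> 0 \<le> cube_mean V f"
  unfolding cube_mean_def by (intro divide_nonneg_pos sum_nonneg) auto

lemma cube_mean_cong: "(\<And>X. X \<subseteq> V \<Longrightarrow> f X = g X) \<Longrightarrow> cube_mean V f = cube_mean V g"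
  unfolding cube_mean_def by (intro arg_cong2[where f = "(/)"] sum.cong) auto

lemma cube_mean_empty [simp]: "cube_mean {} f = f {}"
  by (simp add: cube_mean_def)

lemma sum_Pow_insert:
  assumes "finite V" "v \<notin> V"
  shows "sum f (Pow (insert v V)) = sum f (Pow V) + (\<Sum>X\<in>Pow V. f (insert v X))"
proof -
  have "inj_on (insert v) (Pow V)"
    using assms by (auto simp: inj_on_def)
  moreover have "Pow V \<inter> insert v ` Pow V = {}"
    using assms by auto
  ultimately show ?thesis
    using assms by (simp add: Pow_insert sum.union_disjoint sum.reindex)
qed

lemma cube_mean_insert:
  assumes "finite V" "v \<notin> V"
  shows "cube_mean (insert v V) f = cube_mean V (\<lambda>X. (f X + f (insert v X)) / 2)"
  using assms by (simp add: cube_mean_def sum_Pow_insert sum.distrib add_divide_distrib sum_divide_distrib[symmetric])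

lemma walsh_insert_left: "finite S \<Longrightarrow> v \<notin> S \<Longrightarrow> walsh (insert v S) X = (if v \<in> X then - 1 else 1) * walsh S X"
  by (simp add: walsh_def)

lemma walsh_insert_right: "v \<notin> S \<Longrightarrow> walsh S (insert v X) = walsh S X"
  unfolding walsh_def by (intro prod.cong) auto

definition walsh_poly :: "'a set \<Rightarrow> ('a set \<Rightarrow> complex) \<Rightarrow> 'a set \<Rightarrow> complex" where
  "walsh_poly V c X = (\<Sum>S\<in>Pow V. c S * of_real (walsh S X))"

lemma walsh_poly_insert:
  assumes "finite V" "v \<notin> V" "X \<subseteq> V"
  shows "walsh_poly (insert v V) c X = walsh_poly V c X + walsh_poly V (\<lambda>S. c (insert v S)) X"
    and "walsh_poly (insert v V) c (insert v X) = walsh_poly V c X - walsh_poly V (\<lambda>S. c (insert v S)) X"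
proof -
  have *: "finite S \<and> v \<notin> S" if "S \<in> Pow V" for S
    using assms that by (auto intro: finite_subset)
  have X: "v \<notin> X" using assms by auto
  show "walsh_poly (insert v V) c X = walsh_poly V c X + walsh_poly V (\<lambda>S. c (insert v S)) X"
    unfolding walsh_poly_def sum_Pow_insert[OF assms(1,2)]
    using * X by (intro arg_cong2[where f = "(+)"] sum.cong) (auto simp: walsh_insert_left)
  show "walsh_poly (insert v V) c (insert v X) = walsh_poly V c X - walsh_poly V (\<lambda>S. c (insert v S)) X"
    unfolding walsh_poly_def sum_Pow_insert[OF assms(1,2)] diff_conv_add_uminus sum_negf[symmetric]
    using * X by (intro arg_cong2[where f = "(+)"] sum.cong) (auto simp: walsh_insert_left walsh_insert_right)
qed

lemma walsh_parseval:
  assumes "finite V"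
  shows "cube_mean V (\<lambda>X. (cmod (walsh_poly V c X))\<^sup>2) = (\<Sum>S\<in>Pow V. (cmod (c S))\<^sup>2)"
  using assms
proof (induction V arbitrary: c rule: finite_induct)
  case empty
  show ?case by (simp add: walsh_poly_def walsh_def)
next
  case (insert v V)
  have "((cmod (a + b))\<^sup>2 + (cmod (a - b))\<^sup>2) / 2 = (cmod a)\<^sup>2 + (cmod b)\<^sup>2" for a b
    unfolding cmod_power2 by (simp add: power2_eq_square algebra_simps)
  then have "cube_mean (insert v V) (\<lambda>X. (cmod (walsh_poly (insert v V) c X))\<^sup>2) =
      cube_mean V (\<lambda>X. (cmod (walsh_poly V c X))\<^sup>2 + (cmod (walsh_poly V (\<lambda>S. c (insert v S)) X))\<^sup>2)"
    unfolding cube_mean_insert[OF insert.hyps]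
    by (intro cube_mean_cong) (simp only: walsh_poly_insert[OF insert.hyps])
  then show ?case
    by (simp add: cube_mean_add insert.IH sum_Pow_insert[OF insert.hyps])
qed

section \<open>Bonami's fourth moment inequality and comparison of moments\<close>

lemma cube_mean_Cauchy_Schwarz:
  "(cube_mean V (\<lambda>X. f X * g X))\<^sup>2 \<le> cube_mean V (\<lambda>X. (f X)\<^sup>2) * cube_mean V (\<lambda>X. (g X)\<^sup>2)"
proof -
  have "(\<Sum>X\<in>Pow V. f X * g X)\<^sup>2 / (2 ^ card V)\<^sup>2 \<le> (\<Sum>X\<in>Pow V. (f X)\<^sup>2) * (\<Sum>X\<in>Pow V. (g X)\<^sup>2) / (2 ^ card V)\<^sup>2"
    by (intro divide_right_mono Cauchy_Schwarz_ineq_sum) auto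
  then show ?thesis
    by (simp add: cube_mean_def power_divide power2_eq_square)
qed

text \<open>Splitting off one variable writes the polynomial as \<open>g\<close> plus or minus
  \<open>h\<close>, where \<open>h\<close> has degree one less. Averaging over the sign kills the
  odd terms, and the missing degree of \<open>h\<close> is worth a factor 9, which is just enough
  for the cross term to complete the square (G + H)^2.\<close>

lemma bonami_four_two:
  assumes "finite V" "\<And>S. S \<subseteq> V \<Longrightarrow> d < card S \<Longrightarrow> c S = 0"
  shows "cube_mean V (\<lambda>X. cmod (walsh_poly V c X) ^ 4) \<le> 9 ^ d * (\<Sum>S\<in>Pow V. (cmod (c S))\<^sup>2)\<^sup>2"
  using assms
proof (induction V arbitrary: c d rule: finite_induct)
  case empty
  have "cmod (c {}) ^ 4 = ((cmod (c {}))\<^sup>2)\<^sup>2" by simp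
  also have "\<dots> \<le> 9 ^ d * ((cmod (c {}))\<^sup>2)\<^sup>2"
    by (simp add: mult_le_cancel_right1)
  finally show ?case by (simp add: walsh_poly_def walsh_def)
next
  case (insert v V)
  define g h where "g = walsh_poly V c" and "h = walsh_poly V (\<lambda>S. c (insert v S))"
  define G H where "G = (\<Sum>S\<in>Pow V. (cmod (c S))\<^sup>2)" and "H = (\<Sum>S\<in>Pow V. (cmod (c (insert v S)))\<^sup>2)"
  have GH: "0 \<le> G" "0 \<le> H" by (auto simp: G_def H_def sum_nonneg)
  have g4: "cube_mean V (\<lambda>X. cmod (g X) ^ 4) \<le> 9 ^ d * G\<^sup>2"
    unfolding g_def G_def by (rule insert.IH) (use insert.prems in auto)
  have h4: "9 * cube_mean V (\<lambda>X. cmod (h X) ^ 4) \<le> 9 ^ d * H\<^sup>2"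
  proof (cases d)
    case 0
    have "c (insert v S) = 0" if "S \<subseteq> V" for S
      using that insert.hyps 0 insert.prems[of "insert v S"]
      by (auto simp: card_gt_0_iff finite_subset)
    then have "h X = 0" for X
      unfolding h_def walsh_poly_def by (intro sum.neutral) auto
    then show ?thesis by (simp add: cube_mean_def)
  next
    case (Suc d')
    have "cube_mean V (\<lambda>X. cmod (h X) ^ 4) \<le> 9 ^ d' * H\<^sup>2"
      unfolding h_def H_def
    proof (rule insert.IH)
      fix S assume S: "S \<subseteq> V" "d' < card S"
      then have "v \<notin> S" "finite S" using insert.hyps by (auto intro: finite_subset)
      then show "c (insert v S) = 0" using S Suc by (intro insert.prems) auto
    qed
    then show ?thesis using Suc by simp
  qed
  \<comment> \<open>With t the real part of a times the conjugate of b, the left side is (A + B)^2 +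
    4 t^2, and t^2 is at most A B.\<close>
  have pt: "(cmod (a + b) ^ 4 + cmod (a - b) ^ 4) / 2 \<le>
      cmod a ^ 4 + 6 * ((cmod a)\<^sup>2 * (cmod b)\<^sup>2) + cmod b ^ 4" for a b
  proof -
    define A B t where "A = (cmod a)\<^sup>2" and "B = (cmod b)\<^sup>2" and "t = Re a * Re b + Im a * Im b"
    have pm: "(cmod (a + b))\<^sup>2 = A + B + 2 * t" "(cmod (a - b))\<^sup>2 = A + B - 2 * t"
      unfolding A_def B_def t_def cmod_power2 by (simp_all add: power2_eq_square algebra_simps)
    have "t\<^sup>2 + (Re a * Im b - Im a * Re b)\<^sup>2 = A * B"
      unfolding A_def B_def t_def cmod_power2 by (simp add: power2_eq_square algebra_simps)
    then have tAB: "t\<^sup>2 \<le> A * B"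
      by (smt (verit) zero_le_power2)
    have four: "cmod x ^ 4 = ((cmod x)\<^sup>2)\<^sup>2" for x by simp
    show ?thesis
      unfolding four pm A_def[symmetric] B_def[symmetric] using tAB
      by (simp add: power2_eq_square algebra_simps)
  qed
  \<comment> \<open>The binomial coefficient 6 becomes 2, as the square root of the factor 9 in
    \<open>h4\<close> divides it by 3.\<close>
  have cs: "6 * cube_mean V (\<lambda>X. (cmod (g X))\<^sup>2 * (cmod (h X))\<^sup>2) \<le> 2 * 9 ^ d * G * H"
  proof (rule power2_le_imp_le)
    have "(6 * cube_mean V (\<lambda>X. (cmod (g X))\<^sup>2 * (cmod (h X))\<^sup>2))\<^sup>2 \<le>
        4 * (cube_mean V (\<lambda>X. cmod (g X) ^ 4) * (9 * cube_mean V (\<lambda>X. cmod (h X) ^ 4)))"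
      using cube_mean_Cauchy_Schwarz[of V "\<lambda>X. (cmod (g X))\<^sup>2" "\<lambda>X. (cmod (h X))\<^sup>2"]
      by (simp add: power_mult_distrib)
    also have "\<dots> \<le> 4 * ((9 ^ d * G\<^sup>2) * (9 ^ d * H\<^sup>2))"
      by (intro mult_left_mono mult_mono g4 h4) (auto intro!: cube_mean_nonneg)
    also have "\<dots> = (2 * 9 ^ d * G * H)\<^sup>2"
      by (simp add: power2_eq_square)
    finally show "(6 * cube_mean V (\<lambda>X. (cmod (g X))\<^sup>2 * (cmod (h X))\<^sup>2))\<^sup>2 \<le> (2 * 9 ^ d * G * H)\<^sup>2" .
  qed (use GH in auto)
  have "cube_mean (insert v V) (\<lambda>X. cmod (walsh_poly (insert v V) c X) ^ 4) =
      cube_mean V (\<lambda>X. (cmod (g X + h X) ^ 4 + cmod (g X - h X) ^ 4) / 2)"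
    unfolding cube_mean_insert[OF insert.hyps] g_def h_def
    by (intro cube_mean_cong) (simp only: walsh_poly_insert[OF insert.hyps])
  also have "\<dots> \<le> cube_mean V (\<lambda>X. cmod (g X) ^ 4 + 6 * ((cmod (g X))\<^sup>2 * (cmod (h X))\<^sup>2) + cmod (h X) ^ 4)"
    by (intro cube_mean_mono pt)
  also have "\<dots> = cube_mean V (\<lambda>X. cmod (g X) ^ 4) + 6 * cube_mean V (\<lambda>X. (cmod (g X))\<^sup>2 * (cmod (h X))\<^sup>2)
      + cube_mean V (\<lambda>X. cmod (h X) ^ 4)"
    by (simp add: cube_mean_add cube_mean_cmult)
  also have "\<dots> \<le> 9 ^ d * G\<^sup>2 + 2 * 9 ^ d * G * H + 9 ^ d * H\<^sup>2"
  proof -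
    have "0 \<le> cube_mean V (\<lambda>X. cmod (h X) ^ 4)" by (rule cube_mean_nonneg) simp
    with g4 h4 cs show ?thesis by linarith
  qed
  also have "\<dots> = 9 ^ d * (G + H)\<^sup>2"
    by (simp add: power2_eq_square algebra_simps)
  also have "G + H = (\<Sum>S\<in>Pow (insert v V). (cmod (c S))\<^sup>2)"
    by (simp add: G_def H_def sum_Pow_insert[OF insert.hyps])
  finally show ?case .
qed

text \<open>A pointwise substitute for Hoelder interpolation between the exponents p, 2 and 4: in
  the variable u = s^2 the convex function u powr ((p - 2) / 2) lies above its tangent at u = 1;
  then multiply by u.\<close>

lemma powr_ge_tangent:
  fixes s p :: real
  assumes "0 \<le> s" "0 < p" "p \<le> 2"
  shows "s powr p \<ge> (4 - p) / 2 * s\<^sup>2 - (2 - p) / 2 * s ^ 4"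
proof (cases "s = 0")
  case False
  with assms have s: "s > 0" by simp
  have "1 - (2 - p) / 2 * (s\<^sup>2 - 1) \<le> 1 - (2 - p) / 2 * ln (s\<^sup>2)"
    using assms s ln_le_minus_one[of "s\<^sup>2"] by (simp add: mult_left_mono)
  also have "\<dots> = 1 + (p - 2) * ln s"
    using s by (simp add: ln_realpow field_simps)
  also have "\<dots> \<le> exp ((p - 2) * ln s)" by (rule exp_ge_add_one_self)
  also have "\<dots> = s powr (p - 2)" using s by (simp add: powr_def)
  finally have "s\<^sup>2 * (1 - (2 - p) / 2 * (s\<^sup>2 - 1)) \<le> s\<^sup>2 * s powr (p - 2)"
    by (intro mult_left_mono) auto
  also have "s\<^sup>2 * s powr (p - 2) = s powr p"
    using s powr_add[of s 2 "p - 2"] by simp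
  finally show ?thesis by (simp add: field_simps power2_eq_square power4_eq_xxxx)
qed simp

text \<open>The second moment is controlled by the p-th one because Bonami's inequality controls the
  fourth. The constant tends to 1 as p tends to 2; this makes exponents close to 2 cheap even for
  large \<open>d\<close>.\<close>

lemma walsh_interpolation:
  assumes V: "finite V" and c: "\<And>S. S \<subseteq> V \<Longrightarrow> d < card S \<Longrightarrow> c S = 0" and p: "0 < p" "p \<le> 2"
  shows "(\<Sum>S\<in>Pow V. (cmod (c S))\<^sup>2) powr (p / 2) \<le>
    3 powr (real d * (2 - p)) * cube_mean V (\<lambda>X. cmod (walsh_poly V c X) powr p)"
proof -
  define N where "N = (\<Sum>S\<in>Pow V. (cmod (c S))\<^sup>2)"
  define f where "f X = cmod (walsh_poly V c X)" for X
  have f0: "0 \<le> f X" for X by (simp add: f_def)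
  show ?thesis
  proof (cases "N = 0")
    case True
    then show ?thesis unfolding N_def[symmetric] by (auto intro!: mult_nonneg_nonneg cube_mean_nonneg)
  next
    case False
    then have N: "N > 0" by (simp add: N_def sum_nonneg less_le)
    \<comment> \<open>With this scale Bonami's inequality reads: fourth moment at most
      \<open>\<tau>\<^sup>2\<close> times the second. In the mean of the tangent bound for
      \<open>f X / \<tau>\<close> both terms are then multiples of N /
      \<open>\<tau>\<^sup>2\<close>, with total coefficient (4 - p)/2 - (2 - p)/2 = 1.\<close>
    define \<tau> where "\<tau> = 3 ^ d * sqrt N"
    have \<tau>: "\<tau> > 0" using N by (simp add: \<tau>_def)
    have \<tau>2: "\<tau>\<^sup>2 = 9 ^ d * N"
    proof -
      have "(3 ^ d)\<^sup>2 = (3\<^sup>2 :: real) ^ d" by (simp only: power_mult[symmetric] mult.commute)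
      then show ?thesis using N by (simp add: \<tau>_def power_mult_distrib)
    qed
    have E2: "cube_mean V (\<lambda>X. (f X)\<^sup>2) = N"
      unfolding f_def N_def by (rule walsh_parseval[OF V])
    have E4: "cube_mean V (\<lambda>X. (f X) ^ 4) \<le> \<tau>\<^sup>2 * N"
    proof -
      have "cube_mean V (\<lambda>X. (f X) ^ 4) \<le> 9 ^ d * N\<^sup>2"
        unfolding f_def N_def by (rule bonami_four_two[OF V c])
      then show ?thesis unfolding \<tau>2 by (simp only: power2_eq_square mult.assoc)
    qed
    have "\<tau> powr p * (N / \<tau>\<^sup>2) = \<tau> powr p * ((4 - p) / 2 * (N / \<tau>\<^sup>2) - (2 - p) / 2 * (\<tau>\<^sup>2 * N / \<tau> ^ 4))"
      using \<tau> by (simp add: power2_eq_square power4_eq_xxxx field_simps)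
    also have "\<dots> \<le> \<tau> powr p * ((4 - p) / 2 * (N / \<tau>\<^sup>2) - (2 - p) / 2 * (cube_mean V (\<lambda>X. (f X) ^ 4) / \<tau> ^ 4))"
      using \<tau> p E4 by (intro mult_left_mono diff_left_mono divide_right_mono) auto
    also have "\<dots> = cube_mean V (\<lambda>X. \<tau> powr p * ((4 - p) / 2 * (f X / \<tau>)\<^sup>2 - (2 - p) / 2 * (f X / \<tau>) ^ 4))"
    proof -
      have "x * (u * (v / t) - w * (y / z)) = x * (u / t) * v - x * (w / z) * y" for x u v t w y z :: real
        by (simp add: right_diff_distrib)
      then show ?thesis
        by (simp only: power_divide cube_mean_diff cube_mean_cmult E2)
    qed
    also have "\<dots> \<le> cube_mean V (\<lambda>X. \<tau> powr p * (f X / \<tau>) powr p)"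
      using p f0 \<tau> by (intro cube_mean_mono mult_left_mono powr_ge_tangent) auto
    also have "\<dots> = cube_mean V (\<lambda>X. f X powr p)"
      using \<tau> f0 by (simp add: powr_divide)
    finally have *: "\<tau> powr p * (N / \<tau>\<^sup>2) \<le> cube_mean V (\<lambda>X. f X powr p)" .
    have e1: "\<tau> powr p * (N / \<tau>\<^sup>2) = \<tau> powr p / 9 ^ d"
      using N by (simp add: \<tau>2)
    have e2: "\<tau> powr p = 3 powr (real d * p) * N powr (p / 2)"
    proof -
      have "\<tau> = 3 powr real d * N powr (1 / 2)"
        using N by (simp add: \<tau>_def powr_half_sqrt powr_realpow)
      then show ?thesis using N by (simp add: powr_mult powr_powr)
    qed
    have e3: "(9::real) ^ d = 3 powr (2 * real d)"
    proof -
      have "(3::real) powr (2 * real d) = (3 powr 2) powr real d" by (simp only: powr_powr)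
      then show ?thesis by (simp add: powr_realpow)
    qed
    have e4: "3 powr (real d * p) * N powr (p / 2) / 3 powr (2 * real d) = N powr (p / 2) / 3 powr (real d * (2 - p))"
    proof -
      have "real d * (2 - p) = 2 * real d - real d * p" by (simp add: algebra_simps)
      then show ?thesis by (simp only: powr_diff) simp
    qed
    have "N powr (p / 2) / 3 powr (real d * (2 - p)) \<le> cube_mean V (\<lambda>X. f X powr p)"
      using * by (simp only: e1) (simp only: e2 e3 e4)
    then show ?thesis
      unfolding N_def[symmetric] f_def[symmetric] by (subst (asm) pos_divide_le_eq) (simp_all add: mult.commute)
  qed
qed

lemma walsh_family_interpolation:
  assumes V: "finite V" and K: "finite K" and s: "inj_on s K" "\<And>i. i \<in> K \<Longrightarrow> s i \<subseteq> V"
    "\<And>i. i \<in> K \<Longrightarrow> card (s i) \<le> d" and p: "0 < p" "p \<le> 2"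
  shows "(\<Sum>i\<in>K. (cmod (c i))\<^sup>2) powr (p / 2) \<le>
    3 powr (real d * (2 - p)) * cube_mean V (\<lambda>X. cmod (\<Sum>i\<in>K. c i * of_real (walsh (s i) X)) powr p)"
proof -
  define c' where "c' S = (if S \<in> s ` K then c (the_inv_into K s S) else 0)" for S
  have c': "c' (s i) = c i" if "i \<in> K" for i
    using that s by (simp add: c'_def the_inv_into_f_f)
  have sub: "s ` K \<subseteq> Pow V" using s by auto
  have 1: "(\<Sum>S\<in>Pow V. (cmod (c' S))\<^sup>2) = (\<Sum>i\<in>K. (cmod (c i))\<^sup>2)"
  proof -
    have "(\<Sum>S\<in>Pow V. (cmod (c' S))\<^sup>2) = (\<Sum>S\<in>s ` K. (cmod (c' S))\<^sup>2)"
      using sub V by (intro sum.mono_neutral_right) (auto simp: c'_def)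
    then show ?thesis using s c' by (simp add: sum.reindex)
  qed
  have 2: "walsh_poly V c' X = (\<Sum>i\<in>K. c i * of_real (walsh (s i) X))" for X
  proof -
    have "walsh_poly V c' X = (\<Sum>S\<in>s ` K. c' S * of_real (walsh S X))"
      unfolding walsh_poly_def using sub V by (intro sum.mono_neutral_right) (auto simp: c'_def)
    then show ?thesis using s c' by (simp add: sum.reindex)
  qed
  show ?thesis
    using walsh_interpolation[OF V _ p, of d c'] s(3) unfolding 1 2 by (force simp: c'_def)
qed

section \<open>Blei inequality and the multilinear estimate\<close>

text \<open>AM-GM replaces the usual iterated Hoelder inequality. After division by
  \<open>D\<close>, the p-th power of \<open>a i\<close> is the geometric mean of k + 1 weights: one
  for each coordinate, and one for the product of all slice norms. The mixed norm hypothesis says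
  that each weight has total mass at most 1.\<close>

lemma blei:
  fixes a :: "(nat \<Rightarrow> 'b) \<Rightarrow> real"
  assumes k: "k \<ge> 1" and fin: "\<And>l. l < k \<Longrightarrow> finite (A l)" and D: "0 \<le> D"
    and a: "\<And>i. 0 \<le> a i"
    and mixed: "\<And>l. l < k \<Longrightarrow> (\<Sum>j\<in>A l. sqrt (\<Sum>i | i \<in> PiE {..<k} A \<and> i l = j. (a i)\<^sup>2)) \<le> D"
  shows "(\<Sum>i\<in>PiE {..<k} A. a i powr (2 * real k / (real k + 1))) \<le> D powr (2 * real k / (real k + 1))"
proof -
  define I where "I = PiE {..<k} A"
  define p where "p = 2 * real k / (real k + 1)"
  define s where "s l j = sqrt (\<Sum>i | i \<in> I \<and> i l = j. (a i)\<^sup>2)" for l j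
  have finI: "finite I" unfolding I_def using fin by (intro finite_PiE) auto
  have s0: "0 \<le> s l j" for l j by (simp add: s_def sum_nonneg)
  have sD: "(\<Sum>j\<in>A l. s l j) \<le> D" if "l < k" for l
    using mixed[OF that] by (simp add: s_def I_def)
  have as: "(a i)\<^sup>2 \<le> (s l (i l))\<^sup>2" if "i \<in> I" for i l
    unfolding s_def using finI that a by (subst real_sqrt_pow2) (auto intro!: sum_nonneg member_le_sum)
  then have as: "a i \<le> s l (i l)" if "i \<in> I" for i l
    using that s0 by (meson power2_le_imp_le)
  have IA: "i l \<in> A l" if "i \<in> I" "l < k" for i l
    using that by (auto simp: I_def)
  have aD: "a i \<le> D" if "i \<in> I" for i
  proof -
    have "a i \<le> s 0 (i 0)" using as that by auto
    also have "\<dots> \<le> (\<Sum>j\<in>A 0. s 0 j)"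
      using k that IA fin s0 by (intro member_le_sum) auto
    also have "\<dots> \<le> D" using k sD by auto
    finally show ?thesis .
  qed
  show ?thesis
  proof (cases "D = 0")
    case True
    then have "a i = 0" if "i \<in> I" for i using aD[OF that] a[of i] by simp
    then show ?thesis using True by (simp add: I_def)
  next
    case False
    with D have D: "D > 0" by simp
    \<comment> \<open>The product over \<open>l \<le> k\<close> cancels the slice norms and leaves
      (a i / D)^(2k), whose (k+1)-th root has exponent p. Vanishing slice norms are harmless: the
      quotient is then 0, and indices with \<open>a i = 0\<close> are treated apart.\<close>
    define q where "q l i = (if l = k then (\<Prod>l<k. s l (i l)) / D ^ k else (a i)\<^sup>2 / (s l (i l) * D))" for l i
    have q0: "0 \<le> q l i" for l i
      using s0 D by (auto simp: q_def intro!: divide_nonneg_pos prod_nonneg divide_nonneg_nonneg)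
    have pt: "a i powr p \<le> D powr p * (\<Sum>l\<le>k. q l i / (real k + 1))" if i: "i \<in> I" for i
    proof (cases "a i = 0")
      case True
      then show ?thesis using q0 by (auto intro!: mult_nonneg_nonneg sum_nonneg)
    next
      case False
      then have ai: "a i > 0" using a[of i] by simp
      have sp: "s l (i l) > 0" for l using as[OF i, of l] ai by linarith
      have "(\<Prod>l\<le>k. q l i) = (\<Prod>l<k. (a i)\<^sup>2 / (s l (i l) * D)) * ((\<Prod>l<k. s l (i l)) / D ^ k)"
        by (subst lessThan_Suc_atMost[symmetric]) (simp add: q_def)
      also have "\<dots> = ((a i)\<^sup>2) ^ k / (D ^ k * D ^ k)"
      proof -
        have "(\<Prod>l<k. s l (i l)) \<noteq> 0" using sp by (simp add: less_imp_neq[symmetric])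
        then show ?thesis by (simp add: prod_dividef prod.distrib)
      qed
      also have "\<dots> = (a i / D) ^ (2 * k)"
        by (simp add: power_mult power_divide power2_eq_square power_mult_distrib)
      also have "\<dots> = (a i / D) powr (2 * real k)"
        using ai D by (subst powr_realpow[symmetric]) auto
      finally have "(\<Prod>l\<le>k. q l i) powr (1 / (real k + 1)) = (a i / D) powr p"
        by (simp add: powr_powr p_def)
      moreover have "(\<Prod>l\<le>k. q l i) powr (1 / card {..k}) \<le> (\<Sum>l\<le>k. q l i / card {..k})"
        by (rule arith_geom_mean) (use q0 in auto)
      ultimately have "(a i / D) powr p \<le> (\<Sum>l\<le>k. q l i / (real k + 1))"
        by (simp add: add.commute)
      then have "D powr p * (a i / D) powr p \<le> D powr p * (\<Sum>l\<le>k. q l i / (real k + 1))"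
        by (intro mult_left_mono) auto
      then show ?thesis using ai D by (simp add: powr_divide)
    qed
    have qsum: "(\<Sum>i\<in>I. q l i) \<le> 1" if "l \<le> k" for l
    proof (cases "l = k")
      case True
      have "(\<Sum>i\<in>I. q l i) = (\<Prod>l<k. \<Sum>j\<in>A l. s l j) / D ^ k"
        unfolding q_def True I_def sum_divide_distrib[symmetric] using fin by (subst prod_sum_PiE) (auto simp: sum_divide_distrib)
      also have "(\<Prod>l<k. \<Sum>j\<in>A l. s l j) \<le> (\<Prod>l<k. D)"
        using s0 sD by (intro prod_mono) (auto intro: sum_nonneg)
      finally show ?thesis using D by (simp add: divide_right_mono)
    next
      case False
      with that have l: "l < k" by simp
      have "(\<Sum>i\<in>I. q l i) = (\<Sum>j\<in>A l. \<Sum>i | i \<in> I \<and> i l = j. q l i)"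
        using finI fin[OF l] IA l by (intro sum.group[symmetric]) auto
      also have "\<dots> = (\<Sum>j\<in>A l. (s l j)\<^sup>2 / (s l j * D))"
      proof (intro sum.cong refl)
        fix j
        have "(\<Sum>i | i \<in> I \<and> i l = j. q l i) = (\<Sum>i | i \<in> I \<and> i l = j. (a i)\<^sup>2 / (s l j * D))"
          using False by (intro sum.cong) (auto simp: q_def)
        also have "\<dots> = (s l j)\<^sup>2 / (s l j * D)"
          by (simp add: s_def sum_divide_distrib[symmetric] sum_nonneg)
        finally show "(\<Sum>i | i \<in> I \<and> i l = j. q l i) = (s l j)\<^sup>2 / (s l j * D)" .
      qed
      also have "\<dots> = (\<Sum>j\<in>A l. s l j) / D"
        unfolding sum_divide_distrib by (intro sum.cong refl) (auto simp: power2_eq_square)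
      also have "\<dots> \<le> 1" using sD[OF l] D by simp
      finally show ?thesis .
    qed
    have "(\<Sum>i\<in>I. a i powr p) \<le> (\<Sum>i\<in>I. D powr p * (\<Sum>l\<le>k. q l i / (real k + 1)))"
      by (intro sum_mono pt)
    also have "\<dots> = D powr p * (\<Sum>l\<le>k. (\<Sum>i\<in>I. q l i) / (real k + 1))"
      unfolding sum_distrib_left[symmetric] by (subst sum.swap) (simp add: sum_divide_distrib)
    also have "\<dots> \<le> D powr p * (\<Sum>l\<le>k. 1 / (real k + 1))"
      using qsum by (intro mult_left_mono sum_mono divide_right_mono) auto
    also have "\<dots> = D powr p" by (simp add: add.commute)
    finally show ?thesis by (simp add: I_def p_def)
  qed
qed

section \<open>Power means and mixed norms of multilinear forms\<close>

lemma powr_bernoulli: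
  fixes x p :: real
  assumes x: "0 < x" and p: "1 \<le> p"
  shows "1 + p * (x - 1) \<le> x powr p"
proof -
  have "1 - 1 / x \<le> ln x"
    using ln_le_minus_one[of "1 / x"] x by (simp add: ln_div)
  then have "1 + (p - 1) * (1 - 1 / x) \<le> 1 + (p - 1) * ln x"
    using p by (simp add: mult_left_mono)
  also have "\<dots> \<le> exp ((p - 1) * ln x)" by (rule exp_ge_add_one_self)
  also have "\<dots> = x powr (p - 1)" using x by (simp add: powr_def)
  finally have "x * (1 + (p - 1) * (1 - 1 / x)) \<le> x * x powr (p - 1)"
    using x by (intro mult_left_mono) auto
  also have "x * x powr (p - 1) = x powr p"
    using x powr_add[of x 1 "p - 1"] by simp
  also have "x * (1 + (p - 1) * (1 - 1 / x)) = 1 + p * (x - 1)"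
    using x by (simp add: field_simps)
  finally show ?thesis .
qed

text \<open>Hoelder's inequality against the constant 1, obtained by adding tangent inequalities.
  \<open>N\<close> is real and only bounds the cardinality, so that a bound n^k for the number of
  tuples can be inserted directly.\<close>

lemma sum_le_power_mean:
  fixes b :: "'a \<Rightarrow> real"
  assumes "finite I" "\<And>i. i \<in> I \<Longrightarrow> 0 \<le> b i" "1 \<le> p" "0 \<le> D" "(\<Sum>i\<in>I. b i powr p) \<le> D powr p"
    and cardI: "real (card I) \<le> N"
  shows "(\<Sum>i\<in>I. b i) \<le> N powr (1 - 1 / p) * D"
proof (cases "D = 0 \<or> N \<le> 0")
  case True
  then show ?thesis
  proof
    assume "D = 0"
    then have "(\<Sum>i\<in>I. b i powr p) \<le> 0" using assms by simp
    then have "(\<Sum>i\<in>I. b i powr p) = 0" by (meson sum_nonneg powr_ge_zero order_antisym)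
    then have "b i = 0" if "i \<in> I" for i
      using that assms by (simp add: sum_nonneg_eq_0_iff)
    then show ?thesis using \<open>D = 0\<close> by simp
  next
    assume "N \<le> 0"
    then have "card I = 0" using cardI by linarith
    then show ?thesis using assms by simp
  qed
next
  case False
  then have D: "D > 0" and N: "N > 0" using assms by auto
  \<comment> \<open>The common value of the \<open>b i\<close> in the extremal case, where N equal
    terms satisfy N t^p = D^p; the tangents are taken there.\<close>
  define t where "t = D * N powr (- 1 / p)"
  have t: "t > 0" using D N by (simp add: t_def)
  have pt: "b i \<le> (1 - 1 / p) * t + (1 / p) * (t powr (1 - p) * b i powr p)" if "i \<in> I" for i
  proof -
    have b: "0 \<le> b i" using assms that by auto
    have "b i / t \<le> (1 - 1 / p) + (1 / p) * (b i / t) powr p"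
    proof (cases "b i = 0")
      case True
      then show ?thesis using assms by simp
    next
      case False
      then have x: "b i / t > 0" using b t by simp
      have "p * (b i / t - 1) \<le> (b i / t) powr p - 1"
        using powr_bernoulli[OF x \<open>1 \<le> p\<close>] by simp
      then have "b i / t - 1 \<le> ((b i / t) powr p - 1) / p"
        using \<open>1 \<le> p\<close> by (subst pos_le_divide_eq) (auto simp: mult.commute)
      then show ?thesis by (simp add: diff_divide_distrib)
    qed
    then have "t * (b i / t) \<le> t * ((1 - 1 / p) + (1 / p) * (b i / t) powr p)"
      using t by (intro mult_left_mono) auto
    also have "\<dots> = (1 - 1 / p) * t + (1 / p) * (t powr (1 - p) * b i powr p)"
      using t b by (simp add: powr_divide powr_diff field_simps)
    finally show ?thesis using t by simp
  qed
  have "(\<Sum>i\<in>I. b i) \<le> (\<Sum>i\<in>I. (1 - 1 / p) * t + (1 / p) * (t powr (1 - p) * b i powr p))"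
    by (intro sum_mono pt)
  also have "\<dots> = real (card I) * ((1 - 1 / p) * t) + (1 / p) * (t powr (1 - p) * (\<Sum>i\<in>I. b i powr p))"
    by (simp add: sum.distrib sum_distrib_left)
  also have "\<dots> \<le> N * ((1 - 1 / p) * t) + (1 / p) * (t powr (1 - p) * D powr p)"
    using assms t by (intro add_mono mult_right_mono mult_left_mono mult_nonneg_nonneg) auto
  also have "t powr (1 - p) * D powr p = N * t"
  proof -
    have "t powr (1 - p) * D powr p = D powr (1 - p) * N powr ((- 1 / p) * (1 - p)) * D powr p"
      using D N by (simp add: t_def powr_mult powr_powr)
    also have "(- 1 / p) * (1 - p) = 1 + (- 1 / p)" using assms by (simp add: field_simps)
    also have "D powr (1 - p) * N powr (1 + (- 1 / p)) * D powr p = D * (N * N powr (- 1 / p))"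
      using D N by (simp only: powr_add powr_diff) simp
    finally show ?thesis by (simp add: t_def)
  qed
  also have "N * ((1 - 1 / p) * t) + (1 / p) * (N * t) = N * t"
    by (simp add: algebra_simps)
  also have "N * t = N powr (1 - 1 / p) * D"
    using N powr_add[of N 1 "- 1 / p"] by (simp add: t_def)
  finally show ?thesis .
qed

lemma inj_on_drop_coordinate:
  assumes "l0 < k"
  shows "inj_on (\<lambda>i. (\<lambda>l. (l, i l)) ` ({..<k} - {l0})) {i \<in> PiE {..<k} A. i l0 = j}"
proof (rule inj_onI)
  fix i i' assume i: "i \<in> {i \<in> PiE {..<k} A. i l0 = j}" "i' \<in> {i \<in> PiE {..<k} A. i l0 = j}"
    and eq: "(\<lambda>l. (l, i l)) ` ({..<k} - {l0}) = (\<lambda>l. (l, i' l)) ` ({..<k} - {l0})"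
  have "i l = i' l" if "l < k" for l
  proof (cases "l = l0")
    case False
    then have "(l, i l) \<in> (\<lambda>l. (l, i' l)) ` ({..<k} - {l0})"
      using that unfolding eq[symmetric] by auto
    then show ?thesis by auto
  qed (use i in auto)
  then show "i = i'"
    using i by (intro PiE_ext[of i "{..<k}" A i']) auto
qed

text \<open>This supplies the hypothesis of \<open>blei\<close>. With all blocks except
  \<open>l0\<close> set to signs, the variables of block \<open>l0\<close> can align the phases, so
  the absolute values of the linear coefficients sum to at most \<open>M\<close>. Each coefficient
  is a Walsh polynomial of degree k - 1, and the moment comparison with p = 1 replaces its mean
  modulus by the l2 norm at the cost 3^(k-1).\<close>

lemma multilinear_mixed_bound:
  fixes q :: "(nat \<Rightarrow> 'b) \<Rightarrow> complex"
  assumes fin: "\<And>l. l < k \<Longrightarrow> finite (A l)" and l0: "l0 < k"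
    and bd: "\<And>x. (\<And>l j. cmod (x l j) = 1) \<Longrightarrow>
      cmod (\<Sum>i\<in>PiE {..<k} A. q i * (\<Prod>l<k. x l (i l))) \<le> M"
  shows "(\<Sum>j\<in>A l0. sqrt (\<Sum>i | i \<in> PiE {..<k} A \<and> i l0 = j. (cmod (q i))\<^sup>2)) \<le> 3 ^ (k - 1) * M"
proof -
  define I where "I = PiE {..<k} A"
  have finI: "finite I" unfolding I_def using fin by (intro finite_PiE) auto
  \<comment> \<open>Signs are indexed by pairs of a block and an element: the sets
    \<open>A l\<close> may overlap, while the blocks carry independent variables.\<close>
  define V where "V = Sigma {..<k} A"
  have finV: "finite V" unfolding V_def using fin by auto
  define s where "s i = (\<lambda>l. (l, i l)) ` ({..<k} - {l0})" for i :: "nat \<Rightarrow> 'b"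
  define g where "g j Y = (\<Sum>i | i \<in> I \<and> i l0 = j. q i * of_real (walsh (s i) Y))" for j Y
  have one: "sqrt (\<Sum>i | i \<in> I \<and> i l0 = j. (cmod (q i))\<^sup>2) \<le> 3 ^ (k - 1) * cube_mean V (\<lambda>Y. cmod (g j Y))" for j
  proof -
    have "(\<Sum>i | i \<in> I \<and> i l0 = j. (cmod (q i))\<^sup>2) powr (1 / 2) \<le>
        3 powr (real (k - 1) * (2 - 1)) * cube_mean V (\<lambda>Y. cmod (\<Sum>i | i \<in> I \<and> i l0 = j. q i * of_real (walsh (s i) Y)) powr 1)"
    proof (rule walsh_family_interpolation[OF finV])
      show "inj_on s {i \<in> I. i l0 = j}"
        unfolding s_def I_def by (rule inj_on_drop_coordinate[OF l0])
      show "s i \<subseteq> V" if "i \<in> {i \<in> I. i l0 = j}" for i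
        using that by (auto simp: s_def V_def I_def)
      show "card (s i) \<le> k - 1" for i
        unfolding s_def using l0 by (intro order_trans[OF card_image_le]) auto
    qed (use finI in auto)
    then show ?thesis
      by (simp add: g_def powr_half_sqrt sum_nonneg powr_realpow)
  qed
  have pt: "(\<Sum>j\<in>A l0. cmod (g j Y)) \<le> M" for Y
  proof -
    \<comment> \<open>Block \<open>l0\<close> carries the conjugate phase of \<open>g j Y\<close>
      (and 1 where that is 0); the other blocks carry the signs encoded by \<open>Y\<close>.\<close>
    define x where "x l j = (if l = l0 then (if g j Y = 0 then 1 else of_real (cmod (g j Y)) / g j Y)
        else if (l, j) \<in> Y then - 1 else 1)" for l j
    have x1: "cmod (x l j) = 1" for l j by (simp add: x_def norm_divide)
    have xg: "x l0 j * g j Y = of_real (cmod (g j Y))" for j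
      by (simp add: x_def)
    have w: "(\<Prod>l<k. x l (i l)) = x l0 (i l0) * of_real (walsh (s i) Y)" for i
    proof -
      have "(\<Prod>l<k. x l (i l)) = x l0 (i l0) * (\<Prod>l\<in>{..<k} - {l0}. x l (i l))"
        using l0 by (intro prod.remove) auto
      also have "(\<Prod>l\<in>{..<k} - {l0}. x l (i l)) = of_real (walsh (s i) Y)"
      proof -
        have "of_real (walsh (s i) Y) = (\<Prod>l\<in>{..<k} - {l0}. complex_of_real (if (l, i l) \<in> Y then - 1 else 1))"
          unfolding walsh_def s_def of_real_prod by (subst prod.reindex) (auto simp: inj_on_def)
        also have "\<dots> = (\<Prod>l\<in>{..<k} - {l0}. x l (i l))"
          by (intro prod.cong refl) (simp add: x_def)
        finally show ?thesis ..
      qed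
      finally show ?thesis .
    qed
    have "(\<Sum>i\<in>I. q i * (\<Prod>l<k. x l (i l))) = (\<Sum>j\<in>A l0. \<Sum>i | i \<in> I \<and> i l0 = j. q i * (\<Prod>l<k. x l (i l)))"
      using finI fin[OF l0] l0 by (intro sum.group[symmetric]) (auto simp: I_def)
    also have "\<dots> = (\<Sum>j\<in>A l0. x l0 j * g j Y)"
      unfolding w g_def sum_distrib_left by (intro sum.cong refl) auto
    also have "\<dots> = of_real (\<Sum>j\<in>A l0. cmod (g j Y))"
      by (simp add: xg)
    finally have "cmod (of_real (\<Sum>j\<in>A l0. cmod (g j Y))) \<le> M"
      using bd[of x] x1 by (simp add: I_def)
    then show ?thesis
      unfolding norm_of_real using abs_ge_self order_trans by blast
  qed
  have "(\<Sum>j\<in>A l0. sqrt (\<Sum>i | i \<in> I \<and> i l0 = j. (cmod (q i))\<^sup>2)) \<le>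
      (\<Sum>j\<in>A l0. 3 ^ (k - 1) * cube_mean V (\<lambda>Y. cmod (g j Y)))"
    by (intro sum_mono one)
  also have "\<dots> = 3 ^ (k - 1) * cube_mean V (\<lambda>Y. \<Sum>j\<in>A l0. cmod (g j Y))"
    by (simp add: cube_mean_sum sum_distrib_left)
  also have "\<dots> \<le> 3 ^ (k - 1) * cube_mean V (\<lambda>Y. M)"
    by (intro mult_left_mono cube_mean_mono pt) auto
  finally show ?thesis by (simp add: cube_mean_const[OF finV] I_def)
qed

text \<open>For every fixed sign vector on \<open>B\<close> Blei's inequality applies to the
  remaining k-linear form. Averaging the p-th powers over the signs and comparing moments brings in
  the l2 norms over \<open>B\<close>. Since 2 - p = p / k, the price of degree \<open>d\<close> is
  only 3^(d/k). Hoelder over at most n^k tuples contributes the exponent k (1 - 1/p) = (k -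
  1)/2.\<close>

theorem multilinear_walsh_l1_l2:
  fixes c :: "(nat \<Rightarrow> 'b) \<Rightarrow> 'a set \<Rightarrow> complex"
  assumes k: "k \<ge> 1" and fin: "\<And>l. l < k \<Longrightarrow> finite (A l)" and cardA: "\<And>l. l < k \<Longrightarrow> card (A l) \<le> n"
    and B: "finite B" and c: "\<And>i S. S \<subseteq> B \<Longrightarrow> d < card S \<Longrightarrow> c i S = 0"
    and bd: "\<And>x X. (\<And>l j. cmod (x l j) = 1) \<Longrightarrow> X \<subseteq> B \<Longrightarrow>
      cmod (\<Sum>i\<in>PiE {..<k} A. walsh_poly B (c i) X * (\<Prod>l<k. x l (i l))) \<le> M"
  shows "(\<Sum>i\<in>PiE {..<k} A. sqrt (\<Sum>S\<in>Pow B. (cmod (c i S))\<^sup>2)) \<le>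
    real n powr ((real k - 1) / 2) * (3 powr (real d / real k) * (3 ^ (k - 1) * M))"
proof -
  define I where "I = PiE {..<k} A"
  define p where "p = 2 * real k / (real k + 1)"
  have p: "1 \<le> p" "p \<le> 2" using k by (auto simp: p_def field_simps)
  have finI: "finite I" unfolding I_def using fin by (intro finite_PiE) auto
  have M0: "0 \<le> M"
    by (rule order_trans[OF norm_ge_zero bd[of "\<lambda>_ _. 1" "{}"]]) auto
  define D where "D = 3 ^ (k - 1) * M"
  have D0: "0 \<le> D" using M0 by (simp add: D_def)
  define b where "b i = sqrt (\<Sum>S\<in>Pow B. (cmod (c i S))\<^sup>2)" for i
  have fiber: "(\<Sum>i\<in>I. cmod (walsh_poly B (c i) X) powr p) \<le> D powr p" if X: "X \<subseteq> B" for X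
    unfolding I_def p_def
  proof (rule blei[OF k fin D0])
    fix l assume l: "l < k"
    show "(\<Sum>j\<in>A l. sqrt (\<Sum>i | i \<in> PiE {..<k} A \<and> i l = j. (cmod (walsh_poly B (c i) X))\<^sup>2)) \<le> D"
      unfolding D_def using X by (intro multilinear_mixed_bound fin l bd) auto
  qed auto
  have bp: "b i powr p \<le> 3 powr (real d * (2 - p)) * cube_mean B (\<lambda>X. cmod (walsh_poly B (c i) X) powr p)" for i
    using walsh_interpolation[OF B, of d "c i" p] c p
    by (simp add: b_def powr_half_sqrt[symmetric] powr_powr sum_nonneg)
  have "(\<Sum>i\<in>I. b i powr p) \<le> (\<Sum>i\<in>I. 3 powr (real d * (2 - p)) * cube_mean B (\<lambda>X. cmod (walsh_poly B (c i) X) powr p))"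
    by (intro sum_mono bp)
  also have "\<dots> = 3 powr (real d * (2 - p)) * cube_mean B (\<lambda>X. \<Sum>i\<in>I. cmod (walsh_poly B (c i) X) powr p)"
    by (simp add: cube_mean_sum sum_distrib_left)
  also have "\<dots> \<le> 3 powr (real d * (2 - p)) * cube_mean B (\<lambda>X. D powr p)"
    by (intro mult_left_mono cube_mean_mono fiber) auto
  also have "\<dots> = (3 powr (real d / real k) * D) powr p"
  proof -
    have "real d * (2 - p) = real d / real k * p"
      using k by (simp add: p_def field_simps)
    then show ?thesis
      using D0 by (simp add: cube_mean_const[OF B] powr_mult powr_powr)
  qed
  finally have sum_bp: "(\<Sum>i\<in>I. b i powr p) \<le> (3 powr (real d / real k) * D) powr p" .
  have "card I = (\<Prod>l<k. card (A l))" by (simp add: I_def card_PiE)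
  also have "\<dots> \<le> (\<Prod>l<k. n)" using cardA by (intro prod_mono) auto
  finally have cardI: "real (card I) \<le> real n ^ k"
    by (simp flip: of_nat_power)
  have "(\<Sum>i\<in>I. b i) \<le> (real n ^ k) powr (1 - 1 / p) * (3 powr (real d / real k) * D)"
    using finI p D0 sum_bp cardI by (intro sum_le_power_mean) (auto simp: b_def sum_nonneg)
  also have "(real n ^ k) powr (1 - 1 / p) = real n powr ((real k - 1) / 2)"
  proof (cases "n = 0")
    case True
    then show ?thesis using k by simp
  next
    case False
    have e: "real k * (1 - 1 / p) = (real k - 1) / 2" using k by (simp add: p_def field_simps)
    have "(real n ^ k) powr (1 - 1 / p) = real n powr (real k * (1 - 1 / p))"
      using False by (subst powr_realpow[symmetric]) (auto simp: powr_powr)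
    then show ?thesis by (simp only: e)
  qed
  finally show ?thesis by (simp add: I_def b_def D_def)
qed

section \<open>Squarefree coefficients: random colourings\<close>

definition homog :: "nat \<Rightarrow> nat \<Rightarrow> (nat \<Rightarrow> nat) set" where
  "homog n m = {\<alpha> \<in> MI n. (\<Sum>j<n. \<alpha> j) = m}"

definition sqf :: "nat set \<Rightarrow> nat \<Rightarrow> nat" where
  "sqf T = (\<lambda>j. if j \<in> T then 1 else 0)"

lemma homog_le: "\<alpha> \<in> homog n m \<Longrightarrow> j < n \<Longrightarrow> \<alpha> j \<le> m"
  unfolding homog_def using member_le_sum[of j "{..<n}" \<alpha>] by auto

lemma inj_on_restrict_MI: "inj_on (\<lambda>\<alpha>. restrict \<alpha> {..<n}) (MI n)"
proof (rule inj_onI)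
  fix \<alpha> \<beta> assume *: "\<alpha> \<in> MI n" "\<beta> \<in> MI n" "restrict \<alpha> {..<n} = restrict \<beta> {..<n}"
  have "\<alpha> j = \<beta> j" if "j < n" for j
    using fun_cong[OF *(3), of j] that by simp
  then show "\<alpha> = \<beta>" by (rule MI_eqI[OF *(1,2)])
qed

lemma restrict_homog_subset: "(\<lambda>\<alpha>. restrict \<alpha> {..<n}) ` homog n m \<subseteq> PiE {..<n} (\<lambda>_. {..m})"
  by (auto simp: PiE_def extensional_def homog_le)

lemma finite_homog [simp]: "finite (homog n m)"
proof -
  have "finite ((\<lambda>\<alpha>. restrict \<alpha> {..<n}) ` homog n m)"
    by (rule finite_subset[OF restrict_homog_subset]) (auto intro: finite_PiE)
  then show ?thesis
    by (rule finite_imageD) (rule inj_on_subset[OF inj_on_restrict_MI], auto simp: homog_def)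
qed

text \<open>Extracting the part of degree one in each of the \<open>k\<close> blocks keeps the bound
  \<open>M\<close>. On it the block variables stay on the torus and those of \<open>B\<close> become
  signs. Restricting to signs merges indices on \<open>B\<close> of equal parity pattern, but a
  Walsh coefficient of top degree m - k receives a contribution from a single, squarefree index, so
  the wanted coefficients can be read off. Cauchy-Schwarz over the sets \<open>T\<close>
  finishes.\<close>

lemma colored_bound:
  fixes col :: "nat \<Rightarrow> nat"
  assumes A_def: "A = (\<lambda>l. {j. j < n \<and> col j = l})" and B_def: "B = {j. j < n \<and> k \<le> col j}"
    and k: "1 \<le> k" "k \<le> m" and bd: "torus_bounded n (homog n m) a M"
  shows "(\<Sum>i\<in>PiE {..<k} A. \<Sum>T | T \<subseteq> B \<and> card T = m - k. cmod (a (sqf (i ` {..<k} \<union> T)))) \<le>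
    real n powr ((real k - 1) / 2) * (3 powr (real (m - k) / real k) * (3 ^ (k - 1) * M)) *
    sqrt (real (card {T. T \<subseteq> {..<n} \<and> card T = m - k}))"
proof -
  define I where "I = PiE {..<k} A"
  have finA: "finite (A l)" for l by (simp add: A_def)
  have finB: "finite B" and BV: "B \<subseteq> {..<n}" by (auto simp: B_def)
  have finI: "finite I" unfolding I_def by (intro finite_PiE finA) auto
  have iI: "i l < n" "col (i l) = l" if "i \<in> I" "l < k" for i l
    using that by (auto simp: I_def A_def)
  define C where "C = {j. j < n \<and> col j < k}"
  have finC: "finite C" by (simp add: C_def)
  have split: "{..<n} = C \<union> B" "C \<inter> B = {}" by (auto simp: C_def B_def)
  have CA: "{j \<in> C. col j = l} = A l" if "l < k" for l
    using that by (auto simp: C_def A_def)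
  have sumC: "(\<Sum>j\<in>C. f j) = (\<Sum>l<k. \<Sum>j\<in>A l. f j)" for f :: "nat \<Rightarrow> nat"
  proof -
    have "(\<Sum>j\<in>C. f j) = (\<Sum>l<k. \<Sum>j\<in>{j \<in> C. col j = l}. f j)"
      using finC by (intro sum.group[symmetric]) (auto simp: C_def)
    then show ?thesis using CA by simp
  qed
  have prodC: "(\<Prod>j\<in>C. f j) = (\<Prod>l<k. \<Prod>j\<in>A l. f j)" for f :: "nat \<Rightarrow> complex"
  proof -
    have "(\<Prod>j\<in>C. f j) = (\<Prod>l<k. \<Prod>j\<in>{j \<in> C. col j = l}. f j)"
      using finC by (intro prod.group[symmetric]) (auto simp: C_def)
    then show ?thesis using CA by simp
  qed
  have sum_split: "(\<Sum>j<n. f j) = (\<Sum>l<k. \<Sum>j\<in>A l. f j) + (\<Sum>j\<in>B. f j)" for f :: "nat \<Rightarrow> nat"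
    unfolding split(1) using split finC finB by (simp add: sum.union_disjoint sumC)

  define F where "F k' = {\<alpha> \<in> homog n m. \<forall>l<k'. (\<Sum>j\<in>A l. \<alpha> j) = 1}" for k'
  have finF: "finite (F k')" for k' by (simp add: F_def)
  have bdF: "torus_bounded n (F k') a M" for k'
  proof (induction k')
    case 0
    then show ?case using bd by (simp add: F_def)
  next
    case (Suc k')
    have "F (Suc k') = {\<alpha> \<in> F k'. (\<Sum>j\<in>A k'. \<alpha> j) = 1}"
      by (auto simp: F_def less_Suc_eq)
    then show ?case
      using torus_bounded_block_degree[OF finF Suc.IH finA] by (auto simp: A_def)
  qed

  define \<Gamma> where "\<Gamma> = {\<gamma> :: nat \<Rightarrow> nat. (\<forall>j. \<gamma> j \<noteq> 0 \<longrightarrow> j \<in> B) \<and> (\<Sum>j\<in>B. \<gamma> j) = m - k}"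
  have "\<Gamma> \<subseteq> homog n (m - k)"
  proof
    fix \<gamma> assume g: "\<gamma> \<in> \<Gamma>"
    then have "(\<Sum>j<n. \<gamma> j) = (\<Sum>j\<in>B. \<gamma> j)"
      using BV by (intro sum.mono_neutral_right) (auto simp: \<Gamma>_def)
    then show "\<gamma> \<in> homog n (m - k)"
      using g BV by (auto simp: \<Gamma>_def homog_def MI_def)
  qed
  then have fin\<Gamma>: "finite \<Gamma>" by (rule finite_subset) simp
  define comb where "comb i \<gamma> = (\<lambda>j. if j \<in> C then (if i (col j) = j then 1 else 0) else \<gamma> j)"
    for i :: "nat \<Rightarrow> nat" and \<gamma> :: "nat \<Rightarrow> nat"
  have combA: "(\<Sum>j\<in>A l. comb i \<gamma> j) = 1" if "i \<in> I" "l < k" for i \<gamma> l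
  proof -
    have "(\<Sum>j\<in>A l. comb i \<gamma> j) = (\<Sum>j\<in>A l. if i l = j then 1 else 0)"
      using that by (intro sum.cong refl) (auto simp: comb_def A_def C_def)
    also have "\<dots> = 1" using that by (auto simp: sum.delta' finA I_def)
    finally show ?thesis .
  qed
  have combB: "comb i \<gamma> j = \<gamma> j" if "j \<in> B" for i \<gamma> j
    using that by (auto simp: comb_def B_def C_def)
  \<comment> \<open>Total degree one in a block means that exactly one variable of it is chosen;
    such an index is a choice function together with an index on \<open>B\<close> of degree m -
    k.\<close>
  have bij: "bij_betw (\<lambda>(i, \<gamma>). comb i \<gamma>) (I \<times> \<Gamma>) (F k)"
    unfolding bij_betw_def
  proof
    show "inj_on (\<lambda>(i, \<gamma>). comb i \<gamma>) (I \<times> \<Gamma>)"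
    proof (rule inj_onI, clarify)
      fix i \<gamma> i' \<gamma>' assume i: "i \<in> I" "i' \<in> I" and g: "\<gamma> \<in> \<Gamma>" "\<gamma>' \<in> \<Gamma>" and eq: "comb i \<gamma> = comb i' \<gamma>'"
      have "i l = i' l" if l: "l < k" for l
      proof -
        have "i l \<in> C" using i l iI by (auto simp: C_def)
        then show ?thesis
          using fun_cong[OF eq, of "i l"] iI[OF i(1) l] by (auto simp: comb_def split: if_splits)
      qed
      then have "i = i'"
        using i unfolding I_def by (intro PiE_ext[of i "{..<k}" A i']) auto
      moreover have "\<gamma> j = \<gamma>' j" for j
      proof (cases "j \<in> B")
        case True
        then show ?thesis using fun_cong[OF eq, of j] combB by simp
      next
        case False
        then have "\<gamma> j = 0" "\<gamma>' j = 0" using g unfolding \<Gamma>_def by blast+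
          then show ?thesis by simp
      qed
      ultimately show "i = i' \<and> \<gamma> = \<gamma>'" by auto
    qed
    show "(\<lambda>(i, \<gamma>). comb i \<gamma>) ` (I \<times> \<Gamma>) = F k"
    proof (intro equalityI subsetI)
      fix \<alpha> assume "\<alpha> \<in> (\<lambda>(i, \<gamma>). comb i \<gamma>) ` (I \<times> \<Gamma>)"
      then obtain i \<gamma> where i: "i \<in> I" and g: "\<gamma> \<in> \<Gamma>" and \<alpha>: "\<alpha> = comb i \<gamma>" by auto
      have "(\<Sum>j<n. \<alpha> j) = k + (m - k)"
        unfolding sum_split \<alpha> using g by (simp add: combA[OF i] combB \<Gamma>_def)
      moreover have "\<alpha> \<in> MI n"
        using g BV by (auto simp: \<alpha> MI_def comb_def C_def \<Gamma>_def)
      ultimately show "\<alpha> \<in> F k"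
        using k combA[OF i] by (simp add: F_def homog_def \<alpha>)
    next
      fix \<alpha> assume al: "\<alpha> \<in> F k"
      have "\<forall>l\<in>{..<k}. \<exists>j. j \<in> A l \<and> \<alpha> j = 1 \<and> (\<forall>b\<in>A l. j \<noteq> b \<longrightarrow> \<alpha> b = 0)"
      proof
        fix l assume "l \<in> {..<k}"
        then have "(\<Sum>j\<in>A l. \<alpha> j) = 1" using al by (simp add: F_def)
        then show "\<exists>j. j \<in> A l \<and> \<alpha> j = 1 \<and> (\<forall>b\<in>A l. j \<noteq> b \<longrightarrow> \<alpha> b = 0)"
          unfolding sum_eq_1_iff[OF finA] by blast
      qed
      then obtain i0 where i0: "\<And>l. l < k \<Longrightarrow> i0 l \<in> A l \<and> \<alpha> (i0 l) = 1 \<and> (\<forall>b\<in>A l. i0 l \<noteq> b \<longrightarrow> \<alpha> b = 0)"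
        by (metis lessThan_iff)
      define i where "i = restrict i0 {..<k}"
      define \<gamma> where "\<gamma> = (\<lambda>j. if j \<in> B then \<alpha> j else 0)"
      have "i \<in> I" using i0 by (auto simp: i_def I_def)
      moreover have "\<gamma> \<in> \<Gamma>"
        using al sum_split[of \<alpha>] by (auto simp: \<gamma>_def \<Gamma>_def F_def homog_def)
      moreover have "comb i \<gamma> = \<alpha>"
      proof
        fix j
        consider "j \<in> C" | "j \<in> B" | "j \<ge> n" using split by force
        then show "comb i \<gamma> j = \<alpha> j"
        proof cases
          case 1
          then have "col j < k" "j \<in> A (col j)" by (auto simp: C_def A_def)
          then show ?thesis using 1 i0[of "col j"] by (auto simp: comb_def i_def)
        next
          case 2
          then show ?thesis by (simp add: combB \<gamma>_def)
        next
          case 3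
          then have "\<alpha> j = 0" using al by (auto simp: F_def homog_def MI_def)
          then show ?thesis using 3 by (auto simp: comb_def C_def \<gamma>_def)
        qed
      qed
      ultimately show "\<alpha> \<in> (\<lambda>(i, \<gamma>). comb i \<gamma>) ` (I \<times> \<Gamma>)" by force
    qed
  qed

  \<comment> \<open>On sign vectors a monomial depends only on which exponents are odd.\<close>
  define oddset where "oddset \<gamma> = {j. odd (\<gamma> j)}" for \<gamma> :: "nat \<Rightarrow> nat"
  have oddB: "oddset \<gamma> \<subseteq> B" if "\<gamma> \<in> \<Gamma>" for \<gamma>
    using that by (auto simp: oddset_def \<Gamma>_def dest: odd_pos)
  have odd_le: "sqf (oddset \<gamma>) j \<le> \<gamma> j" for \<gamma> j
    by (auto simp: oddset_def sqf_def Suc_le_eq odd_pos)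
  have sqf_sum: "(\<Sum>j\<in>B. sqf T j) = card T" if "T \<subseteq> B" for T
    using that finB by (simp add: sqf_def sum.If_cases Int_absorb1)
  define c where "c i T = (\<Sum>\<gamma> | \<gamma> \<in> \<Gamma> \<and> oddset \<gamma> = T. a (comb i \<gamma>))" for i T
  have c0: "c i T = 0" if "T \<subseteq> B" "m - k < card T" for i T
  proof -
    have "False" if "\<gamma> \<in> \<Gamma>" "oddset \<gamma> = T" for \<gamma>
    proof -
      have "card T \<le> (\<Sum>j\<in>B. \<gamma> j)"
        using sum_mono[of B "sqf T" \<gamma>] odd_le[of \<gamma>] that(2) sqf_sum[OF \<open>T \<subseteq> B\<close>] by simp
      then show False using that \<open>m - k < card T\<close> by (simp add: \<Gamma>_def)
    qed
    then have "{\<gamma>. \<gamma> \<in> \<Gamma> \<and> oddset \<gamma> = T} = {}" by auto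
    then show ?thesis unfolding c_def by (simp only: sum.empty)
  qed
  \<comment> \<open>An index with odd set \<open>T\<close> dominates the indicator of
    \<open>T\<close>. If \<open>T\<close> already has m - k elements, both have the same sum over
    \<open>B\<close> and must coincide, so \<open>c i T\<close> is a single coefficient.\<close>
  have ctop: "c i T = a (sqf (i ` {..<k} \<union> T))" if i: "i \<in> I" and T: "T \<subseteq> B" "card T = m - k" for i T
  proof -
    have "{\<gamma>. \<gamma> \<in> \<Gamma> \<and> oddset \<gamma> = T} = {sqf T}"
    proof (intro equalityI subsetI)
      fix \<gamma> assume "\<gamma> \<in> {\<gamma>. \<gamma> \<in> \<Gamma> \<and> oddset \<gamma> = T}"
      then have g: "\<gamma> \<in> \<Gamma>" "oddset \<gamma> = T" by auto
      have "(\<Sum>j\<in>B. sqf T j) = (\<Sum>j\<in>B. \<gamma> j)"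
        using g T sqf_sum by (simp add: \<Gamma>_def)
      then have "sqf T j = \<gamma> j" if "j \<in> B" for j
        using sum_mono_inv[of "sqf T" B \<gamma> j] odd_le[of \<gamma>] g finB that by auto
      moreover have "sqf T j = \<gamma> j" if "j \<notin> B" for j
        using that g T by (auto simp: sqf_def \<Gamma>_def)
      ultimately have "sqf T = \<gamma>" by (intro ext) metis
      then show "\<gamma> \<in> {sqf T}" by simp
    next
      fix \<gamma> assume "\<gamma> \<in> {sqf T}"
      then show "\<gamma> \<in> {\<gamma>. \<gamma> \<in> \<Gamma> \<and> oddset \<gamma> = T}"
        using T sqf_sum[OF T(1)] unfolding \<Gamma>_def oddset_def by (auto simp: sqf_def split: if_splits)
    qed
    moreover have "comb i (sqf T) = sqf (i ` {..<k} \<union> T)"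
    proof
      fix j
      have "j \<in> i ` {..<k} \<longleftrightarrow> j \<in> C \<and> i (col j) = j"
        using iI[OF i] by (auto simp: C_def intro!: image_eqI[of _ _ "col j"])
      moreover have "j \<in> T \<Longrightarrow> j \<notin> C" using T split by auto
      ultimately show "comb i (sqf T) j = sqf (i ` {..<k} \<union> T) j"
        by (auto simp: comb_def sqf_def)
    qed
    ultimately show ?thesis by (simp add: c_def)
  qed

  have core: "(\<Sum>i\<in>I. sqrt (\<Sum>S\<in>Pow B. (cmod (c i S))\<^sup>2)) \<le>
    real n powr ((real k - 1) / 2) * (3 powr (real (m - k) / real k) * (3 ^ (k - 1) * M))"
    unfolding I_def
  proof (rule multilinear_walsh_l1_l2[OF k(1) finA _ finB c0])
    show "card (A l) \<le> n" for l
      using card_mono[of "{..<n}" "A l"] by (auto simp: A_def)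
    fix x :: "nat \<Rightarrow> nat \<Rightarrow> complex" and X assume x: "\<And>l j. cmod (x l j) = 1" and X: "X \<subseteq> B"
    \<comment> \<open>Coordinates outside \<open>C\<close> and \<open>X\<close>, including all those
      from \<open>n\<close> on, get the value 1.\<close>
    define z where "z j = (if j \<in> C then x (col j) j else if j \<in> X then - 1 else 1)" for j
    have z1: "cmod (z j) = 1" for j by (simp add: z_def x)
    have mono: "monomial n (comb i \<gamma>) z = of_real (walsh (oddset \<gamma>) X) * (\<Prod>l<k. x l (i l))"
      if i: "i \<in> I" and g: "\<gamma> \<in> \<Gamma>" for i \<gamma>
    proof -
      have "monomial n (comb i \<gamma>) z = (\<Prod>j\<in>C. z j ^ comb i \<gamma> j) * (\<Prod>j\<in>B. z j ^ comb i \<gamma> j)"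
        unfolding monomial_def split(1) using split finB finC by (simp add: prod.union_disjoint)
      also have "(\<Prod>j\<in>C. z j ^ comb i \<gamma> j) = (\<Prod>l<k. x l (i l))"
      proof (unfold prodC, intro prod.cong refl)
        fix l assume "l \<in> {..<k}"
        then have l: "l < k" by simp
        have "(\<Prod>j\<in>A l. z j ^ comb i \<gamma> j) = (\<Prod>j\<in>A l. if i l = j then x l j else 1)"
          using l by (intro prod.cong refl) (auto simp: z_def comb_def A_def C_def)
        also have "\<dots> = x l (i l)" using i l by (auto simp: prod.delta' finA I_def)
        finally show "(\<Prod>j\<in>A l. z j ^ comb i \<gamma> j) = x l (i l)" .
      qed
      also have "(\<Prod>j\<in>B. z j ^ comb i \<gamma> j) = (\<Prod>j\<in>B. if odd (\<gamma> j) then (if j \<in> X then - 1 else 1) else 1)"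
        using split by (intro prod.cong refl) (auto simp: combB z_def)
      also have "\<dots> = (\<Prod>j\<in>oddset \<gamma>. if j \<in> X then - 1 else 1)"
        using oddB[OF g] finB by (subst prod.inter_filter[symmetric]) (auto simp: oddset_def intro!: prod.cong)
      also have "\<dots> = of_real (walsh (oddset \<gamma>) X)"
        unfolding walsh_def of_real_prod by (intro prod.cong) auto
      finally show ?thesis by (simp add: mult.commute)
    qed
    have wp: "walsh_poly B (c i) X = (\<Sum>\<gamma>\<in>\<Gamma>. a (comb i \<gamma>) * of_real (walsh (oddset \<gamma>) X))" for i
    proof -
      have "(\<Sum>\<gamma>\<in>\<Gamma>. a (comb i \<gamma>) * of_real (walsh (oddset \<gamma>) X)) =
          (\<Sum>T\<in>Pow B. \<Sum>\<gamma>\<in>{\<gamma> \<in> \<Gamma>. oddset \<gamma> = T}. a (comb i \<gamma>) * of_real (walsh (oddset \<gamma>) X))"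
        using fin\<Gamma> finB oddB by (intro sum.group[symmetric]) auto
      also have "\<dots> = walsh_poly B (c i) X"
        unfolding walsh_poly_def c_def sum_distrib_right by (intro sum.cong) auto
      finally show ?thesis ..
    qed
    have "(\<Sum>i\<in>PiE {..<k} A. walsh_poly B (c i) X * (\<Prod>l<k. x l (i l))) =
        (\<Sum>i\<in>I. \<Sum>\<gamma>\<in>\<Gamma>. a (comb i \<gamma>) * monomial n (comb i \<gamma>) z)"
      unfolding wp I_def[symmetric] sum_distrib_right by (intro sum.cong refl) (simp add: mono mult_ac)
    also have "\<dots> = (\<Sum>(i, \<gamma>)\<in>I \<times> \<Gamma>. a (comb i \<gamma>) * monomial n (comb i \<gamma>) z)"
      by (rule sum.cartesian_product)
    also have "\<dots> = (\<Sum>\<alpha>\<in>F k. a \<alpha> * monomial n \<alpha> z)"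
      using sum.reindex_bij_betw[OF bij, of "\<lambda>\<alpha>. a \<alpha> * monomial n \<alpha> z"] by (simp add: case_prod_unfold)
    finally show "cmod (\<Sum>i\<in>PiE {..<k} A. walsh_poly B (c i) X * (\<Prod>l<k. x l (i l))) \<le> M"
      using torus_boundedD[OF bdF z1] by simp
  qed
  define N where "N = card {T. T \<subseteq> {..<n} \<and> card T = m - k}"
  have inner: "(\<Sum>T | T \<subseteq> B \<and> card T = m - k. cmod (a (sqf (i ` {..<k} \<union> T)))) \<le>
      sqrt (\<Sum>S\<in>Pow B. (cmod (c i S))\<^sup>2) * sqrt (real N)" if i: "i \<in> I" for i
  proof -
    define \<T> where "\<T> = {T. T \<subseteq> B \<and> card T = m - k}"
    have fin: "finite \<T>" using finB by (simp add: \<T>_def)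
    have "(\<Sum>T\<in>\<T>. cmod (a (sqf (i ` {..<k} \<union> T)))) = (\<Sum>T\<in>\<T>. cmod (c i T) * 1)"
      using ctop[OF i] by (simp add: \<T>_def)
    also have "\<dots> \<le> sqrt ((\<Sum>T\<in>\<T>. (cmod (c i T))\<^sup>2) * (\<Sum>T\<in>\<T>. 1\<^sup>2))"
      by (intro real_le_rsqrt Cauchy_Schwarz_ineq_sum)
    also have "\<dots> \<le> sqrt ((\<Sum>S\<in>Pow B. (cmod (c i S))\<^sup>2) * real N)"
    proof (intro real_sqrt_le_mono mult_mono)
      show "(\<Sum>T\<in>\<T>. (cmod (c i T))\<^sup>2) \<le> (\<Sum>S\<in>Pow B. (cmod (c i S))\<^sup>2)"
        using finB by (intro sum_mono2) (auto simp: \<T>_def)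
      have "card \<T> \<le> N"
        unfolding N_def \<T>_def using BV by (intro card_mono) (auto intro: finite_subset[OF _ finite_Pow_iff[THEN iffD2, of "{..<n}"]])
      then show "(\<Sum>T\<in>\<T>. 1\<^sup>2) \<le> real N" by simp
    qed (auto intro: sum_nonneg)
    finally show ?thesis by (simp add: \<T>_def real_sqrt_mult)
  qed
  have "(\<Sum>i\<in>I. \<Sum>T | T \<subseteq> B \<and> card T = m - k. cmod (a (sqf (i ` {..<k} \<union> T)))) \<le>
      (\<Sum>i\<in>I. sqrt (\<Sum>S\<in>Pow B. (cmod (c i S))\<^sup>2)) * sqrt (real N)"
    unfolding sum_distrib_right by (intro sum_mono inner)
  also have "\<dots> \<le> real n powr ((real k - 1) / 2) * (3 powr (real (m - k) / real k) * (3 ^ (k - 1) * M)) * sqrt (real N)"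
    by (intro mult_right_mono core) auto
  finally show ?thesis by (simp add: I_def N_def)
qed

section \<open>Averaging over colourings of the variables\<close>

lemma power_self_le_exp:
  assumes "1 \<le> k" "k \<le> m"
  shows "real m ^ m \<le> (real m * exp 1) ^ k * real (m - k) ^ (m - k)"
proof -
  define d where "d = m - k"
  have m: "m = k + d" using assms by (simp add: d_def)
  have "real m ^ d \<le> exp 1 ^ k * real d ^ d"
  proof (cases "d = 0")
    case False
    have "real m = real d * (1 + real k / real d)"
      using False by (simp add: m field_simps)
    then have "real m ^ d = real d ^ d * (1 + real k / real d) ^ d"
      by (simp add: power_mult_distrib)
    also have "\<dots> \<le> real d ^ d * exp (real k / real d) ^ d"
      by (intro mult_left_mono power_mono exp_ge_add_one_self) auto
    also have "exp (real k / real d) ^ d = exp (real k)"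
      using False by (simp add: exp_of_nat_mult[symmetric])
    finally show ?thesis by (simp add: exp_of_nat_mult[symmetric] mult.commute)
  qed (simp add: one_le_power)
  then have "real m ^ k * real m ^ d \<le> real m ^ k * (exp 1 ^ k * real d ^ d)"
    by (intro mult_left_mono) auto
  then show ?thesis
    by (simp add: m power_add power_mult_distrib mult_ac)
qed

text \<open>Double counting of pairs of a set and a colouring. Each set of size \<open>m\<close> is
  split as \<open>colored_bound\<close> wants by at least the proportion (m - k)^(m - k) / m^m of
  all colourings, and for each colouring the good sets contribute at most the bound proved there.
  Inverting the proportion costs (e m)^k, polynomial in m for fixed \<open>k\<close>; a loss
  exponential in m with a fixed base would destroy the sharp constant.\<close>

lemma squarefree_part_bound:
  assumes k: "1 \<le> k" "k \<le> m" and bd: "torus_bounded n (homog n m) a M"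
  shows "(\<Sum>S | S \<subseteq> {..<n} \<and> card S = m. cmod (a (sqf S))) \<le>
    (real m * exp 1) ^ k * (real n powr ((real k - 1) / 2) *
      (3 powr (real (m - k) / real k) * (3 ^ (k - 1) * M)) *
      sqrt (real (card {T. T \<subseteq> {..<n} \<and> card T = m - k})))"
proof -
  define \<S> where "\<S> = {S. S \<subseteq> {..<n} \<and> card S = m}"
  define W where "W = real n powr ((real k - 1) / 2) *
      (3 powr (real (m - k) / real k) * (3 ^ (k - 1) * M)) *
      sqrt (real (card {T. T \<subseteq> {..<n} \<and> card T = m - k}))"
  have W0: "0 \<le> W" unfolding W_def using torus_bounded_nonneg[OF bd] by simp
  have fin\<S>: "finite \<S>" unfolding \<S>_def by simp
  have m0: "m > 0" using k by simp
  show ?thesis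
  proof (cases "\<S> = {}")
    case True
    then show ?thesis
      unfolding \<S>_def[symmetric] W_def[symmetric] using W0 by simp
  next
    case False
    then have mn: "m \<le> n"
      using card_mono[of "{..<n}"] by (force simp: \<S>_def)
    have "\<exists>h. bij_betw h {..<m} S" if "S \<in> \<S>" for S
      using that ex_bij_betw_nat_finite[of S] by (auto simp: \<S>_def lessThan_atLeast0 finite_subset)
    then obtain h where h: "\<And>S. S \<in> \<S> \<Longrightarrow> bij_betw (h S) {..<m} S" by metis
    \<comment> \<open>With \<open>m\<close> colours each of the \<open>k\<close> blocks has density
      1/m and \<open>B\<close> has density 1 - k/m. Placing the m - k other elements in
      \<open>B\<close> then costs at most e^k.\<close>
    define P where "P = PiE {..<n} (\<lambda>_. {..<m})"
    have finP: "finite P" and cardP: "card P = m ^ n"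
      by (auto simp: P_def finite_PiE card_PiE)
    define good where "good S col \<longleftrightarrow> (\<forall>l<k. col (h S l) = l) \<and> (\<forall>l. k \<le> l \<longrightarrow> l < m \<longrightarrow> k \<le> col (h S l))"
      for S and col :: "nat \<Rightarrow> nat"
    have card_good: "(m - k) ^ (m - k) * m ^ (n - m) \<le> card {col \<in> P. good S col}" if S: "S \<in> \<S>" for S
    proof -
      define g where "g = inv_into {..<m} (h S)"
      have gh: "g (h S l) = l" if "l < m" for l
        using h[OF S] that unfolding g_def by (auto simp: bij_betw_def)
      have hS: "h S l \<in> S" if "l < m" for l
        using h[OF S] that by (auto simp: bij_betw_def)
      have SV: "S \<subseteq> {..<n}" "finite S" using S by (auto simp: \<S>_def finite_subset)
      \<comment> \<open>Goodness restricts the colours of the elements of \<open>S\<close>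
        independently of each other, so the good colourings contain a box whose size is a
        product.\<close>
      define X where "X j = (if j \<in> S then (if g j < k then {g j} else {k..<m}) else {..<m})" for j
      have "PiE {..<n} X \<subseteq> {col \<in> P. good S col}"
      proof
        fix col assume c: "col \<in> PiE {..<n} X"
        have gm: "g j < m" if "j \<in> S" for j
          using h[OF S] that unfolding g_def bij_betw_def
          by (metis inv_into_into lessThan_iff)
        have "X j \<subseteq> {..<m}" for j using k gm by (auto simp: X_def)
        then have "col \<in> P" using c by (auto simp: P_def PiE_iff)
        moreover have "col (h S l) \<in> X (h S l)" if "l < m" for l
          using c hS[OF that] SV by (auto simp: PiE_iff)
        then have "good S col"
          using hS gh k unfolding good_def X_def by (metis (no_types, lifting) atLeastLessThan_iff linorder_not_le order_less_le_trans singletonD)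
        ultimately show "col \<in> {col \<in> P. good S col}" by simp
      qed
      then have "card (PiE {..<n} X) \<le> card {col \<in> P. good S col}"
        using finP by (intro card_mono) auto
      moreover have "card (PiE {..<n} X) = (m - k) ^ (m - k) * m ^ (n - m)"
      proof -
        have "card (PiE {..<n} X) = (\<Prod>j<n. card (X j))" by (simp add: card_PiE)
        also have "\<dots> = (\<Prod>j\<in>S. card (X j)) * (\<Prod>j\<in>{..<n} - S. card (X j))"
          using SV by (subst prod.subset_diff[of S]) (auto simp: mult.commute)
        also have "(\<Prod>j\<in>{..<n} - S. card (X j)) = m ^ (n - m)"
          using S SV by (simp add: X_def card_Diff_subset \<S>_def)
        also have "(\<Prod>j\<in>S. card (X j)) = (\<Prod>l<m. card (X (h S l)))"
          using prod.reindex_bij_betw[OF h[OF S], of "\<lambda>j. card (X j)"] by simp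
        also have "\<dots> = (\<Prod>l<m. if l < k then 1 else m - k)"
          using hS gh by (intro prod.cong refl) (auto simp: X_def)
        also have "\<dots> = (m - k) ^ (m - k)"
        proof -
          have e: "{..<m} = {..<k} \<union> {k..<m}" using k by auto
          have "(\<Prod>l<m. if l < k then 1 else m - k) = (\<Prod>l<k. if l < k then 1 else m - k) * (\<Prod>l=k..<m. if l < k then 1 else m - k)"
            by (subst e, rule prod.union_disjoint) auto
          then show ?thesis by simp
        qed
        finally show ?thesis .
      qed
      ultimately show ?thesis by simp
    qed
    have col_bound: "(\<Sum>S | S \<in> \<S> \<and> good S col. cmod (a (sqf S))) \<le> W" if col: "col \<in> P" for col
    proof -
      define A where "A = (\<lambda>l. {j. j < n \<and> col j = l})"
      define B where "B = {j. j < n \<and> k \<le> col j}"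
      define \<S>' where "\<S>' = {S. S \<in> \<S> \<and> good S col}"
      \<comment> \<open>For a good set the first \<open>k\<close> elements form a choice function on
        the blocks and the others lie in \<open>B\<close>. The union of both parts is the set again,
        hence injectivity.\<close>
      define \<phi> where "\<phi> S = (restrict (h S) {..<k}, h S ` {k..<m})" for S
      define u where "u = (\<lambda>(i :: nat \<Rightarrow> nat, T). cmod (a (sqf (i ` {..<k} \<union> T))))"
      have un: "fst (\<phi> S) ` {..<k} \<union> snd (\<phi> S) = S" if "S \<in> \<S>'" for S
      proof -
        have "{..<m} = {..<k} \<union> {k..<m}" using k by auto
        then have "h S ` {..<k} \<union> h S ` {k..<m} = S"
          using h[of S] that by (simp add: bij_betw_def \<S>'_def image_Un[symmetric])
        then show ?thesis by (simp add: \<phi>_def)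
      qed
      then have inj: "inj_on \<phi> \<S>'" by (metis inj_onI)
      have sub: "\<phi> ` \<S>' \<subseteq> PiE {..<k} A \<times> {T. T \<subseteq> B \<and> card T = m - k}"
      proof (rule image_subsetI)
        fix S assume S: "S \<in> \<S>'"
        have hS: "h S l < n" if "l < m" for l
          using h[of S] S that by (auto simp: bij_betw_def \<S>'_def \<S>_def)
        have "restrict (h S) {..<k} \<in> PiE {..<k} A"
          using S k hS by (auto simp: A_def \<S>'_def good_def)
        moreover have "h S ` {k..<m} \<subseteq> B"
          using S hS by (auto simp: B_def \<S>'_def good_def)
        moreover have "card (h S ` {k..<m}) = m - k"
        proof -
          have "inj_on (h S) {k..<m}"
            using h[of S] S by (auto simp: bij_betw_def \<S>'_def intro: inj_on_subset)
          then show ?thesis by (simp add: card_image)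
        qed
        ultimately show "\<phi> S \<in> PiE {..<k} A \<times> {T. T \<subseteq> B \<and> card T = m - k}"
          by (simp add: \<phi>_def)
      qed
      have "(\<Sum>S\<in>\<S>'. cmod (a (sqf S))) = (\<Sum>S\<in>\<S>'. u (\<phi> S))"
        using un by (intro sum.cong refl) (simp add: u_def case_prod_unfold)
      also have "\<dots> = (\<Sum>p\<in>\<phi> ` \<S>'. u p)"
        using inj by (simp add: sum.reindex)
      also have "\<dots> \<le> (\<Sum>p\<in>PiE {..<k} A \<times> {T. T \<subseteq> B \<and> card T = m - k}. u p)"
      proof (rule sum_mono2[OF _ sub])
        show "finite (PiE {..<k} A \<times> {T. T \<subseteq> B \<and> card T = m - k})"
          by (intro finite_cartesian_product finite_PiE) (auto simp: A_def B_def)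
      qed (auto simp: u_def)
      also have "\<dots> = (\<Sum>i\<in>PiE {..<k} A. \<Sum>T | T \<subseteq> B \<and> card T = m - k. cmod (a (sqf (i ` {..<k} \<union> T))))"
        unfolding u_def by (rule sum.cartesian_product[symmetric])
      also have "\<dots> \<le> W"
        unfolding W_def by (rule colored_bound[OF A_def B_def k bd])
      finally show ?thesis by (simp add: \<S>'_def)
    qed
    \<comment> \<open>For \<open>m = k\<close> this is 0^0 = 1, so \<open>Z\<close> is positive and
      can be cancelled in all cases.\<close>
    define Z where "Z = real (m - k) ^ (m - k)"
    have Z0: "Z > 0" unfolding Z_def by (cases "m = k") (use k in auto)
    have "Z * real m ^ (n - m) * (\<Sum>S\<in>\<S>. cmod (a (sqf S))) \<le> (\<Sum>S\<in>\<S>. real (card {col \<in> P. good S col}) * cmod (a (sqf S)))"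
      unfolding sum_distrib_left
    proof (intro sum_mono mult_right_mono)
      fix S assume "S \<in> \<S>"
      from card_good[OF this] show "Z * real m ^ (n - m) \<le> real (card {col \<in> P. good S col})"
        unfolding Z_def by (metis of_nat_le_iff of_nat_mult of_nat_power)
    qed auto
    also have "\<dots> = (\<Sum>S\<in>\<S>. \<Sum>col | col \<in> P \<and> good S col. cmod (a (sqf S)))"
      by simp
    also have "\<dots> = (\<Sum>col\<in>P. \<Sum>S | S \<in> \<S> \<and> good S col. cmod (a (sqf S)))"
      by (rule sum.swap_restrict[OF fin\<S> finP])
    also have "\<dots> \<le> (\<Sum>col\<in>P. W)"
      by (intro sum_mono col_bound)
    also have "\<dots> = real m ^ (n - m) * (real m ^ m * W)"
      using mn by (simp add: cardP power_add[symmetric])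
    finally have "real m ^ (n - m) * (Z * (\<Sum>S\<in>\<S>. cmod (a (sqf S)))) \<le> real m ^ (n - m) * (real m ^ m * W)"
      by (simp only: mult_ac)
    then have "Z * (\<Sum>S\<in>\<S>. cmod (a (sqf S))) \<le> real m ^ m * W"
      by (rule mult_left_le_imp_le) (use m0 in simp)
    also have "\<dots> \<le> ((real m * exp 1) ^ k * Z) * W"
      unfolding Z_def using power_self_le_exp[OF k] W0 by (intro mult_right_mono) auto
    also have "\<dots> = Z * ((real m * exp 1) ^ k * W)" by simp
    finally have "(\<Sum>S\<in>\<S>. cmod (a (sqf S))) \<le> (real m * exp 1) ^ k * W"
      using Z0 by (rule mult_left_le_imp_le)
    then show ?thesis by (simp add: \<S>_def W_def)
  qed
qed

section \<open>Coefficient sums of homogeneous polynomials\<close>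

text \<open>Rankin's trick: weight each index by x^degree and enlarge the sum to a box, where it
  factors into truncated geometric series. Leaving \<open>x\<close> free avoids binomial
  asymptotics; later it is about ln n / n.\<close>

lemma card_homog_le:
  assumes "0 < x" "x < 1"
  shows "real (card (homog n q)) * x ^ q \<le> (1 / (1 - x)) ^ n"
proof -
  define u where "u g = (\<Prod>j<n. x ^ g j)" for g :: "nat \<Rightarrow> nat"
  have "real (card (homog n q)) * x ^ q = (\<Sum>\<alpha>\<in>homog n q. u (restrict \<alpha> {..<n}))"
    by (simp add: u_def homog_def flip: power_sum)
  also have "\<dots> = (\<Sum>g\<in>(\<lambda>\<alpha>. restrict \<alpha> {..<n}) ` homog n q. u g)"
    by (subst sum.reindex) (auto intro: inj_on_subset[OF inj_on_restrict_MI] simp: homog_def)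
  also have "\<dots> \<le> (\<Sum>g\<in>PiE {..<n} (\<lambda>_. {..q}). u g)"
    using assms by (intro sum_mono2 restrict_homog_subset finite_PiE) (auto simp: u_def intro!: prod_nonneg)
  also have "\<dots> = (\<Prod>j<n. \<Sum>b\<le>q. x ^ b)"
    unfolding u_def by (rule prod_sum_PiE[symmetric]) auto
  also have "\<dots> \<le> (\<Prod>j<n. 1 / (1 - x))"
  proof (intro prod_mono conjI)
    have "(\<Sum>b\<le>q. x ^ b) \<le> (\<Sum>b. x ^ b)"
      using assms by (intro sum_le_suminf summable_geometric) auto
    then show "(\<Sum>b\<le>q. x ^ b) \<le> 1 / (1 - x)"
      using assms by (simp add: suminf_geometric)
  qed (use assms in \<open>auto intro: sum_nonneg\<close>)
  finally show ?thesis by simp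
qed

lemma sqrt_card_homog_le:
  assumes x: "0 < x" "x < 1"
  shows "sqrt (real (card (homog n q))) \<le> (1 - x) powr (- real n / 2) * x powr (- real q / 2)"
proof (rule real_le_lsqrt)
  have "real (card (homog n q)) \<le> (1 / (1 - x)) ^ n / x ^ q"
    using card_homog_le[OF x, of n q] x by (simp add: field_simps)
  also have "\<dots> = (1 - x) powr (- real n) * x powr (- real q)"
    using x by (simp add: powr_minus powr_realpow field_simps)
  also have "\<dots> = ((1 - x) powr (- real n / 2) * x powr (- real q / 2))\<^sup>2"
    using x by (simp add: power_mult_distrib powr_power)
  finally show "real (card (homog n q)) \<le> ((1 - x) powr (- real n / 2) * x powr (- real q / 2))\<^sup>2" .
qed auto

lemma inj_sqf: "inj sqf"
proof (rule injI)
  fix S T assume "sqf S = sqf T"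
  then have "j \<in> S \<longleftrightarrow> j \<in> T" for j
    by (metis sqf_def zero_neq_one)
  then show "S = T" by auto
qed

lemma sqf_homog: "S \<subseteq> {..<n} \<Longrightarrow> sqf S \<in> homog n (card S)"
  by (auto simp: homog_def MI_def sqf_def sum.If_cases Int_absorb1)

lemma card_subsets_le_homog: "card {T. T \<subseteq> {..<n} \<and> card T = q} \<le> card (homog n q)"
  using sqf_homog by (intro card_inj_on_le[of sqf] inj_on_subset[OF inj_sqf]) auto

definition nonsqf :: "nat \<Rightarrow> nat \<Rightarrow> (nat \<Rightarrow> nat) set" where
  "nonsqf n m = {\<alpha> \<in> homog n m. \<exists>j. 2 \<le> \<alpha> j}"

lemma homog_split: "homog n m = sqf ` {S. S \<subseteq> {..<n} \<and> card S = m} \<union> nonsqf n m"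
proof (intro equalityI subsetI)
  fix \<alpha> assume a: "\<alpha> \<in> homog n m"
  show "\<alpha> \<in> sqf ` {S. S \<subseteq> {..<n} \<and> card S = m} \<union> nonsqf n m"
  proof (cases "\<exists>j. 2 \<le> \<alpha> j")
    case False
    define S where "S = {j. \<alpha> j = 1}"
    have "\<alpha> j \<le> 1" for j using False by (metis Suc_1 not_less_eq_eq One_nat_def)
    then have "\<alpha> j = sqf S j" for j
      unfolding S_def sqf_def by (metis (mono_tags) le_neq_implies_less less_one mem_Collect_eq)
    then have "\<alpha> = sqf S" ..
    moreover have S: "S \<subseteq> {..<n}"
      using a by (auto simp: S_def homog_def MI_def) (metis linorder_not_le nat.distinct(1))
    moreover have "card S = m"
      using sqf_homog[OF S] a \<open>\<alpha> = sqf S\<close> by (simp add: homog_def)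
    ultimately show ?thesis by auto
  qed (use a in \<open>auto simp: nonsqf_def\<close>)
qed (auto simp: nonsqf_def sqf_homog)

text \<open>Such an index is recovered from a coordinate where it is at least 2 and the index left
  after subtracting 2 there.\<close>

lemma card_nonsqf_le:
  assumes "2 \<le> m"
  shows "card (nonsqf n m) \<le> n * card (homog n (m - 2))"
proof -
  define g where "g = (\<lambda>(j, \<gamma> :: nat \<Rightarrow> nat). \<gamma>(j := \<gamma> j + 2))"
  have "nonsqf n m \<subseteq> g ` ({..<n} \<times> homog n (m - 2))"
  proof
    fix \<alpha> assume "\<alpha> \<in> nonsqf n m"
    then obtain j where a: "\<alpha> \<in> homog n m" and j: "2 \<le> \<alpha> j" by (auto simp: nonsqf_def)
    then have jn: "j < n" by (auto simp: homog_def MI_def) (metis linorder_not_le not_numeral_le_zero)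
    define \<gamma> where "\<gamma> = \<alpha>(j := \<alpha> j - 2)"
    have "(\<Sum>i<n. \<alpha> i) = \<alpha> j + (\<Sum>i\<in>{..<n} - {j}. \<alpha> i)"
      using jn by (intro sum.remove) auto
    moreover have "(\<Sum>i<n. \<gamma> i) = \<gamma> j + (\<Sum>i\<in>{..<n} - {j}. \<gamma> i)"
      using jn by (intro sum.remove) auto
    moreover have "(\<Sum>i\<in>{..<n} - {j}. \<gamma> i) = (\<Sum>i\<in>{..<n} - {j}. \<alpha> i)"
      by (intro sum.cong) (auto simp: \<gamma>_def)
    ultimately have "(\<Sum>i<n. \<gamma> i) = m - 2" using a j by (simp add: \<gamma>_def homog_def)
    moreover have "\<gamma> \<in> MI n" using a jn by (auto simp: \<gamma>_def homog_def MI_def)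
    ultimately have "\<gamma> \<in> homog n (m - 2)" by (simp add: homog_def)
    moreover have "\<alpha> = g (j, \<gamma>)"
      using j by (intro ext) (auto simp: g_def \<gamma>_def)
    ultimately show "\<alpha> \<in> g ` ({..<n} \<times> homog n (m - 2))" using jn by blast
  qed
  then have "card (nonsqf n m) \<le> card (g ` ({..<n} \<times> homog n (m - 2)))"
    by (intro card_mono finite_imageI) auto
  also have "\<dots> \<le> card ({..<n} \<times> homog n (m - 2))"
    by (intro card_image_le) auto
  finally show ?thesis by (simp add: card_cartesian_product)
qed

text \<open>Compared with the count of all indices of degree \<open>m\<close>, the factor
  \<open>sqrt n\<close> is lost and two powers of \<open>sqrt x\<close> are gained. For x near ln n
  / n this is a net saving of \<open>sqrt n\<close> up to a logarithm. In degree below 2 there is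
  nothing to bound.\<close>

lemma nonsqf_part_bound:
  assumes bd: "torus_bounded n (homog n m) a M" and x: "0 < x" "x < 1"
  shows "(\<Sum>\<alpha>\<in>nonsqf n m. cmod (a \<alpha>)) \<le>
    M * ((1 - x) powr (- real n / 2) * (sqrt (real n) * x powr (- (real m - 2) / 2)))"
proof (cases "2 \<le> m")
  case False
  have "\<alpha> j < 2" if "\<alpha> \<in> homog n m" for \<alpha> j
    using that False homog_le[OF that, of j] by (cases "j < n") (auto simp: homog_def MI_def)
  then have "\<not> 2 \<le> \<alpha> j" if "\<alpha> \<in> homog n m" for \<alpha> j
    using that by (simp add: not_le)
  then have "nonsqf n m = {}" unfolding nonsqf_def by blast
  then show ?thesis using torus_bounded_nonneg[OF bd] by simp
next
  case True
  have M0: "0 \<le> M" by (rule torus_bounded_nonneg[OF bd])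
  have fin: "finite (nonsqf n m)" by (auto simp: nonsqf_def)
  have l2: "(\<Sum>\<alpha>\<in>homog n m. (cmod (a \<alpha>))\<^sup>2) \<le> M\<^sup>2"
    by (rule torus_coeff_l2_le[OF finite_homog _ bd]) (auto simp: homog_def)
  have "(\<Sum>\<alpha>\<in>nonsqf n m. cmod (a \<alpha>) * 1)\<^sup>2 \<le> (\<Sum>\<alpha>\<in>nonsqf n m. (cmod (a \<alpha>))\<^sup>2) * (\<Sum>\<alpha>\<in>nonsqf n m. 1\<^sup>2)"
    by (rule Cauchy_Schwarz_ineq_sum)
  also have "\<dots> \<le> M\<^sup>2 * (real n * real (card (homog n (m - 2))))"
  proof (intro mult_mono)
    have "(\<Sum>\<alpha>\<in>nonsqf n m. (cmod (a \<alpha>))\<^sup>2) \<le> (\<Sum>\<alpha>\<in>homog n m. (cmod (a \<alpha>))\<^sup>2)"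
      by (intro sum_mono2) (auto simp: nonsqf_def)
    with l2 show "(\<Sum>\<alpha>\<in>nonsqf n m. (cmod (a \<alpha>))\<^sup>2) \<le> M\<^sup>2" by simp
    show "(\<Sum>\<alpha>\<in>nonsqf n m. 1\<^sup>2) \<le> real n * real (card (homog n (m - 2)))"
      using card_nonsqf_le[OF True, of n] by (simp flip: of_nat_mult)
  qed auto
  finally have "(\<Sum>\<alpha>\<in>nonsqf n m. cmod (a \<alpha>)) \<le> sqrt (M\<^sup>2 * (real n * real (card (homog n (m - 2)))))"
    by (intro real_le_rsqrt) simp
  also have "\<dots> = M * (sqrt (real n) * sqrt (real (card (homog n (m - 2)))))"
    using M0 by (simp add: real_sqrt_mult)
  also have "\<dots> \<le> M * (sqrt (real n) * ((1 - x) powr (- real n / 2) * x powr (- real (m - 2) / 2)))"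
    using M0 sqrt_card_homog_le[OF x, of n "m - 2"] by (intro mult_left_mono) auto
  also have "\<dots> = M * ((1 - x) powr (- real n / 2) * (sqrt (real n) * x powr (- (real m - 2) / 2)))"
    using True by (simp add: of_nat_diff mult_ac)
  finally show ?thesis .
qed

text \<open>Both \<open>k\<close> and \<open>x\<close> stay free because small and large degrees
  need different choices: k = 1 with x = L / (2 n), and a large fixed k with x = L / n.\<close>

theorem homog_l1_bound:
  assumes k: "1 \<le> k" "k \<le> m" and bd: "torus_bounded n (homog n m) a M" and x: "0 < x" "x < 1"
  shows "(\<Sum>\<alpha>\<in>homog n m. cmod (a \<alpha>)) \<le> M * ((1 - x) powr (- real n / 2) *
    ((real m * exp 1) ^ k * 3 ^ (k - 1) * 3 powr (real (m - k) / real k) * real n powr ((real k - 1) / 2) *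
       x powr (- (real m - real k) / 2)
     + sqrt (real n) * x powr (- (real m - 2) / 2)))"
proof -
  have M0: "0 \<le> M" by (rule torus_bounded_nonneg[OF bd])
  define \<S> where "\<S> = {S. S \<subseteq> {..<n} \<and> card S = m}"
  define c where "c = (real m * exp 1) ^ k * real n powr ((real k - 1) / 2) * 3 powr (real (m - k) / real k) * 3 ^ (k - 1)"
  have c0: "0 \<le> c" by (simp add: c_def)
  have fin: "finite \<S>" by (simp add: \<S>_def)
  have "(\<Sum>\<alpha>\<in>homog n m. cmod (a \<alpha>)) \<le> (\<Sum>\<alpha>\<in>sqf ` \<S>. cmod (a \<alpha>)) + (\<Sum>\<alpha>\<in>nonsqf n m. cmod (a \<alpha>))"
    unfolding homog_split[of n m] \<S>_def[symmetric]
    using fin by (subst sum.union_inter_neutral) (auto simp: nonsqf_def sqf_def split: if_splits)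
  also have "(\<Sum>\<alpha>\<in>sqf ` \<S>. cmod (a \<alpha>)) = (\<Sum>S\<in>\<S>. cmod (a (sqf S)))"
    by (rule sum.reindex_cong[OF inj_on_subset[OF inj_sqf]]) auto
  also have "\<dots> \<le> c * M * sqrt (real (card {T. T \<subseteq> {..<n} \<and> card T = m - k}))"
    using squarefree_part_bound[OF k bd] by (simp add: \<S>_def c_def mult_ac)
  also have "\<dots> \<le> c * M * ((1 - x) powr (- real n / 2) * x powr (- real (m - k) / 2))"
  proof (intro mult_left_mono)
    have "sqrt (real (card {T. T \<subseteq> {..<n} \<and> card T = m - k})) \<le> sqrt (real (card (homog n (m - k))))"
      using card_subsets_le_homog by simp
    also have "\<dots> \<le> (1 - x) powr (- real n / 2) * x powr (- real (m - k) / 2)"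
      by (rule sqrt_card_homog_le[OF x])
    finally show "sqrt (real (card {T. T \<subseteq> {..<n} \<and> card T = m - k})) \<le> (1 - x) powr (- real n / 2) * x powr (- real (m - k) / 2)" .
  qed (use c0 M0 in auto)
  also have "(\<Sum>\<alpha>\<in>nonsqf n m. cmod (a \<alpha>)) \<le>
    M * ((1 - x) powr (- real n / 2) * (sqrt (real n) * x powr (- (real m - 2) / 2)))"
    by (rule nonsqf_part_bound[OF bd x])
  finally show ?thesis
    using k by (simp add: c_def of_nat_diff distrib_left mult_ac)
qed

section \<open>Weighted coefficient sums over all degrees\<close>

lemma one_minus_powr_le:
  fixes x N :: real
  assumes "0 < x" "x \<le> 1/2" "0 \<le> N"
  shows "(1 - x) powr (- N / 2) \<le> exp (N * x / 2 + N * x\<^sup>2)"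
proof -
  have "- x - 2 * x\<^sup>2 \<le> ln (1 - x)"
    using assms by (intro ln_one_minus_pos_lower_bound) auto
  then have "(- N / 2) * ln (1 - x) \<le> (- N / 2) * (- x - 2 * x\<^sup>2)"
    using assms by (intro mult_left_mono_neg) auto
  then show ?thesis
    using assms by (simp add: powr_def algebra_simps)
qed

text \<open>Halving \<open>x\<close> to L / (2 n) reduces (1 - x)^(-n/2) from about n^(1/2) to about
  n^(1/4), so the saving n^(-1/2) leaves n^(-1/4). The price is sqrt 2 per degree, rounded up to 2;
  together with the 3 per degree from the moment comparison at k = 1 this is the 6^m, affordable
  while m is a small multiple of ln n.\<close>

lemma low_degree_bound:
  assumes m: "1 \<le> m" and bd: "torus_bounded n (homog n m) a M"
    and L: "L = ln (real n)" "1 \<le> L" "L\<^sup>2 \<le> real n" "L \<le> real n"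
    and r: "0 \<le> r" "r \<le> sqrt (L / real n)"
  shows "r ^ m * (\<Sum>\<alpha>\<in>homog n m. cmod (a \<alpha>)) \<le>
    M * (exp 1 * real n powr (-1/4) * L * (exp 1 * real m + 1) * 6 ^ m)"
proof -
  have M0: "0 \<le> M" by (rule torus_bounded_nonneg[OF bd])
  have n0: "0 < real n" using L by linarith
  define s where "s = sqrt (L / real n)"
  define t where "t = s / sqrt 2"
  have "0 < L / real n" using L(2) n0 by (intro divide_pos_pos) linarith+
  then have s: "s > 0" "s\<^sup>2 = L / real n" by (auto simp: s_def)
  have t: "t > 0" "t\<^sup>2 = L / (2 * real n)" "s = sqrt 2 * t" "t \<le> s"
    using s by (auto simp: t_def power_divide field_simps)
  define x where "x = L / (2 * real n)"
  have x: "0 < x" "x \<le> 1/2" using L(2,4) n0 unfolding x_def by (auto simp: divide_simps simp del: of_nat_0_less_iff)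
  have xp: "x powr (- y / 2) = t powr (- y)" for y
  proof -
    have "x = t powr 2" using t by (simp add: x_def)
    then show ?thesis by (simp add: powr_powr)
  qed
  have st: "s ^ m * t powr (- (real m - y)) \<le> 2 ^ m * t powr y" for y
  proof -
    have "s ^ m * t powr (- (real m - y)) = sqrt 2 ^ m * (t powr real m * t powr (- (real m - y)))"
      using t by (simp add: power_mult_distrib powr_realpow)
    also have "t powr real m * t powr (- (real m - y)) = t powr y"
      by (simp add: powr_add[symmetric])
    also have "sqrt 2 ^ m * t powr y \<le> 2 ^ m * t powr y"
      by (intro mult_right_mono power_mono) (auto intro: real_le_lsqrt)
    finally show ?thesis .
  qed
  have e1: "(1 - x) powr (- real n / 2) \<le> exp 1 * real n powr (1/4)"
  proof -
    have "(1 - x) powr (- real n / 2) \<le> exp (real n * x / 2 + real n * x\<^sup>2)"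
      using x by (intro one_minus_powr_le) auto
    also have "real n * x / 2 + real n * x\<^sup>2 = L / 4 + L\<^sup>2 / (4 * real n)"
      using n0 by (simp add: x_def power2_eq_square field_simps)
    also have "exp (L / 4 + L\<^sup>2 / (4 * real n)) \<le> exp (L / 4 + 1)"
      using L n0 by (simp add: field_simps)
    also have "\<dots> = exp 1 * real n powr (1/4)"
      using n0 L by (simp add: powr_def exp_add mult.commute)
    finally show ?thesis .
  qed
  have sn: "s \<le> L * real n powr (-1/2)"
  proof -
    have "s = sqrt L * real n powr (-1/2)"
      using n0 by (simp add: s_def real_sqrt_divide powr_minus powr_half_sqrt field_simps)
    also have "sqrt L \<le> L" using L(2) by (intro real_le_lsqrt) (auto simp: power2_eq_square)
    finally show ?thesis by (simp add: mult_right_mono)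
  qed
  have ns: "sqrt (real n) * s\<^sup>2 = L * real n powr (-1/2)"
    using n0 by (simp add: s powr_minus powr_half_sqrt real_div_sqrt field_simps)
  have "r ^ m * (\<Sum>\<alpha>\<in>homog n m. cmod (a \<alpha>)) \<le> s ^ m * (M * ((1 - x) powr (- real n / 2) *
    ((real m * exp 1) ^ 1 * 3 ^ (1 - 1) * 3 powr (real (m - 1) / real 1) * real n powr ((real 1 - 1) / 2) *
       x powr (- (real m - real 1) / 2)
     + sqrt (real n) * x powr (- (real m - 2) / 2))))"
    using r x s m by (intro mult_mono power_mono homog_l1_bound[OF _ _ bd]) (auto simp: s_def intro: sum_nonneg)
  also have "\<dots> = M * ((1 - x) powr (- real n / 2) *
      (real m * exp 1 * 3 ^ (m - 1) * (s ^ m * t powr (- (real m - 1)))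
       + sqrt (real n) * (s ^ m * t powr (- (real m - 2)))))"
    unfolding xp using n0 by (simp add: powr_realpow algebra_simps)
  also have "\<dots> \<le> M * ((1 - x) powr (- real n / 2) *
      (real m * exp 1 * 3 ^ m * (2 ^ m * s)
       + sqrt (real n) * (2 ^ m * s\<^sup>2)))"
  proof -
    note st[of 1]
    also have "2 ^ m * t powr 1 \<le> 2 ^ m * s" using t(1,4) by simp
    finally have a1: "s ^ m * t powr (- (real m - 1)) \<le> 2 ^ m * s" .
    note st[of 2]
    also have "2 ^ m * t powr 2 \<le> 2 ^ m * s\<^sup>2" using t(1,4) by (simp add: power_mono)
    finally have a2: "s ^ m * t powr (- (real m - 2)) \<le> 2 ^ m * s\<^sup>2" .
    show ?thesis
      using s(1) t(1) M0 by (intro a1 a2 mult_left_mono[OF _ M0] mult_left_mono[of _ _ "(1 - x) powr _"] add_mono mult_mono[OF _ a1] mult_left_mono)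
        (auto simp: power_increasing)
  qed
  also have "\<dots> = M * ((1 - x) powr (- real n / 2) *
      (real m * exp 1 * 6 ^ m * s + 2 ^ m * (sqrt (real n) * s\<^sup>2)))"
    by (simp add: power_mult_distrib[symmetric] algebra_simps)
  also have "\<dots> \<le> M * ((exp 1 * real n powr (1/4)) *
      (real m * exp 1 * 6 ^ m * (L * real n powr (-1/2)) + 6 ^ m * (L * real n powr (-1/2))))"
    unfolding ns using e1 sn M0 L(2) s(1)
    by (intro mult_left_mono mult_mono add_mono power_mono) auto
  also have "\<dots> = M * (exp 1 * (real n powr (1/4) * real n powr (-1/2)) * L * (exp 1 * real m + 1) * 6 ^ m)"
    by (simp add: algebra_simps)
  also have "real n powr (1/4) * real n powr (-1/2) = real n powr (-1/4)"
    by (simp add: powr_add[symmetric])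
  finally show ?thesis .
qed

text \<open>Now x = L / n matches the radius, and n^(1/2) meets n^(-1/2) exactly. Powers of L and m
  and the exponential 3^(m/K) remain. The latter goes into q^m: the radius is smaller than sqrt (L /
  n) by the factor \<open>e\<close>, and hypothesis \<open>q\<close> makes this enough.\<close>

lemma high_degree_bound:
  assumes K: "1 \<le> K" "K \<le> m" and bd: "torus_bounded n (homog n m) a M"
    and L: "L = ln (real n)" "1 \<le> L" "L\<^sup>2 \<le> real n" "2 * L \<le> real n"
    and e: "0 \<le> e" "e \<le> 1" and q: "3 powr (1 / real K) * e \<le> q"
  shows "(e * sqrt (L / real n)) ^ m * (\<Sum>\<alpha>\<in>homog n m. cmod (a \<alpha>)) \<le>
    M * (exp 1 * L ^ K * ((3 * exp 1 * real m) ^ K + 1) * q ^ m)"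
proof -
  have M0: "0 \<le> M" by (rule torus_bounded_nonneg[OF bd])
  have n0: "0 < real n" using L by linarith
  define s where "s = sqrt (L / real n)"
  have "0 < L / real n" using L(2) n0 by (intro divide_pos_pos) linarith+
  then have s: "s > 0" "s\<^sup>2 = L / real n" by (auto simp: s_def)
  define x where "x = L / real n"
  have x: "0 < x" "x \<le> 1/2" using L(2,4) n0 unfolding x_def by (auto simp: divide_simps simp del: of_nat_0_less_iff)
  have xp: "x powr (- y / 2) = s powr (- y)" for y
  proof -
    have "x = s powr 2" using s by (simp add: x_def)
    then show ?thesis by (simp add: powr_powr)
  qed
  have st: "s ^ m * s powr (- (real m - y)) = s powr y" for y
  proof -
    have "s ^ m = s powr real m" using s(1) by (simp add: powr_realpow)
    then show ?thesis by (simp add: powr_add[symmetric])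
  qed
  have e1: "(1 - x) powr (- real n / 2) \<le> exp 1 * real n powr (1/2)"
  proof -
    have "(1 - x) powr (- real n / 2) \<le> exp (real n * x / 2 + real n * x\<^sup>2)"
      using x by (intro one_minus_powr_le) auto
    also have "real n * x / 2 + real n * x\<^sup>2 = L / 2 + L\<^sup>2 / real n"
      using n0 by (simp add: x_def power2_eq_square field_simps)
    also have "exp (L / 2 + L\<^sup>2 / real n) \<le> exp (L / 2 + 1)"
      using L n0 by (simp add: field_simps)
    also have "\<dots> = exp 1 * real n powr (1/2)"
      using n0 L by (simp add: powr_def exp_add mult.commute)
    finally show ?thesis .
  qed
  have sL: "s ^ K * real n powr ((real K - 1) / 2) \<le> L ^ K * real n powr (-1/2)"
  proof -
    have "s = sqrt L * real n powr (-1/2)"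
      using n0 by (simp add: s_def real_sqrt_divide powr_minus powr_half_sqrt field_simps)
    then have "s ^ K = sqrt L ^ K * real n powr (- real K / 2)"
      using n0 by (simp add: power_mult_distrib powr_power)
    then have "s ^ K * real n powr ((real K - 1) / 2) = sqrt L ^ K * (real n powr (- real K / 2) * real n powr ((real K - 1) / 2))"
      by simp
    also have "real n powr (- real K / 2) * real n powr ((real K - 1) / 2) = real n powr (-1/2)"
      by (simp add: powr_add[symmetric] diff_divide_distrib)
    also have "sqrt L ^ K * real n powr (-1/2) \<le> L ^ K * real n powr (-1/2)"
      using L by (intro mult_right_mono power_mono) (auto intro: real_le_lsqrt simp: power2_eq_square)
    finally show ?thesis .
  qed
  have ns: "sqrt (real n) * s\<^sup>2 = L * real n powr (-1/2)"
    using n0 by (simp add: s powr_minus powr_half_sqrt real_div_sqrt field_simps)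
  have three: "3 ^ (K - 1) * 3 powr (real (m - K) / real K) \<le> 3 ^ K * (3 powr (1 / real K)) ^ m"
  proof (rule mult_mono)
    have "(3 powr (1 / real K)) ^ m = (3::real) powr (real m / real K)"
      by (simp add: powr_power)
    moreover have "(3::real) powr (real (m - K) / real K) \<le> 3 powr (real m / real K)"
      by (intro powr_mono divide_right_mono) auto
    ultimately show "3 powr (real (m - K) / real K) \<le> (3 powr (1 / real K)) ^ m" by simp
  qed (auto simp: power_increasing)
  have q1: "e \<le> q"
  proof -
    have "1 * e \<le> 3 powr (1 / real K) * e"
      using e by (intro mult_right_mono ge_one_powr_ge_zero) auto
    then show ?thesis using q by simp
  qed
  have "(e * s) ^ m * (\<Sum>\<alpha>\<in>homog n m. cmod (a \<alpha>)) \<le> (e * s) ^ m * (M * ((1 - x) powr (- real n / 2) *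
    ((real m * exp 1) ^ K * 3 ^ (K - 1) * 3 powr (real (m - K) / real K) * real n powr ((real K - 1) / 2) *
       x powr (- (real m - real K) / 2)
     + sqrt (real n) * x powr (- (real m - 2) / 2))))"
    using x s e by (intro mult_left_mono homog_l1_bound[OF K bd]) auto
  also have "\<dots> = M * ((1 - x) powr (- real n / 2) *
      ((real m * exp 1) ^ K * (3 ^ (K - 1) * 3 powr (real (m - K) / real K)) * e ^ m * (real n powr ((real K - 1) / 2) * (s ^ m * s powr (- (real m - real K))))
       + e ^ m * (sqrt (real n) * (s ^ m * s powr (- (real m - 2))))))"
    unfolding xp power_mult_distrib by (simp only: distrib_left mult_ac)
  also have "\<dots> = M * ((1 - x) powr (- real n / 2) *
      ((real m * exp 1) ^ K * (3 ^ (K - 1) * 3 powr (real (m - K) / real K)) * e ^ m * (s ^ K * real n powr ((real K - 1) / 2))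
       + e ^ m * (sqrt (real n) * s\<^sup>2)))"
    unfolding st using s by (simp add: powr_realpow mult_ac)
  also have "\<dots> \<le> M * ((exp 1 * real n powr (1/2)) *
      ((real m * exp 1) ^ K * (3 ^ K * (3 powr (1 / real K)) ^ m) * e ^ m * (L ^ K * real n powr (-1/2))
       + q ^ m * (L ^ K * real n powr (-1/2))))"
  proof -
    have a2: "sqrt (real n) * s\<^sup>2 \<le> L ^ K * real n powr (-1/2)"
      unfolding ns using L K by (intro mult_right_mono) (auto intro: self_le_power)
    have a3: "e ^ m \<le> q ^ m" using q1 e by (intro power_mono)
    show ?thesis
      using e s q1 L(2)
      by (intro mult_left_mono[OF _ M0] mult_mono[OF e1] add_mono mult_mono[OF _ sL] mult_mono[OF a3 a2] mult_right_mono mult_left_mono[OF three])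
        auto
  qed
  also have "\<dots> = M * (exp 1 * (real n powr (1/2) * real n powr (-1/2)) * L ^ K *
      ((3 * exp 1 * real m) ^ K * (3 powr (1 / real K) * e) ^ m + q ^ m))"
    by (simp only: power_mult_distrib distrib_left mult_ac)
  also have "real n powr (1/2) * real n powr (-1/2) = 1"
    using n0 by (simp add: powr_add[symmetric])
  also have "M * (exp 1 * 1 * L ^ K * ((3 * exp 1 * real m) ^ K * (3 powr (1 / real K) * e) ^ m + q ^ m)) \<le>
      M * (exp 1 * 1 * L ^ K * ((3 * exp 1 * real m) ^ K * q ^ m + q ^ m))"
    using M0 L(2) e(1) q q1 by (intro mult_left_mono add_mono power_mono) auto
  finally show ?thesis by (simp add: s_def algebra_simps)
qed

text \<open>The degrees are split at ln n / 10. Below, each term is at most \<open>M * E1 n\<close>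
  with \<open>E1 n\<close> small by a power of n, and there are at most ln n of them. Above, the
  terms decay geometrically from degree ln n / 10 on. Each range contributes at most M / 4.\<close>

theorem eventually_weighted_l1_sum_le:
  assumes eps: "0 < \<epsilon>" "\<epsilon> < 1"
  shows "\<forall>\<^sub>F n in sequentially. \<forall>a M D. (\<forall>m\<ge>1. torus_bounded n (homog n m) a M) \<longrightarrow>
    (\<Sum>m=1..D. ((1 - \<epsilon>) * sqrt (ln (real n) / real n)) ^ m * (\<Sum>\<alpha>\<in>homog n m. cmod (a \<alpha>))) \<le> M / 2"
proof -
  define q where "q = 1 - \<epsilon> / 2"
  have q: "0 < q" "q < 1" using eps by (auto simp: q_def)
  \<comment> \<open>The cube root lets q^m be spent three times: on the polynomial in m (giving
    \<open>C\<close>), on smallness through m being at least ln n / 10, and on summing over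
    m.\<close>
  define q2 where "q2 = root 3 q"
  have q2: "0 < q2" "q2 < 1" "q = q2 ^ 3" using q by (auto simp: q2_def)
  have "((\<lambda>K. 3 powr (1 / real K) * (1 - \<epsilon>)) \<longlongrightarrow> 3 powr 0 * (1 - \<epsilon>)) sequentially"
    by (intro tendsto_intros lim_1_over_n) auto
  then have "\<forall>\<^sub>F K in sequentially. 3 powr (1 / real K) * (1 - \<epsilon>) < q"
    by (rule order_tendstoD) (use eps in \<open>auto simp: q_def\<close>)
  then have "\<forall>\<^sub>F K in sequentially. 3 powr (1 / real K) * (1 - \<epsilon>) < q \<and> 1 \<le> K"
    using eventually_ge_at_top by (rule eventually_conj)
  then obtain K where K: "3 powr (1 / real K) * (1 - \<epsilon>) \<le> q" "1 \<le> K"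
    by (metis (mono_tags, lifting) eventually_happens' less_imp_le sequentially_bot)
  have "(\<lambda>m. ((3 * exp 1 * real m) ^ K + 1) * q2 ^ m) \<longlonglongrightarrow> 0"
    using q2(1,2) by real_asymp
  then have "Bseq (\<lambda>m. ((3 * exp 1 * real m) ^ K + 1) * q2 ^ m)"
    by (intro convergent_imp_Bseq convergentI)
  then obtain C where C: "C > 0" "\<And>m. norm (((3 * exp 1 * real m) ^ K + 1) * q2 ^ m) \<le> C"
    by (auto simp: Bseq_def)
  \<comment> \<open>Since 6 is at most e^2, degrees up to ln n / 10 give \<open>6 ^ m\<close> at
    most n^(1/5), which n^(-1/4) still beats.\<close>
  define E1 where "E1 n = exp 1 * real n powr (-1/4) * ln (real n) * (exp 1 * ln (real n) + 1) * real n powr (1/5)" for n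
  define E2 where "E2 n = exp 1 * ln (real n) ^ K * C * q2 powr (ln (real n) / 10)" for n
  have "(\<lambda>n. ln (real n) * E1 n) \<longlonglongrightarrow> 0"
    unfolding E1_def by real_asymp
  then have ev1: "\<forall>\<^sub>F n in sequentially. ln (real n) * E1 n < 1/4"
    by (rule order_tendstoD) auto
  have "(\<lambda>n. E2 n / (1 - q2)) \<longlonglongrightarrow> 0"
    unfolding E2_def using q2(1,2) C(1) by real_asymp
  then have ev2: "\<forall>\<^sub>F n in sequentially. E2 n / (1 - q2) < 1/4"
    by (rule order_tendstoD) auto
  have ev3: "\<forall>\<^sub>F n in sequentially. 1 \<le> ln (real n)" by real_asymp
  have ev4: "\<forall>\<^sub>F n in sequentially. (ln (real n))\<^sup>2 \<le> real n" by real_asymp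
  have ev5: "\<forall>\<^sub>F n in sequentially. 2 * ln (real n) \<le> real n" by real_asymp
  have ev6: "\<forall>\<^sub>F n in sequentially. real K \<le> ln (real n) / 10" by real_asymp
  show ?thesis
    using ev1 ev2 ev3 ev4 ev5 ev6
  proof eventually_elim
    case (elim n)
    define L where "L = ln (real n)"
    have L: "1 \<le> L" "L\<^sup>2 \<le> real n" "2 * L \<le> real n" "real K \<le> L / 10"
      using elim by (auto simp: L_def)
    have n0: "0 < real n" using L by linarith
    define r where "r = (1 - \<epsilon>) * sqrt (L / real n)"
    have Ln: "0 \<le> L / real n" using L n0 by (intro divide_nonneg_pos) linarith+
    have r: "0 \<le> r" "r \<le> sqrt (L / real n)"
      using eps Ln by (auto simp: r_def intro!: mult_left_le_one_le)
    show ?case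
    proof (intro allI impI)
      fix a M D assume bd: "\<forall>m\<ge>1. torus_bounded n (homog n m) a M"
      then have M0: "0 \<le> M" using torus_bounded_nonneg by blast
      define f where "f m = r ^ m * (\<Sum>\<alpha>\<in>homog n m. cmod (a \<alpha>))" for m
      define A where "A = {m \<in> {1..D}. real m \<le> L / 10}"
      define B where "B = {m \<in> {1..D}. \<not> real m \<le> L / 10}"
      have "(\<Sum>m=1..D. f m) = (\<Sum>m\<in>A \<union> B. f m)"
        by (intro sum.cong) (auto simp: A_def B_def)
      also have "\<dots> = (\<Sum>m\<in>A. f m) + (\<Sum>m\<in>B. f m)"
        by (intro sum.union_disjoint) (auto simp: A_def B_def)
      also have "(\<Sum>m\<in>A. f m) \<le> M * (1/4)"
      proof -
        have fA: "f m \<le> M * E1 n" if "m \<in> A" for m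
        proof -
          have m: "1 \<le> m" "real m \<le> L / 10" using that by (auto simp: A_def)
          have "f m \<le> M * (exp 1 * real n powr (-1/4) * L * (exp 1 * real m + 1) * 6 ^ m)"
            unfolding f_def using m bd L r by (intro low_degree_bound) (auto simp: L_def)
          also have "\<dots> \<le> M * (exp 1 * real n powr (-1/4) * L * (exp 1 * L + 1) * real n powr (1/5))"
          proof -
            have "(6::real) \<le> exp 2"
            proof -
              have "(5/2::real) \<le> exp 1" using exp_lower_Taylor_quadratic[of 1] by simp
              then have "(5/2::real) ^ 2 \<le> exp 1 ^ 2" by (intro power_mono) auto
              moreover have "exp 2 = exp 1 * exp (1::real)" by (simp add: exp_add[symmetric])
              ultimately show ?thesis by (simp add: power2_eq_square)
            qed
            then have "6 ^ m \<le> (exp 2 :: real) ^ m" by (intro power_mono) auto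
            also have "\<dots> = exp (2 * real m)" by (simp add: exp_of_nat_mult[symmetric] mult.commute)
            also have "\<dots> \<le> exp (L / 5)" using m by simp
            also have "\<dots> = real n powr (1/5)" using n0 by (simp add: powr_def L_def)
            finally have six: "6 ^ m \<le> real n powr (1/5)" .
            show ?thesis
              using M0 L m six by (intro mult_left_mono[OF _ M0] mult_mono) auto
          qed
          finally show ?thesis by (simp add: E1_def L_def)
        qed
        have "A \<subseteq> {1..nat \<lfloor>L\<rfloor>}"
          using L by (auto simp: A_def le_nat_floor)
        then have "card A \<le> nat \<lfloor>L\<rfloor>"
          using card_mono[of "{1..nat \<lfloor>L\<rfloor>}" A] by simp
        then have cA: "real (card A) \<le> L" using L by linarith
        have E10: "0 \<le> E1 n"
          using L by (auto simp: E1_def L_def)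
        have "(\<Sum>m\<in>A. f m) \<le> (\<Sum>m\<in>A. M * E1 n)" by (intro sum_mono fA)
        also have "\<dots> = M * (real (card A) * E1 n)" by simp
        also have "\<dots> \<le> M * (L * E1 n)"
          using cA E10 M0 by (intro mult_left_mono mult_right_mono) auto
        also have "\<dots> \<le> M * (1/4)"
          using elim(1) M0 by (intro mult_left_mono) (auto simp: L_def)
        finally show ?thesis .
      qed
      also have "(\<Sum>m\<in>B. f m) \<le> M * (1/4)"
      proof -
        have fB: "f m \<le> M * E2 n * q2 ^ m" if "m \<in> B" for m
        proof -
          have m: "1 \<le> m" "L / 10 \<le> real m" using that by (auto simp: B_def)
          have Km: "K \<le> m" using m L by linarith
          have "f m \<le> M * (exp 1 * L ^ K * ((3 * exp 1 * real m) ^ K + 1) * q ^ m)"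
            unfolding f_def r_def using m bd L eps K Km by (intro high_degree_bound) (auto simp: L_def)
          also have "\<dots> = M * (exp 1 * L ^ K * (((3 * exp 1 * real m) ^ K + 1) * q2 ^ m) * q2 ^ m * q2 ^ m)"
            by (simp add: q2(3) power_mult[symmetric] power_mult_distrib power3_eq_cube)
          also have "\<dots> \<le> M * (exp 1 * L ^ K * C * q2 powr (L / 10) * q2 ^ m)"
          proof -
            have "q2 ^ m = q2 powr real m" using q2 by (simp add: powr_realpow)
            also have "\<dots> \<le> q2 powr (L / 10)" using q2 m by (intro powr_mono') auto
            finally have q2m: "q2 ^ m \<le> q2 powr (L / 10)" .
            have "((3 * exp 1 * real m) ^ K + 1) * q2 ^ m \<le> C" using C(2)[of m] by simp
            then show ?thesis
              using M0 L(1) q2m q2(1) C(1)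
              by (intro mult_left_mono[OF _ M0] mult_right_mono[of _ _ "q2 ^ m"] mult_mono[OF _ q2m] mult_left_mono[of _ C]) auto
          qed
          finally show ?thesis by (simp add: E2_def L_def mult_ac)
        qed
        have E20: "0 \<le> E2 n" using L C by (auto simp: E2_def L_def)
        have "(\<Sum>m\<in>B. q2 ^ m) \<le> (\<Sum>m. q2 ^ m)"
          using q2 by (intro sum_le_suminf summable_geometric) (auto simp: B_def)
        then have geo: "(\<Sum>m\<in>B. q2 ^ m) \<le> 1 / (1 - q2)"
          using q2 by (simp add: suminf_geometric)
        have "(\<Sum>m\<in>B. f m) \<le> (\<Sum>m\<in>B. M * E2 n * q2 ^ m)" by (intro sum_mono fB)
        also have "\<dots> = M * (E2 n * (\<Sum>m\<in>B. q2 ^ m))" by (simp add: sum_distrib_left mult.assoc)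
        also have "\<dots> \<le> M * (E2 n * (1 / (1 - q2)))"
          using geo E20 M0 by (intro mult_left_mono) auto
        also have "\<dots> \<le> M * (1/4)"
          using elim(2) M0 by (intro mult_left_mono) auto
        finally show ?thesis .
      qed
      finally show "(\<Sum>m=1..D. ((1 - \<epsilon>) * sqrt (ln (real n) / real n)) ^ m * (\<Sum>\<alpha>\<in>homog n m. cmod (a \<alpha>))) \<le> M / 2"
        by (simp add: f_def r_def L_def)
    qed
  qed
qed

section \<open>Taylor expansion on polydiscs\<close>

lemma cis_int_power_shift:
  "cis (2 * pi * real l / real N) ^ i * cis (- (2 * pi * real l * real b / real N)) =
     cis (2 * pi * real l * of_int (int i - int b) / real N)"
proof -
  have "cis (2 * pi * real l / real N) ^ i = cis (2 * pi * real l * real i / real N)"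
    by (simp add: Complex.DeMoivre mult_ac)
  then show ?thesis by (simp add: cis_mult algebra_simps diff_divide_distrib)
qed

text \<open>The average over N-th roots of unity collects the coefficients whose index is congruent
  to \<open>b\<close> modulo N. As \<open>b < N\<close>, all of them except \<open>p b\<close> have
  index at least N and belong to the tail.\<close>

lemma series_root_average:
  fixes p :: "nat \<Rightarrow> complex"
  assumes p: "summable (\<lambda>i. norm (p i))" and b: "b < N"
  shows "cmod ((\<Sum>l<N. (\<Sum>i. p i * cis (2 * pi * real l / real N) ^ i) * cis (- (2 * pi * real l * real b / real N))) / of_nat N - p b)
    \<le> (\<Sum>i. cmod (p (i + N)))"
proof -
  define S where "S = (\<Sum>l<N. (\<Sum>i. p i * cis (2 * pi * real l / real N) ^ i) * cis (- (2 * pi * real l * real b / real N))) / of_nat N"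
  define d where "d i = (if int N dvd int i - int b then p i else 0)" for i
  have N: "N > 0" using b by simp
  have sm: "summable (\<lambda>i. p i * cis (2 * pi * real l / real N) ^ i)" for l
    by (rule summable_norm_cancel) (simp add: norm_mult norm_power p)
  have "(\<lambda>i. (\<Sum>l<N. p i * cis (2 * pi * real l / real N) ^ i * cis (- (2 * pi * real l * real b / real N))) / of_nat N) sums S"
    unfolding S_def by (intro sums_divide sums_sum sums_mult2 summable_sums sm)
  also have "(\<lambda>i. (\<Sum>l<N. p i * cis (2 * pi * real l / real N) ^ i * cis (- (2 * pi * real l * real b / real N))) / of_nat N) = d"
  proof
    fix i
    have "(\<Sum>l<N. p i * cis (2 * pi * real l / real N) ^ i * cis (- (2 * pi * real l * real b / real N))) =
        p i * (\<Sum>l<N. cis (2 * pi * real l * of_int (int i - int b) / real N))"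
      unfolding sum_distrib_left cis_int_power_shift[symmetric] by (simp only: mult.assoc)
    then show "(\<Sum>l<N. p i * cis (2 * pi * real l / real N) ^ i * cis (- (2 * pi * real l * real b / real N))) / of_nat N = d i"
      using N unfolding sum_cis_roots[OF N] by (simp add: d_def)
  qed
  finally have dS: "d sums S" .
  have low: "d i = (if i = b then p b else 0)" if "i < N" for i
    using int_dvd_diff_iff[OF that b] by (simp add: d_def)
  have nd: "summable (\<lambda>i. norm (d i))"
    by (rule summable_comparison_test[OF _ p]) (auto simp: d_def)
  have "S = (\<Sum>i. d (i + N)) + (\<Sum>i<N. d i)"
    using suminf_split_initial_segment[OF sums_summable[OF dS], of N] sums_unique[OF dS] by simp
  also have "(\<Sum>i<N. d i) = p b" using low b by (simp add: sum.delta)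
  finally have "S - p b = (\<Sum>i. d (i + N))" by simp
  also have "cmod \<dots> \<le> (\<Sum>i. cmod (d (i + N)))"
    by (rule summable_norm) (rule summable_ignore_initial_segment[OF nd])
  also have "\<dots> \<le> (\<Sum>i. cmod (p (i + N)))"
    by (rule suminf_le[OF _ summable_ignore_initial_segment[OF nd] summable_ignore_initial_segment[OF p]]) (simp add: d_def)
  finally show ?thesis by (simp add: S_def)
qed

text \<open>The coefficients of \<open>h\<close> are, up to an error that vanishes in the limit, those of the nonnegative
  function \<open>2 (B - Re h)\<close>, whose mean is \<open>2 (B - |p 0|)\<close> after a rotation.\<close>
lemma power_series_coeff_bound:
  fixes p :: "nat \<Rightarrow> complex"
  assumes p: "summable (\<lambda>i. norm (p i))" and m: "m \<ge> 1"
    and bd: "\<And>w. cmod w = 1 \<Longrightarrow> cmod (\<Sum>i. p i * w ^ i) \<le> B"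
  shows "cmod (p m) \<le> 2 * (B - cmod (p 0))"
proof -
  define v where "v = (if p 0 = 0 then 1 else of_real (cmod (p 0)) / p 0)"
  have v: "cmod v = 1" "v * p 0 = of_real (cmod (p 0))"
    by (auto simp: v_def norm_divide)
  define p' where "p' i = v * p i" for i
  have p': "summable (\<lambda>i. norm (p' i))" using p v by (simp add: p'_def norm_mult)
  define h where "h w = (\<Sum>i. p' i * w ^ i)" for w
  have hB: "cmod (h w) \<le> B" if "cmod w = 1" for w
  proof -
    have "summable (\<lambda>i. p i * w ^ i)"
      by (rule summable_norm_cancel) (simp add: norm_mult norm_power p that)
    then have "h w = v * (\<Sum>i. p i * w ^ i)"
      unfolding h_def p'_def mult.assoc by (rule suminf_mult)
    then show ?thesis using bd[OF that] v by (simp add: norm_mult)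
  qed
  define R where "R N = (\<Sum>i. cmod (p' (i + N)))" for N
  have R: "R \<longlonglongrightarrow> 0"
    unfolding R_def by (rule suminf_exist_split2[OF p'])
  have key: "cmod (p m) \<le> 2 * (B - cmod (p 0)) + (4 * R N + cmod (p' (N - m)))" if N: "N > m" for N
  proof -
    have N0: "N > 0" using N by simp
    define w where "w l = cis (2 * pi * real l / real N)" for l
    define A where "A b = (\<Sum>l<N. h (w l) * cis (- (2 * pi * real l * real b / real N))) / of_nat N" for b
    have A: "cmod (A b - p' b) \<le> R N" if "b < N" for b
      unfolding A_def h_def w_def R_def by (rule series_root_average[OF p' that])
    have A0: "A 0 = (\<Sum>l<N. h (w l)) / of_nat N" by (simp add: A_def)
    have Re0: "(\<Sum>l<N. B - Re (h (w l))) / real N \<le> B - cmod (p 0) + R N"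
    proof -
      have "(\<Sum>l<N. B - Re (h (w l))) / real N = B - Re (A 0)"
        using N0 by (simp add: A0 sum_subtractf diff_divide_distrib)
      also have "Re (A 0) \<ge> Re (p' 0) - R N"
        using A[of 0] N0 abs_Re_le_cmod[of "A 0 - p' 0"] by simp
      moreover have "Re (p' 0) = cmod (p 0)" by (simp add: p'_def v)
      ultimately show ?thesis by simp
    qed
    \<comment> \<open>The m-th average of the conjugate of \<open>h\<close> is the conjugate of the
      average of index N - m of \<open>h\<close>. It vanishes in the limit, because both the tail
      and the coefficient of index N - m tend to 0.\<close>
    define C where "C = (\<Sum>l<N. cnj (h (w l)) * cis (- (2 * pi * real l * real m / real N))) / of_nat N"
    have C: "cmod C \<le> R N + cmod (p' (N - m))"
    proof -
      have cc: "cis (- (2 * pi * real l * real m / real N)) = cnj (cis (- (2 * pi * real l * real (N - m) / real N)))" for l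
      proof -
        have "- (2 * pi * real l * real m / real N) = 2 * pi * real l * real (N - m) / real N - 2 * pi * real l"
          using N by (simp add: of_nat_diff field_simps)
        then have "cis (- (2 * pi * real l * real m / real N)) = cis (2 * pi * real l * real (N - m) / real N) / cis (2 * pi * real l)"
          by (simp only: cis_divide)
        also have "cis (2 * pi * real l) = 1" by (rule cis_multiple_2pi) simp
        finally show ?thesis by (simp add: cis_cnj)
      qed
      have "C = cnj (A (N - m))"
        unfolding C_def A_def cc by (simp add: cnj_sum)
      moreover have "cmod (A (N - m)) \<le> R N + cmod (p' (N - m))"
        using A[of "N - m"] m N norm_triangle_ineq2[of "A (N - m)" "p' (N - m)"] by simp
      ultimately show ?thesis by simp
    qed
    have z0: "(\<Sum>l<N. cis (- (2 * pi * real l * real m / real N))) = 0"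
    proof -
      have "\<not> int N dvd - int m"
        using m N zdvd_imp_le[of "int N" "int m"] by auto
      then show ?thesis using sum_cis_roots[OF N0, of "- int m"] by simp
    qed
    have "(\<Sum>l<N. of_real (2 * (Re (h (w l)) - B)) * cis (- (2 * pi * real l * real m / real N))) =
        (\<Sum>l<N. h (w l) * cis (- (2 * pi * real l * real m / real N)) + cnj (h (w l)) * cis (- (2 * pi * real l * real m / real N))
          - of_real (2 * B) * cis (- (2 * pi * real l * real m / real N)))"
    proof (intro sum.cong refl)
      fix l
      have "h (w l) + cnj (h (w l)) = of_real (2 * Re (h (w l)))" by (simp add: complex_add_cnj)
      then show "of_real (2 * (Re (h (w l)) - B)) * cis (- (2 * pi * real l * real m / real N)) =
        h (w l) * cis (- (2 * pi * real l * real m / real N)) + cnj (h (w l)) * cis (- (2 * pi * real l * real m / real N))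
          - of_real (2 * B) * cis (- (2 * pi * real l * real m / real N))"
        unfolding distrib_right[symmetric] left_diff_distrib[symmetric] by (simp add: algebra_simps)
    qed
    also have "\<dots> = of_nat N * (A m + C)"
      using N0 z0 by (simp add: sum.distrib sum_subtractf sum_distrib_left[symmetric] A_def C_def distrib_left)
    finally have eq: "of_nat N * (A m + C) = (\<Sum>l<N. of_real (2 * (Re (h (w l)) - B)) * cis (- (2 * pi * real l * real m / real N)))" ..
    have "real N * cmod (A m + C) = cmod (\<Sum>l<N. of_real (2 * (Re (h (w l)) - B)) * cis (- (2 * pi * real l * real m / real N)))"
      unfolding eq[symmetric] by (simp add: norm_mult)
    also have "\<dots> \<le> (\<Sum>l<N. 2 * (B - Re (h (w l))))"
    proof (rule sum_norm_le)
      fix l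
      have "Re (h (w l)) \<le> B"
        using hB[of "w l"] complex_Re_le_cmod[of "h (w l)"] by (simp add: w_def)
      then show "cmod (of_real (2 * (Re (h (w l)) - B)) * cis (- (2 * pi * real l * real m / real N))) \<le> 2 * (B - Re (h (w l)))"
        by (simp add: norm_mult del: of_real_mult of_real_diff)
    qed
    also have "\<dots> = real N * (2 * ((\<Sum>l<N. B - Re (h (w l))) / real N))"
      using N0 by (simp only: sum_distrib_left[symmetric]) simp
    also have "\<dots> \<le> real N * (2 * (B - cmod (p 0) + R N))"
      using Re0 by (intro mult_left_mono) auto
    finally have AC: "cmod (A m + C) \<le> 2 * (B - cmod (p 0) + R N)" using N0 by simp
    have "cmod (p m) = cmod (p' m)" by (simp add: p'_def norm_mult v)
    also have "p' m = (A m + C) - C - (A m - p' m)" by simp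
    also have "cmod \<dots> \<le> cmod (A m + C) + cmod C + cmod (A m - p' m)"
      by (meson add_mono norm_triangle_ineq4 order_trans order_refl)
    also have "\<dots> \<le> 2 * (B - cmod (p 0) + R N) + (R N + cmod (p' (N - m))) + R N"
      using AC C A[OF N] by (intro add_mono)
    finally show ?thesis by simp
  qed
  have "(\<lambda>N. 2 * (B - cmod (p 0)) + (4 * R N + cmod (p' (N - m)))) \<longlonglongrightarrow> 2 * (B - cmod (p 0)) + (4 * 0 + 0)"
  proof (intro tendsto_intros R)
    have "(\<lambda>i. cmod (p' i)) \<longlonglongrightarrow> 0" by (rule summable_LIMSEQ_zero[OF p'])
    moreover have "filterlim (\<lambda>N. N - m) at_top sequentially"
      by (rule filterlim_minus_const_nat_at_top)
    ultimately show "(\<lambda>N. cmod (p' (N - m))) \<longlonglongrightarrow> 0" by (rule filterlim_compose)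
  qed
  then have "cmod (p m) \<le> 2 * (B - cmod (p 0)) + (4 * 0 + 0)"
    by (rule tendsto_lowerbound) (use key in \<open>auto intro!: eventually_sequentiallyI[of "Suc m"]\<close>)
  then show ?thesis by simp
qed

section \<open>Holomorphic functions on polydiscs\<close>

definition polydisc :: "nat \<Rightarrow> (nat \<Rightarrow> real) \<Rightarrow> (nat \<Rightarrow> complex) set" where
  "polydisc n \<rho> = {u \<in> Cn n. \<forall>k<n. cmod (u k) < \<rho> k}"

lemma pderiv_k_funpow: "(pderiv_k k ^^ b) f z = (deriv ^^ b) (\<lambda>t. f (z(k := t))) (z k)"
proof (induction b arbitrary: z)
  case (Suc b)
  have "(\<lambda>t. (pderiv_k k ^^ b) f (z(k := t))) = (\<lambda>t. (deriv ^^ b) (\<lambda>t. f (z(k := t))) t)"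
    by (intro ext) (simp only: Suc.IH fun_upd_upd fun_upd_same)
  moreover have "(pderiv_k k ^^ Suc b) f z = deriv (\<lambda>t. (pderiv_k k ^^ b) f (z(k := t))) (z k)"
    by (simp add: pderiv_k_def[of k "(pderiv_k k ^^ b) f" z])
  ultimately show ?case by (simp only: funpow.simps comp_apply)
qed simp

lemma polydisc_slice_holomorphic:
  assumes f: "holo_n n (polydisc n \<rho>) f" and k: "k < n"
    and z: "\<And>t. cmod t < R \<Longrightarrow> z(k := t) \<in> polydisc n \<rho>"
  shows "(\<lambda>t. f (z(k := t))) holomorphic_on ball 0 R"
proof (rule holomorphic_onI)
  fix t0 :: complex assume "t0 \<in> ball 0 R"
  then have "z(k := t0) \<in> polydisc n \<rho>" using z by simp
  then have "(\<lambda>t. f ((z(k := t0))(k := t))) field_differentiable (at ((z(k := t0)) k))"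
    using f k unfolding holo_n_def by blast
  then show "(\<lambda>t. f (z(k := t))) field_differentiable at t0 within ball 0 R"
    by (simp add: field_differentiable_at_within)
qed

lemma Cauchy_bound_open_ball:
  assumes h: "h holomorphic_on ball 0 R" and R: "0 < R" and bd: "\<And>t. cmod t < R \<Longrightarrow> cmod (h t) \<le> B"
  shows "cmod ((deriv ^^ b) h 0) * R ^ b \<le> fact b * B"
proof -
  have "cmod ((deriv ^^ b) h 0) * r ^ b \<le> fact b * B" if r: "0 < r" "r < R" for r
  proof -
    have "cmod ((deriv ^^ b) h 0) \<le> fact b * B / r ^ b"
    proof (rule Cauchy_inequality)
      show "h holomorphic_on ball 0 r" using h r by (auto intro: holomorphic_on_subset)
      show "continuous_on (cball 0 r) h"
        using r by (intro holomorphic_on_imp_continuous_on holomorphic_on_subset[OF h]) auto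
      show "cmod (h x) \<le> B" if "cmod (0 - x) = r" for x using bd that r by simp
    qed (use r in auto)
    then show ?thesis using r by (simp add: field_simps)
  qed
  moreover have "((\<lambda>r. cmod ((deriv ^^ b) h 0) * r ^ b) \<longlongrightarrow> cmod ((deriv ^^ b) h 0) * R ^ b) (at_left R)"
    by (intro tendsto_intros)
  moreover have "\<forall>\<^sub>F r in at_left R. 0 < r \<and> r < R"
    using eventually_at_left_real[OF R] by simp
  ultimately show ?thesis
    by (intro tendsto_upperbound[of _ _ "at_left R"]) (auto elim!: eventually_mono)
qed

text \<open>A discrete Cauchy formula. The error depends on \<open>h\<close> only through
  \<open>B\<close>, so it is uniform over a family of functions with a common bound.\<close>

lemma Taylor_coeff_root_average:
  assumes h: "h holomorphic_on ball 0 R" and R: "0 < \<delta>" "\<delta> < R" and bd: "\<And>t. cmod t < R \<Longrightarrow> cmod (h t) \<le> B"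
    and N: "b < N"
  shows "cmod ((\<Sum>l<N. h (of_real \<delta> * cis (2 * pi * real l / real N)) * cis (- (2 * pi * real l * real b / real N))) / of_nat N / of_real \<delta> ^ b
      - (deriv ^^ b) h 0 / fact b) \<le> B / \<delta> ^ b * (1 / (1 - \<delta> / R)) * (\<delta> / R) ^ N"
proof -
  define p where "p i = (deriv ^^ i) h 0 / fact i * of_real \<delta> ^ i" for i
  define q where "q = \<delta> / R"
  have q: "0 < q" "q < 1" using R by (auto simp: q_def)
  have pq: "norm (p i) \<le> B * q ^ i" for i
  proof -
    have "cmod ((deriv ^^ i) h 0) * R ^ i \<le> fact i * B"
      using R by (intro Cauchy_bound_open_ball[OF h _ bd]) auto
    then have "cmod ((deriv ^^ i) h 0) / fact i \<le> B / R ^ i"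
      using R by (simp add: field_simps)
    then have "cmod ((deriv ^^ i) h 0) / fact i * \<delta> ^ i \<le> B / R ^ i * \<delta> ^ i"
      using R by (intro mult_right_mono) auto
    then show ?thesis using R by (simp add: p_def q_def norm_mult norm_divide norm_power power_divide)
  qed
  have sq: "summable (\<lambda>i. B * q ^ i)" using q by (intro summable_mult summable_geometric) auto
  have sp: "summable (\<lambda>i. norm (p i))"
    by (rule summable_comparison_test'[OF sq]) (simp add: pq)
  have hp: "h (of_real \<delta> * w) = (\<Sum>i. p i * w ^ i)" if "cmod w = 1" for w
  proof -
    have "(\<lambda>i. (deriv ^^ i) h 0 / fact i * (of_real \<delta> * w - 0) ^ i) sums h (of_real \<delta> * w)"
      using R that by (intro holomorphic_power_series[OF h]) (auto simp: norm_mult)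
    then show ?thesis by (simp add: p_def power_mult_distrib mult_ac sums_iff)
  qed
  define S where "S = (\<Sum>l<N. h (of_real \<delta> * cis (2 * pi * real l / real N)) * cis (- (2 * pi * real l * real b / real N))) / of_nat N"
  have "cmod (S - p b) \<le> (\<Sum>i. cmod (p (i + N)))"
    using series_root_average[OF sp N] by (simp add: S_def hp)
  also have "\<dots> \<le> (\<Sum>i. B * q ^ N * q ^ i)"
  proof (rule suminf_le)
    show "cmod (p (i + N)) \<le> B * q ^ N * q ^ i" for i
      using pq[of "i + N"] by (simp add: power_add mult_ac)
    show "summable (\<lambda>i. cmod (p (i + N)))" by (rule summable_ignore_initial_segment[OF sp])
    show "summable (\<lambda>i. B * q ^ N * q ^ i)" using q by (intro summable_mult summable_geometric) auto
  qed
  also have "\<dots> = B * q ^ N * (1 / (1 - q))"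
    using q by (simp add: suminf_mult summable_geometric suminf_geometric)
  finally have *: "cmod (S - p b) \<le> B * q ^ N * (1 / (1 - q))" .
  have "S / of_real \<delta> ^ b - (deriv ^^ b) h 0 / fact b = (S - p b) / of_real \<delta> ^ b"
    using R by (simp add: p_def field_simps)
  then have "cmod (S / of_real \<delta> ^ b - (deriv ^^ b) h 0 / fact b) = cmod (S - p b) / \<delta> ^ b"
    using R by (simp add: norm_divide norm_power)
  also have "\<dots> \<le> B * q ^ N * (1 / (1 - q)) / \<delta> ^ b"
    using * R by (intro divide_right_mono) auto
  finally show ?thesis by (simp add: S_def q_def mult_ac)
qed

text \<open>This is what induction on the dimension needs. Expanding in the last variable gives
  coefficients that are functions of the first \<open>n\<close> variables; they inherit continuity
  and separate holomorphy as uniform limits of finite combinations of slices of \<open>f\<close>,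
  and a bound from Cauchy's estimate.\<close>

lemma holo_n_pderiv_last:
  assumes f: "holo_n (Suc n) (polydisc (Suc n) \<rho>) f" and \<rho>: "\<And>k. k \<le> n \<Longrightarrow> 0 < \<rho> k"
    and bd: "\<And>u. u \<in> polydisc (Suc n) \<rho> \<Longrightarrow> cmod (f u) \<le> B"
  shows "holo_n n (polydisc n \<rho>) ((pderiv_k n ^^ b) f)"
    and "\<And>u. u \<in> polydisc n \<rho> \<Longrightarrow> cmod ((pderiv_k n ^^ b) f u) * \<rho> n ^ b \<le> fact b * B"
    and "\<And>u. u \<in> polydisc (Suc n) \<rho> \<Longrightarrow>
      (\<lambda>b. (pderiv_k n ^^ b) f (u(n := 0)) / fact b * u n ^ b) sums f u"
proof -
  define D where "D = polydisc n \<rho>"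
  \<comment> \<open>Any radius strictly inside the last disc would do: the ratio to
    \<open>\<rho> n\<close> is the rate of uniform convergence.\<close>
  define \<delta> where "\<delta> = \<rho> n / 2"
  have \<delta>: "0 < \<delta>" "\<delta> < \<rho> n" using \<rho>[of n] by (auto simp: \<delta>_def)
  have ext: "z(n := t) \<in> polydisc (Suc n) \<rho>" if "z \<in> D" "cmod t < \<rho> n" for z t
    using that by (auto simp: D_def polydisc_def Cn_def less_Suc_eq)
  have zn: "z n = 0" if "z \<in> D" for z using that by (simp add: D_def polydisc_def Cn_def)
  have hol: "(\<lambda>t. f (z(n := t))) holomorphic_on ball 0 (\<rho> n)" if "z \<in> D" for z
    using ext[OF that] by (intro polydisc_slice_holomorphic[OF f]) auto
  define g where "g = (pderiv_k n ^^ b) f"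
  have g: "g z = (deriv ^^ b) (\<lambda>t. f (z(n := t))) 0" if "z \<in> D" for z
    by (simp add: g_def pderiv_k_funpow zn[OF that])
  show "cmod ((pderiv_k n ^^ b) f u) * \<rho> n ^ b \<le> fact b * B" if "u \<in> polydisc n \<rho>" for u
    unfolding g_def[symmetric] using that[folded D_def]
    by (simp only: g) (rule Cauchy_bound_open_ball[OF hol \<rho> bd[OF ext]], auto)
  show "(\<lambda>b. (pderiv_k n ^^ b) f (u(n := 0)) / fact b * u n ^ b) sums f u"
    if u: "u \<in> polydisc (Suc n) \<rho>" for u
  proof -
    have uD: "u(n := 0) \<in> D" using u by (auto simp: D_def polydisc_def Cn_def)
    have "cmod (u n) < \<rho> n" using u by (simp add: polydisc_def)
    then have "(\<lambda>b. (deriv ^^ b) (\<lambda>t. f ((u(n := 0))(n := t))) 0 / fact b * (u n - 0) ^ b) sums f ((u(n := 0))(n := u n))"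
      by (intro holomorphic_power_series[OF hol[OF uD]]) simp
    then show ?thesis by (simp add: pderiv_k_funpow)
  qed
  \<comment> \<open>The discrete Cauchy averages of \<open>f\<close> in the last variable. In the
    other variables each is a finite sum of slices of \<open>f\<close>, and the convergence is
    uniform on \<open>D\<close>.\<close>
  define A where "A N z = (\<Sum>l<N. f (z(n := of_real \<delta> * cis (2 * pi * real l / real N))) * cis (- (2 * pi * real l * real b / real N))) / of_nat N / of_real \<delta> ^ b"
    for N z
  have unif: "uniform_limit D A (\<lambda>z. g z / fact b) sequentially"
  proof (rule uniform_limitI)
    fix e :: real assume e: "0 < e"
    have "(\<lambda>N. B / \<delta> ^ b * (1 / (1 - \<delta> / \<rho> n)) * (\<delta> / \<rho> n) ^ N) \<longlonglongrightarrow> B / \<delta> ^ b * (1 / (1 - \<delta> / \<rho> n)) * 0"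
      using \<delta> by (intro tendsto_intros LIMSEQ_power_zero) (simp add: abs_of_pos)
    then have "\<forall>\<^sub>F N in sequentially. B / \<delta> ^ b * (1 / (1 - \<delta> / \<rho> n)) * (\<delta> / \<rho> n) ^ N < e"
      by (rule order_tendstoD) (use e in auto)
    moreover have "\<forall>\<^sub>F N in sequentially. b < N" by (rule eventually_gt_at_top)
    ultimately show "\<forall>\<^sub>F N in sequentially. \<forall>z\<in>D. dist (A N z) (g z / fact b) < e"
    proof eventually_elim
      case (elim N)
      show ?case
      proof
        fix z assume z: "z \<in> D"
        have "cmod (A N z - g z / fact b) \<le> B / \<delta> ^ b * (1 / (1 - \<delta> / \<rho> n)) * (\<delta> / \<rho> n) ^ N"
          unfolding A_def g[OF z]
          by (rule Taylor_coeff_root_average[OF hol[OF z] \<delta> bd[OF ext[OF z]] elim(2)])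
        then show "dist (A N z) (g z / fact b) < e" using elim(1) by (simp add: dist_norm)
      qed
    qed
  qed
  have pt: "cmod (of_real \<delta> * cis t) < \<rho> n" for t using \<delta> by (simp add: norm_mult)
  have cont_upd: "continuous_on S (\<lambda>z. z(n := c))" for S :: "(nat \<Rightarrow> complex) set" and c
  proof (rule continuous_on_coordinatewise_then_product)
    fix i
    show "continuous_on S (\<lambda>z. (z(n := c)) i)"
      by (cases "i = n") (auto intro: continuous_on_product_then_coordinatewise continuous_on_id)
  qed
  have contA: "continuous_on D (A N)" for N
  proof -
    have "continuous_on D (\<lambda>z. f (z(n := of_real \<delta> * cis t)))" for t
    proof (rule continuous_on_compose2[OF _ cont_upd])
      show "continuous_on (polydisc (Suc n) \<rho>) f" using f by (simp add: holo_n_def)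
      show "(\<lambda>z. z(n := of_real \<delta> * cis t)) ` D \<subseteq> polydisc (Suc n) \<rho>" using ext pt by auto
    qed
    then show ?thesis
      unfolding A_def divide_inverse by (intro continuous_intros) auto
  qed
  have contg: "continuous_on D (\<lambda>z. g z / fact b)"
    by (rule uniform_limit_theorem[OF _ unif]) (use contA in auto)
  have diffg: "(\<lambda>t. g (z(k := t))) field_differentiable at (z k)" if z: "z \<in> D" and k: "k < n" for z k
  proof -
    have upd: "z(k := t) \<in> D" if "t \<in> ball 0 (\<rho> k)" for t
      using z that k by (auto simp: D_def polydisc_def Cn_def)
    have "(\<lambda>t. g (z(k := t)) / fact b) holomorphic_on ball 0 (\<rho> k)"
    proof (rule holomorphic_uniform_sequence)
      show "(\<lambda>t. A N (z(k := t))) holomorphic_on ball 0 (\<rho> k)" for N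
      proof -
        have "(\<lambda>t. f ((z(k := t))(n := of_real \<delta> * cis s))) holomorphic_on ball 0 (\<rho> k)" for s
        proof -
          have "(\<lambda>t. f ((z(n := of_real \<delta> * cis s))(k := t))) holomorphic_on ball 0 (\<rho> k)"
          proof (rule polydisc_slice_holomorphic[OF f])
            fix t assume "cmod t < \<rho> k"
            then have "(z(k := t))(n := of_real \<delta> * cis s) \<in> polydisc (Suc n) \<rho>"
              by (intro ext upd pt) simp
            then show "(z(n := of_real \<delta> * cis s))(k := t) \<in> polydisc (Suc n) \<rho>"
              using k by (simp add: fun_upd_twist)
          qed (use k in simp)
          then show ?thesis using k by (simp add: fun_upd_twist)
        qed
        then show ?thesis
          unfolding A_def divide_inverse by (intro holomorphic_intros)
      qed
      show "\<exists>d>0. cball x d \<subseteq> ball 0 (\<rho> k) \<and> uniform_limit (cball x d) (\<lambda>N t. A N (z(k := t))) (\<lambda>t. g (z(k := t)) / fact b) sequentially"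
        if x: "x \<in> ball 0 (\<rho> k)" for x
      proof -
        obtain d where d: "d > 0" "cball x d \<subseteq> ball 0 (\<rho> k)"
          using x by (meson open_ball open_contains_cball)
        have "uniform_limit (cball x d) (\<lambda>N t. A N (z(k := t))) (\<lambda>t. g (z(k := t)) / fact b) sequentially"
          by (rule uniform_limit_compose'[OF unif]) (use d upd in auto)
        then show ?thesis using d by blast
      qed
    qed auto
    moreover have "z k \<in> ball 0 (\<rho> k)" using z k by (simp add: D_def polydisc_def)
    ultimately have "(\<lambda>t. g (z(k := t)) / fact b) field_differentiable at (z k)"
      by (meson holomorphic_on_imp_differentiable_at open_ball)
    then have "(\<lambda>t. g (z(k := t)) / fact b * fact b) field_differentiable at (z k)"
      by (intro field_differentiable_mult) auto
    then show ?thesis by simp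
  qed
  have "continuous_on D (\<lambda>z. g z / fact b * fact b)"
    by (intro continuous_intros contg)
  then have "continuous_on D g" by simp
  then show "holo_n n (polydisc n \<rho>) ((pderiv_k n ^^ b) f)"
    using diffg by (simp add: holo_n_def D_def g_def)
qed

lemma polydisc_0: "polydisc 0 \<rho> = {\<lambda>_. 0}"
  by (auto simp: polydisc_def Cn_def)

lemma MI_0: "MI 0 = {\<lambda>_. 0}"
  by (auto simp: MI_def)

lemma taylor_coeff_Suc:
  assumes "\<alpha> \<in> MI (Suc n)"
  shows "taylor_coeff (Suc n) f \<alpha> = taylor_coeff n ((pderiv_k n ^^ \<alpha> n) f) (\<alpha>(n := 0)) / fact (\<alpha> n)"
proof -
  have "pderiv_multi (Suc n) \<alpha> f = pderiv_multi n (\<alpha>(n := 0)) ((pderiv_k n ^^ \<alpha> n) f)"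
    unfolding pderiv_multi_def by (simp, rule foldr_cong) auto
  moreover have "(\<Prod>k<n. fact (\<alpha> k)) = (\<Prod>k<n. fact ((\<alpha>(n := 0)) k) :: nat)"
    by (intro prod.cong) auto
  ultimately show ?thesis
    by (simp add: taylor_coeff_def)
qed

lemma monomial_Suc: "monomial (Suc n) \<alpha> u = monomial n (\<alpha>(n := 0)) (u(n := 0)) * u n ^ \<alpha> n"
proof -
  have "(\<Prod>k<n. u k ^ \<alpha> k) = (\<Prod>k<n. (u(n := 0)) k ^ (\<alpha>(n := 0)) k)"
    by (intro prod.cong) auto
  then show ?thesis by (simp add: monomial_def)
qed

lemma bij_betw_MI_Suc: "bij_betw (\<lambda>(b, \<alpha>). \<alpha>(n := b)) (UNIV \<times> MI n) (MI (Suc n))"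
  by (rule bij_betwI[where g = "\<lambda>\<alpha>. (\<alpha> n, \<alpha>(n := 0))"]) (auto simp: MI_def fun_eq_iff)

lemma summable_on_MI_geometric:
  assumes "\<And>k. k < n \<Longrightarrow> 0 \<le> q k \<and> q k < 1"
  shows "(\<lambda>\<alpha>. \<Prod>k<n. q k ^ \<alpha> k :: real) summable_on MI n"
proof (rule nonneg_bdd_above_summable_on)
  show "bdd_above (sum (\<lambda>\<alpha>. \<Prod>k<n. q k ^ \<alpha> k) ` {F. F \<subseteq> MI n \<and> finite F})"
  proof (rule bdd_aboveI2)
    fix F assume F: "F \<in> {F. F \<subseteq> MI n \<and> finite F}"
    define d where "d = Max (insert 0 ((\<lambda>(\<alpha>, j). \<alpha> j) ` (F \<times> {..<n})))"
    have d: "\<alpha> j \<le> d" if "\<alpha> \<in> F" "j < n" for \<alpha> j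
      unfolding d_def using that F by (intro Max_ge) auto
    define u where "u g = (\<Prod>k<n. q k ^ g k)" for g :: "nat \<Rightarrow> nat"
    have "(\<Sum>\<alpha>\<in>F. u \<alpha>) = (\<Sum>\<alpha>\<in>F. u (restrict \<alpha> {..<n}))"
      by (simp add: u_def)
    also have "\<dots> = (\<Sum>g\<in>(\<lambda>\<alpha>. restrict \<alpha> {..<n}) ` F. u g)"
      using F by (subst sum.reindex) (auto intro: inj_on_subset[OF inj_on_restrict_MI])
    also have "\<dots> \<le> (\<Sum>g\<in>PiE {..<n} (\<lambda>_. {..d}). u g)"
    proof (rule sum_mono2)
      show "(\<lambda>\<alpha>. restrict \<alpha> {..<n}) ` F \<subseteq> PiE {..<n} (\<lambda>_. {..d})"
        using d by (auto simp: PiE_def extensional_def)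
    qed (use assms in \<open>auto simp: u_def finite_PiE intro!: prod_nonneg\<close>)
    also have "\<dots> = (\<Prod>k<n. \<Sum>b\<le>d. q k ^ b)"
      unfolding u_def by (rule prod_sum_PiE[symmetric]) auto
    also have "\<dots> \<le> (\<Prod>k<n. 1 / (1 - q k))"
    proof (intro prod_mono conjI)
      fix k assume "k \<in> {..<n}"
      then have q: "0 \<le> q k" "q k < 1" using assms by auto
      have "(\<Sum>b\<le>d. q k ^ b) \<le> (\<Sum>b. q k ^ b)"
        using q by (intro sum_le_suminf summable_geometric) auto
      then show "(\<Sum>b\<le>d. q k ^ b) \<le> 1 / (1 - q k)"
        using q by (simp add: suminf_geometric)
      show "0 \<le> (\<Sum>b\<le>d. q k ^ b)" using q by (simp add: sum_nonneg)
    qed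
    finally show "(\<Sum>\<alpha>\<in>F. \<Prod>k<n. q k ^ \<alpha> k) \<le> (\<Prod>k<n. 1 / (1 - q k))" by (simp add: u_def)
  qed
qed (use assms in \<open>auto intro!: prod_nonneg\<close>)

text \<open>Induction on \<open>n\<close>, peeling off the last variable, which is the one that
  \<open>pderiv_multi\<close> differentiates first. \<open>B\<close> has to vary in the induction,
  since the b-th derivative is bounded by \<open>fact b * B / \<rho> n ^ b\<close>. The coefficient
  estimate yields a geometric majorant, and absolute summability then allows the iterated expansion
  to be read as one sum over multi-indices.\<close>

theorem taylor_expansion_polydisc:
  assumes "holo_n n (polydisc n \<rho>) f" and "\<And>k. k < n \<Longrightarrow> 0 < \<rho> k"
    and "\<And>u. u \<in> polydisc n \<rho> \<Longrightarrow> cmod (f u) \<le> B"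
  shows "\<And>\<alpha>. \<alpha> \<in> MI n \<Longrightarrow> cmod (taylor_coeff n f \<alpha>) * (\<Prod>k<n. \<rho> k ^ \<alpha> k) \<le> B"
    and "\<And>u. u \<in> polydisc n \<rho> \<Longrightarrow> (\<lambda>\<alpha>. norm (taylor_coeff n f \<alpha> * monomial n \<alpha> u)) summable_on MI n"
    and "\<And>u. u \<in> polydisc n \<rho> \<Longrightarrow> ((\<lambda>\<alpha>. taylor_coeff n f \<alpha> * monomial n \<alpha> u) has_sum f u) (MI n)"
  using assms
proof (induction n arbitrary: f B)
  case 0
  { case 1
    then show ?case by (auto simp: MI_0 polydisc_0 taylor_coeff_def pderiv_multi_def) }
  { case 2
    then show ?case by (simp add: MI_0) }
  { case (3 u)
    then show ?case
      by (intro has_sum_finiteI) (auto simp: MI_0 polydisc_0 taylor_coeff_def pderiv_multi_def monomial_def) }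
next
  case (Suc n)
  {
    fix f B
    assume f: "holo_n (Suc n) (polydisc (Suc n) \<rho>) f" and \<rho>: "\<And>k. k < Suc n \<Longrightarrow> 0 < \<rho> k"
      and bd: "\<And>u. u \<in> polydisc (Suc n) \<rho> \<Longrightarrow> cmod (f u) \<le> B"
    have \<rho>': "\<And>k. k \<le> n \<Longrightarrow> 0 < \<rho> k" using \<rho> by auto
    have \<rho>n: "0 < \<rho> n" using \<rho>' by simp
    define g where "g b = (pderiv_k n ^^ b) f" for b
    note last = holo_n_pderiv_last[OF f \<rho>' bd, folded g_def]
    have gB: "cmod (g b u) \<le> fact b * B / \<rho> n ^ b" if "u \<in> polydisc n \<rho>" for b u
      using last(2)[OF _ _ that, of b] \<rho>n by (simp add: field_simps)
    have gcoef: "cmod (taylor_coeff n (g b) \<alpha>) * (\<Prod>k<n. \<rho> k ^ \<alpha> k) \<le> fact b * B / \<rho> n ^ b"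
      if "\<alpha> \<in> MI n" for b \<alpha>
      by (rule Suc.IH(1)[OF that last(1)]) (use \<rho>' bd gB in auto)
    have gexp: "((\<lambda>\<alpha>. taylor_coeff n (g b) \<alpha> * monomial n \<alpha> u) has_sum g b u) (MI n)"
      if "u \<in> polydisc n \<rho>" for b u
      by (rule Suc.IH(3)[OF that last(1)]) (use \<rho>' bd gB in auto)
    have coef: "cmod (taylor_coeff (Suc n) f \<alpha>) * (\<Prod>k<Suc n. \<rho> k ^ \<alpha> k) \<le> B" if a: "\<alpha> \<in> MI (Suc n)" for \<alpha>
    proof -
      define b where "b = \<alpha> n"
      define \<alpha>' where "\<alpha>' = \<alpha>(n := 0)"
      have a': "\<alpha>' \<in> MI n" using a by (auto simp: \<alpha>'_def MI_def)
      have pr: "(\<Prod>k<n. \<rho> k ^ \<alpha> k) = (\<Prod>k<n. \<rho> k ^ \<alpha>' k)" by (intro prod.cong) (auto simp: \<alpha>'_def)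
      have "cmod (taylor_coeff (Suc n) f \<alpha>) * (\<Prod>k<Suc n. \<rho> k ^ \<alpha> k) =
          (cmod (taylor_coeff n (g b) \<alpha>') * (\<Prod>k<n. \<rho> k ^ \<alpha>' k)) * (\<rho> n ^ b / fact b)"
        unfolding taylor_coeff_Suc[OF a] by (simp add: g_def b_def \<alpha>'_def[symmetric] norm_divide pr)
      also have "\<dots> \<le> (fact b * B / \<rho> n ^ b) * (\<rho> n ^ b / fact b)"
        using \<rho>n by (intro mult_right_mono gcoef a') auto
      also have "\<dots> = B" using \<rho>n by simp
      finally show ?thesis .
    qed
    have summ: "(\<lambda>\<alpha>. norm (taylor_coeff (Suc n) f \<alpha> * monomial (Suc n) \<alpha> u)) summable_on MI (Suc n)"
      if u: "u \<in> polydisc (Suc n) \<rho>" for u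
    proof (rule Infinite_Sum.abs_summable_on_comparison_test'[where g = "\<lambda>\<alpha>. B * (\<Prod>k<Suc n. (cmod (u k) / \<rho> k) ^ \<alpha> k)"])
      show "(\<lambda>\<alpha>. B * (\<Prod>k<Suc n. (cmod (u k) / \<rho> k) ^ \<alpha> k)) summable_on MI (Suc n)"
      proof (intro summable_on_cmult_right summable_on_MI_geometric)
        fix k assume "k < Suc n"
        then show "0 \<le> cmod (u k) / \<rho> k \<and> cmod (u k) / \<rho> k < 1"
          using u \<rho>[of k] by (simp add: polydisc_def)
      qed
      fix \<alpha> assume a: "\<alpha> \<in> MI (Suc n)"
      have "0 < (\<Prod>k<Suc n. \<rho> k ^ \<alpha> k)" using \<rho> by (intro prod_pos) auto
      then have "cmod (taylor_coeff (Suc n) f \<alpha>) \<le> B / (\<Prod>k<Suc n. \<rho> k ^ \<alpha> k)"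
        using coef[OF a] by (simp only: pos_le_divide_eq)
      then have "cmod (taylor_coeff (Suc n) f \<alpha>) * (\<Prod>k<Suc n. cmod (u k) ^ \<alpha> k) \<le>
          B / (\<Prod>k<Suc n. \<rho> k ^ \<alpha> k) * (\<Prod>k<Suc n. cmod (u k) ^ \<alpha> k)"
        by (intro mult_right_mono prod_nonneg) auto
      also have "\<dots> = B * (\<Prod>k<Suc n. (cmod (u k) / \<rho> k) ^ \<alpha> k)"
        by (simp add: power_divide prod_dividef del: prod.lessThan_Suc)
      finally show "norm (taylor_coeff (Suc n) f \<alpha> * monomial (Suc n) \<alpha> u) \<le> B * (\<Prod>k<Suc n. (cmod (u k) / \<rho> k) ^ \<alpha> k)"
        by (simp add: norm_mult monomial_def prod_norm[symmetric] norm_power del: prod.lessThan_Suc)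
    qed
    have "((\<lambda>\<alpha>. taylor_coeff (Suc n) f \<alpha> * monomial (Suc n) \<alpha> u) has_sum f u) (MI (Suc n))"
      if u: "u \<in> polydisc (Suc n) \<rho>" for u
    proof -
      define F where "F \<alpha> = taylor_coeff (Suc n) f \<alpha> * monomial (Suc n) \<alpha> u" for \<alpha>
      define G where "G = (\<lambda>(b, \<alpha> :: nat \<Rightarrow> nat). F (\<alpha>(n := b)))"
      define u' where "u' = u(n := 0)"
      have u': "u' \<in> polydisc n \<rho>" using u by (auto simp: polydisc_def Cn_def u'_def)
      have un: "cmod (u n) < \<rho> n" using u by (simp add: polydisc_def)
      have "(\<lambda>\<alpha>. F \<alpha>) summable_on MI (Suc n)"
        using summ[OF u] unfolding F_def by (rule Infinite_Sum.abs_summable_summable)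
      then have Gs: "G summable_on (UNIV \<times> MI n)"
        using summable_on_reindex_bij_betw[OF bij_betw_MI_Suc, where f = F] by (simp add: G_def case_prod_unfold)
      have inner: "((\<lambda>\<alpha>. G (b, \<alpha>)) has_sum (g b u' / fact b * u n ^ b)) (MI n)" for b
      proof -
        have "((\<lambda>\<alpha>. taylor_coeff n (g b) \<alpha> * monomial n \<alpha> u' * (u n ^ b / fact b)) has_sum (g b u' / fact b * u n ^ b)) (MI n)"
          using has_sum_cmult_left[OF gexp[OF u', of b], of "u n ^ b / fact b"] by (simp add: mult.commute)
        also have "?this \<longleftrightarrow> ?thesis"
        proof -
          have "taylor_coeff n (g b) \<alpha> * monomial n \<alpha> u' * (u n ^ b / fact b) = G (b, \<alpha>)" if "\<alpha> \<in> MI n" for \<alpha>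
          proof -
            have a: "\<alpha>(n := b) \<in> MI (Suc n)" "(\<alpha>(n := b))(n := 0) = \<alpha>" using that by (auto simp: MI_def)
            show ?thesis
              unfolding G_def F_def using taylor_coeff_Suc[OF a(1)] monomial_Suc[of n "\<alpha>(n := b)" u] a(2)
              by (simp add: g_def u'_def)
          qed
          then show ?thesis by (rule has_sum_cong)
        qed
        finally show ?thesis .
      qed
      have outer: "((\<lambda>b. g b u' / fact b * u n ^ b) has_sum f u) UNIV"
      proof (rule norm_summable_imp_has_sum)
        have b1: "norm (g b u' / fact b * u n ^ b) \<le> B * (cmod (u n) / \<rho> n) ^ b" for b
        proof -
          have "cmod (g b u') / fact b \<le> B / \<rho> n ^ b"
            using gB[OF u', of b] by (simp add: pos_divide_le_eq mult.commute)
          then have "cmod (g b u') / fact b * cmod (u n) ^ b \<le> B / \<rho> n ^ b * cmod (u n) ^ b"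
            by (intro mult_right_mono) auto
          then have "norm (g b u' / fact b * u n ^ b) \<le> B / \<rho> n ^ b * cmod (u n) ^ b"
            by (simp add: norm_mult norm_divide norm_power)
          then show ?thesis by (simp add: power_divide)
        qed
        have b2: "summable (\<lambda>b. B * (cmod (u n) / \<rho> n) ^ b)"
          using un \<rho>n by (intro summable_mult summable_geometric) simp
        show "summable (\<lambda>b. norm (g b u' / fact b * u n ^ b))"
          by (rule summable_comparison_test'[OF b2, of 0]) (simp only: real_norm_def abs_norm_cancel b1)
        show "(\<lambda>b. g b u' / fact b * u n ^ b) sums f u"
          unfolding g_def u'_def by (rule holo_n_pderiv_last(3)[OF f \<rho>' bd u])
      qed
      have "(G has_sum f u) (UNIV \<times> MI n)"
        by (rule has_sum_SigmaI[OF inner outer Gs])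
      then have "(F has_sum f u) (MI (Suc n))"
        using has_sum_reindex_bij_betw[OF bij_betw_MI_Suc, where f = F and S = "f u"] by (simp add: G_def case_prod_unfold)
      then show ?thesis by (simp only: F_def[abs_def])
    qed
    note coef summ this
  }
  note * = this
  { case 1 then show ?case by (intro *(1)) auto }
  { case 2 then show ?case by (intro *(2)) auto }
  { case 3 then show ?case by (intro *(3)) auto }
qed

lemma bij_betw_homog_MI: "bij_betw snd (Sigma UNIV (homog n)) (MI n)"
  by (rule bij_betwI[where g = "\<lambda>\<alpha>. (\<Sum>j<n. \<alpha> j, \<alpha>)"]) (auto simp: homog_def)

lemma monomial_scale: "\<alpha> \<in> homog n m \<Longrightarrow> monomial n \<alpha> (\<lambda>k. c * u k) = c ^ m * monomial n \<alpha> u"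
  by (auto simp: monomial_def homog_def power_mult_distrib prod.distrib power_sum)

text \<open>On the circle through the point with coordinates \<open>w k * z k\<close>,
  \<open>f\<close> is a power series in one unimodular variable whose m-th coefficient is the
  m-homogeneous part at that point. The polydisc is invariant under such rotations, so
  \<open>B\<close> bounds the series and the one-variable estimate applies.\<close>

theorem homog_part_torus_bounded:
  assumes f: "holo_n n (polydisc n \<rho>) f" and \<rho>: "\<And>k. k < n \<Longrightarrow> 0 < \<rho> k"
    and bd: "\<And>u. u \<in> polydisc n \<rho> \<Longrightarrow> cmod (f u) \<le> B"
    and w: "w \<in> polydisc n \<rho>" and m: "1 \<le> m"
  shows "torus_bounded n (homog n m) (\<lambda>\<alpha>. taylor_coeff n f \<alpha> * monomial n \<alpha> w)
    (2 * (B - cmod (taylor_coeff n f (\<lambda>_. 0))))"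
  unfolding torus_bounded_def
proof (intro allI impI)
  fix z :: "nat \<Rightarrow> complex" assume z: "\<forall>j. cmod (z j) = 1"
  define u where "u k = w k * z k" for k
  have scale: "(\<lambda>k. c * u k) \<in> polydisc n \<rho>" if "cmod c = 1" for c
    using w z that by (auto simp: polydisc_def u_def Cn_def norm_mult)
  have u: "u \<in> polydisc n \<rho>" using scale[of 1] by simp
  define F where "F \<alpha> = taylor_coeff n f \<alpha> * monomial n \<alpha> u" for \<alpha>
  define p where "p i = (\<Sum>\<alpha>\<in>homog n i. F \<alpha>)" for i
  have "(\<lambda>\<alpha>. norm (F \<alpha>)) summable_on MI n"
    unfolding F_def by (rule taylor_expansion_polydisc(2)[OF f \<rho> bd u])
  then have "(\<lambda>x. norm (F (snd x))) summable_on (Sigma UNIV (homog n))"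
    using summable_on_reindex_bij_betw[OF bij_betw_homog_MI, where f = "\<lambda>\<alpha>. norm (F \<alpha>)"] by simp
  then obtain S where "((\<lambda>x. norm (F (snd x))) has_sum S) (Sigma UNIV (homog n))"
    by (auto simp: summable_on_def)
  then have "((\<lambda>i. \<Sum>\<alpha>\<in>homog n i. norm (F \<alpha>)) has_sum S) UNIV"
    by (rule has_sum_SigmaD) (auto intro: has_sum_finiteI)
  then have "summable (\<lambda>i. \<Sum>\<alpha>\<in>homog n i. norm (F \<alpha>))"
    by (intro summable_on_imp_summable) (auto simp: summable_on_def)
  then have sp: "summable (\<lambda>i. norm (p i))"
    by (rule summable_comparison_test'[where N = 0]) (simp add: p_def sum_norm_le)
  have exp: "(\<Sum>i. p i * c ^ i) = f (\<lambda>k. c * u k)" if c: "cmod c = 1" for c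
  proof -
    have "((\<lambda>\<alpha>. taylor_coeff n f \<alpha> * monomial n \<alpha> (\<lambda>k. c * u k)) has_sum f (\<lambda>k. c * u k)) (MI n)"
      by (rule taylor_expansion_polydisc(3)[OF f \<rho> bd scale[OF c]])
    then have "((\<lambda>x. taylor_coeff n f (snd x) * monomial n (snd x) (\<lambda>k. c * u k)) has_sum f (\<lambda>k. c * u k)) (Sigma UNIV (homog n))"
      using has_sum_reindex_bij_betw[OF bij_betw_homog_MI, where f = "\<lambda>\<alpha>. taylor_coeff n f \<alpha> * monomial n \<alpha> (\<lambda>k. c * u k)"] by simp
    then have "((\<lambda>i. p i * c ^ i) has_sum f (\<lambda>k. c * u k)) UNIV"
    proof (rule has_sum_SigmaD)
      fix i
      have "(\<Sum>\<alpha>\<in>homog n i. taylor_coeff n f \<alpha> * monomial n \<alpha> (\<lambda>k. c * u k)) = p i * c ^ i"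
        unfolding p_def sum_distrib_right by (intro sum.cong refl) (simp add: monomial_scale F_def)
      then show "((\<lambda>y. taylor_coeff n f (snd (i, y)) * monomial n (snd (i, y)) (\<lambda>k. c * u k)) has_sum p i * c ^ i) (homog n i)"
        by (intro has_sum_finiteI) auto
    qed
    then show ?thesis using has_sum_imp_sums sums_unique by metis
  qed
  have p0: "p 0 = taylor_coeff n f (\<lambda>_. 0)"
  proof -
    have "homog n 0 = {\<lambda>_. 0}"
      by (auto simp: homog_def MI_def fun_eq_iff) (metis lessThan_iff linorder_not_le)
    then show ?thesis by (simp add: p_def F_def monomial_def)
  qed
  have "cmod (p m) \<le> 2 * (B - cmod (p 0))"
    by (rule power_series_coeff_bound[OF sp m]) (use exp bd scale in auto)
  moreover have "(\<Sum>\<alpha>\<in>homog n m. taylor_coeff n f \<alpha> * monomial n \<alpha> w * monomial n \<alpha> z) = p m"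
    unfolding p_def F_def u_def monomial_def by (simp add: power_mult_distrib prod.distrib mult_ac)
  ultimately show "cmod (\<Sum>\<alpha>\<in>homog n m. taylor_coeff n f \<alpha> * monomial n \<alpha> w * monomial n \<alpha> z) \<le>
      2 * (B - cmod (taylor_coeff n f (\<lambda>_. 0)))"
    by (simp add: p0)
qed

section \<open>The lower bound\<close>

locale seq_lattice =
  fixes X :: "(nat \<Rightarrow> complex) set" and nX :: "(nat \<Rightarrow> complex) \<Rightarrow> real"
  assumes lattice: "banach_seq_lattice X nX"
begin

lemma zero_mem: "(\<lambda>k. 0) \<in> X"
  and add_mem: "x \<in> X \<Longrightarrow> y \<in> X \<Longrightarrow> (\<lambda>k. x k + y k) \<in> X"
  and scale_mem: "x \<in> X \<Longrightarrow> (\<lambda>k. c * x k) \<in> X"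
  and unitv_mem: "unitv j \<in> X"
  and nX_eq_0: "x \<in> X \<Longrightarrow> nX x = 0 \<longleftrightarrow> x = (\<lambda>k. 0)"
  and nX_scale: "x \<in> X \<Longrightarrow> nX (\<lambda>k. c * x k) = cmod c * nX x"
  and nX_triangle: "x \<in> X \<Longrightarrow> y \<in> X \<Longrightarrow> nX (\<lambda>k. x k + y k) \<le> nX x + nX y"
  and nX_mono: "x \<in> X \<Longrightarrow> (\<And>k. cmod (y k) \<le> cmod (x k)) \<Longrightarrow> nX y \<le> nX x"
  using lattice unfolding banach_seq_lattice_def by blast+

lemma nX_nonneg: "x \<in> X \<Longrightarrow> 0 \<le> nX x"
  using nX_mono[of x "\<lambda>k. 0"] nX_eq_0[OF zero_mem] by simp

lemma Cn_subset: "Cn n \<subseteq> X"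
proof (induction n)
  case 0
  have "Cn 0 = {\<lambda>k. 0}" by (auto simp: Cn_def)
  then show ?case using zero_mem by simp
next
  case (Suc n)
  show ?case
  proof
    fix z assume z: "z \<in> Cn (Suc n)"
    have "z(n := 0) \<in> X" using z Suc by (auto simp: Cn_def subset_iff)
    then have "(\<lambda>k. (z(n := 0)) k + z n * unitv n k) \<in> X"
      by (intro add_mem scale_mem unitv_mem)
    also have "(\<lambda>k. (z(n := 0)) k + z n * unitv n k) = z"
      by (auto simp: unitv_def)
    finally show "z \<in> X" .
  qed
qed

lemma trunc_mem: "(\<lambda>k. if k < n then u k else 0) \<in> X"
  using Cn_subset[of n] by (auto simp: Cn_def)

lemma normXn_mono: "(\<And>k. k < n \<Longrightarrow> cmod (y k) \<le> cmod (z k)) \<Longrightarrow> normXn nX n y \<le> normXn nX n z"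
  unfolding normXn_def by (intro nX_mono trunc_mem) auto

lemma normXn_scale: "normXn nX n (\<lambda>k. c * z k) = cmod c * normXn nX n z"
proof -
  have "nX (\<lambda>k. of_real (cmod c) * (if k < n then of_real (cmod (z k)) else 0)) =
      cmod c * nX (\<lambda>k. if k < n then of_real (cmod (z k)) else 0)"
    using nX_scale[OF trunc_mem, of "of_real (cmod c)"] by simp
  then show ?thesis
    unfolding normXn_def by (simp add: norm_mult if_distrib cong: if_cong)
qed

lemma normXn_triangle: "normXn nX n (\<lambda>k. y k + z k) \<le> normXn nX n y + normXn nX n z"
proof -
  have nn: "cmod (of_real (cmod (y k) + cmod (z k))) = cmod (y k) + cmod (z k)" for k
    by (subst norm_of_real) simp
  have "normXn nX n (\<lambda>k. y k + z k) \<le> normXn nX n (\<lambda>k. of_real (cmod (y k) + cmod (z k)))"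
    by (rule normXn_mono) (simp only: nn norm_triangle_ineq)
  also have "\<dots> = nX (\<lambda>k. (if k < n then of_real (cmod (y k)) else 0) + (if k < n then of_real (cmod (z k)) else 0))"
    unfolding normXn_def nn by (intro arg_cong[where f = nX]) auto
  also have "\<dots> \<le> normXn nX n y + normXn nX n z"
    unfolding normXn_def by (intro nX_triangle trunc_mem)
  finally show ?thesis .
qed

lemma normXn_const: "0 \<le> c \<Longrightarrow> normXn nX n (\<lambda>k. of_real c) = c * normXn nX n (\<lambda>k. 1)"
  using normXn_scale[of n "of_real c" "\<lambda>k. 1"] by simp

lemma unitv_pos: "0 < nX (unitv j)"
  using nX_nonneg[OF unitv_mem, of j] nX_eq_0[OF unitv_mem, of j]
  by (auto simp: unitv_def fun_eq_iff less_le)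

lemma normXn_ge_coord: "k < n \<Longrightarrow> cmod (z k) * nX (unitv k) \<le> normXn nX n z"
proof -
  assume k: "k < n"
  have "cmod (z k) * nX (unitv k) = nX (\<lambda>j. of_real (cmod (z k)) * unitv k j)"
    using nX_scale[OF unitv_mem, of "of_real (cmod (z k))" k] by simp
  also have "\<dots> \<le> normXn nX n z"
    unfolding normXn_def using k by (intro nX_mono trunc_mem) (auto simp: unitv_def)
  finally show ?thesis .
qed

lemma normXn_le_sum: "normXn nX n z \<le> (\<Sum>k<n. cmod (z k) * nX (unitv k))"
proof -
  have "nX (\<lambda>k. if k < m then of_real (cmod (z k)) else 0) \<le> (\<Sum>k<m. cmod (z k) * nX (unitv k))" for m
  proof (induction m)
    case 0
    then show ?case using nX_eq_0[OF zero_mem] by simp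
  next
    case (Suc m)
    have "nX (\<lambda>k. if k < Suc m then of_real (cmod (z k)) else 0) =
        nX (\<lambda>k. (if k < m then of_real (cmod (z k)) else 0) + of_real (cmod (z m)) * unitv m k)"
      by (intro arg_cong[where f = nX]) (auto simp: unitv_def less_Suc_eq)
    also have "\<dots> \<le> nX (\<lambda>k. if k < m then of_real (cmod (z k)) else 0) + nX (\<lambda>k. of_real (cmod (z m)) * unitv m k)"
      by (intro nX_triangle trunc_mem scale_mem unitv_mem)
    also have "nX (\<lambda>k. of_real (cmod (z m)) * unitv m k) = cmod (z m) * nX (unitv m)"
      using nX_scale[OF unitv_mem, of "of_real (cmod (z m))" m] by simp
    finally show ?case using Suc by simp
  qed
  then show ?thesis by (simp add: normXn_def)
qed

lemma zero_in_ball: "(\<lambda>k. 0) \<in> ballXn nX n"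
  using nX_eq_0[OF zero_mem] by (simp add: ballXn_def Cn_def normXn_def cong: if_cong)

text \<open>The norm depends monotonically on the moduli, so it suffices to enlarge all moduli of
  \<open>z\<close> by one small amount without leaving the open ball. Nothing else about the shape
  of the ball enters the lower bound.\<close>

lemma polydisc_in_ball:
  assumes z: "z \<in> ballXn nX n"
  obtains \<rho> where "\<And>k. k < n \<Longrightarrow> 0 < \<rho> k" "polydisc n \<rho> \<subseteq> ballXn nX n" "z \<in> polydisc n \<rho>"
proof -
  \<comment> \<open>Adding 1 keeps \<open>C\<close> positive for \<open>n = 0\<close> and makes the
    final inequality strict.\<close>
  define C where "C = (\<Sum>k<n. nX (unitv k)) + 1"
  have C: "C > 0" unfolding C_def using unitv_pos by (intro add_nonneg_pos sum_nonneg) (auto intro: less_imp_le)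
  have z1: "normXn nX n z < 1" "z \<in> Cn n" using z by (auto simp: ballXn_def)
  define \<eta> where "\<eta> = (1 - normXn nX n z) / C"
  have \<eta>: "\<eta> > 0" using z1 C by (simp add: \<eta>_def)
  define \<rho> where "\<rho> k = cmod (z k) + \<eta>" for k
  have \<rho>0: "0 < \<rho> k" for k using \<eta> by (simp add: \<rho>_def add_nonneg_pos)
  have "normXn nX n (\<lambda>k. of_real (\<rho> k)) \<le> normXn nX n (\<lambda>k. of_real (cmod (z k))) + normXn nX n (\<lambda>k. of_real \<eta>)"
    using normXn_triangle[of n "\<lambda>k. of_real (cmod (z k))" "\<lambda>k. of_real \<eta>"] by (simp add: \<rho>_def)
  also have "normXn nX n (\<lambda>k. of_real (cmod (z k))) = normXn nX n z"
    by (simp add: normXn_def cong: if_cong)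
  also have "normXn nX n (\<lambda>k. of_real \<eta>) \<le> \<eta> * (C - 1)"
    using normXn_le_sum[of n "\<lambda>k. of_real \<eta>"] \<eta> by (simp add: C_def sum_distrib_left)
  also have "normXn nX n z + \<eta> * (C - 1) < 1"
  proof -
    have "\<eta> * C = 1 - normXn nX n z" using C by (simp add: \<eta>_def)
    then show ?thesis using \<eta> by (simp add: right_diff_distrib)
  qed
  finally have \<rho>1: "normXn nX n (\<lambda>k. of_real (\<rho> k)) < 1" by simp
  have "polydisc n \<rho> \<subseteq> ballXn nX n"
  proof
    fix u assume u: "u \<in> polydisc n \<rho>"
    have "normXn nX n u \<le> normXn nX n (\<lambda>k. of_real (\<rho> k))"
      using u \<rho>0 by (intro normXn_mono) (auto simp: polydisc_def less_imp_le)
    then show "u \<in> ballXn nX n" using u \<rho>1 by (auto simp: ballXn_def polydisc_def)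
  qed
  moreover have "z \<in> polydisc n \<rho>"
    using z1 \<eta> by (simp add: polydisc_def \<rho>_def)
  ultimately show thesis using that \<rho>0 by blast
qed

end

section \<open>From coefficient sums to the Bohr inequality\<close>

lemma holo_n_subset: "holo_n n U f \<Longrightarrow> V \<subseteq> U \<Longrightarrow> holo_n n V f"
  unfolding holo_n_def by (auto intro: continuous_on_subset)

definition bohr_property :: "((nat \<Rightarrow> complex) \<Rightarrow> real) \<Rightarrow> nat \<Rightarrow> (nat \<Rightarrow> nat) set \<Rightarrow> real \<Rightarrow> bool" where
  "bohr_property nX n J r \<longleftrightarrow> (\<forall>f\<in>H_inf_J nX n J.
        (SUP z \<in> (\<lambda>w k. complex_of_real r * w k) ` ballXn nX n.
           (\<Sum>\<^sub>\<infinity>\<alpha>\<in>J \<inter> MI n. ennreal (cmod (taylor_coeff n f \<alpha> * monomial n \<alpha> z))))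
        \<le> ennreal (SUP w \<in> ballXn nX n. cmod (f w)))"

lemma bohr_radius_eq: "bohr_radius nX n J = Sup {r. 0 < r \<and> r < 1 \<and> bohr_property nX n J r}"
  by (simp add: bohr_radius_def bohr_property_def)

text \<open>With M = 2 (B - c0) the hypothesis leaves B - c0 for all terms of positive degree, and
  adding the constant term c0 gives \<open>B\<close> exactly; this explains the factor 1/2.
  \<open>J\<close> only discards nonnegative terms, so the conclusion holds for every index
  set.\<close>

lemma (in seq_lattice) bohr_property_of_l1_bound:
  assumes r: "0 < r"
    and l1: "\<And>a M D. (\<And>m. 1 \<le> m \<Longrightarrow> torus_bounded n (homog n m) a M) \<Longrightarrow>
      (\<Sum>m=1..D. r ^ m * (\<Sum>\<alpha>\<in>homog n m. cmod (a \<alpha>))) \<le> M / 2"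
  shows "bohr_property nX n J r"
  unfolding bohr_property_def
proof (intro ballI SUP_least)
  fix f z assume f: "f \<in> H_inf_J nX n J" and z: "z \<in> (\<lambda>w k. complex_of_real r * w k) ` ballXn nX n"
  then obtain w where w: "w \<in> ballXn nX n" and zw: "z = (\<lambda>k. of_real r * w k)" by auto
  define B where "B = (SUP w \<in> ballXn nX n. cmod (f w))"
  have "bdd_above ((\<lambda>w. cmod (f w)) ` ballXn nX n)"
    using f by (auto simp: H_inf_J_def bounded_iff intro: bdd_aboveI2)
  then have fB: "cmod (f u) \<le> B" if "u \<in> ballXn nX n" for u
    unfolding B_def using that by (intro cSUP_upper)
  obtain \<rho> where \<rho>: "\<And>k. k < n \<Longrightarrow> 0 < \<rho> k" "polydisc n \<rho> \<subseteq> ballXn nX n" "w \<in> polydisc n \<rho>"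
    using polydisc_in_ball[OF w] by metis
  have hol: "holo_n n (polydisc n \<rho>) f"
    using f \<rho> by (auto simp: H_inf_J_def intro: holo_n_subset)
  define c0 where "c0 = cmod (taylor_coeff n f (\<lambda>_. 0))"
  define a where "a \<alpha> = taylor_coeff n f \<alpha> * monomial n \<alpha> w" for \<alpha>
  have tb: "torus_bounded n (homog n m) a (2 * (B - c0))" if "1 \<le> m" for m
    unfolding a_def c0_def using \<rho> fB that by (intro homog_part_torus_bounded[OF hol]) auto
  have hom0: "homog n 0 = {\<lambda>_. 0}"
    by (auto simp: homog_def MI_def fun_eq_iff) (metis lessThan_iff linorder_not_le)
  show "(\<Sum>\<^sub>\<infinity>\<alpha>\<in>J \<inter> MI n. ennreal (cmod (taylor_coeff n f \<alpha> * monomial n \<alpha> z))) \<le> ennreal B"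
  proof (rule infsum_le_finite_sums)
    show "(\<lambda>\<alpha>. ennreal (cmod (taylor_coeff n f \<alpha> * monomial n \<alpha> z))) summable_on J \<inter> MI n"
      by (rule nonneg_summable_on_complete) simp
    fix F assume F: "finite F" "F \<subseteq> J \<inter> MI n"
    define g where "g \<alpha> = cmod (taylor_coeff n f \<alpha> * monomial n \<alpha> z)" for \<alpha>
    have g: "g \<alpha> = r ^ m * cmod (a \<alpha>)" if "\<alpha> \<in> homog n m" for \<alpha> m
      using r monomial_scale[OF that, of "of_real r" w] by (simp add: g_def zw a_def norm_mult norm_power)
    define D where "D = Max (insert 0 ((\<lambda>\<alpha>. \<Sum>j<n. \<alpha> j) ` F))"
    have sub: "F \<subseteq> (\<Union>m\<in>{..D}. homog n m)"
    proof
      fix \<alpha> assume a: "\<alpha> \<in> F"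
      then have "(\<Sum>j<n. \<alpha> j) \<le> D" unfolding D_def using F by (intro Max_ge) auto
      then show "\<alpha> \<in> (\<Union>m\<in>{..D}. homog n m)" using a F by (auto simp: homog_def)
    qed
    have "(\<Sum>\<alpha>\<in>F. g \<alpha>) \<le> (\<Sum>\<alpha>\<in>(\<Union>m\<in>{..D}. homog n m). g \<alpha>)"
      using sub by (intro sum_mono2) (auto simp: g_def)
    also have "\<dots> = (\<Sum>m\<le>D. \<Sum>\<alpha>\<in>homog n m. g \<alpha>)"
      by (rule sum.UNION_disjoint) (simp_all, auto simp: homog_def)
    also have "\<dots> = (\<Sum>m\<le>D. r ^ m * (\<Sum>\<alpha>\<in>homog n m. cmod (a \<alpha>)))"
      unfolding sum_distrib_left by (intro sum.cong refl g)
    also have "{..D} = insert 0 {1..D}" by auto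
    also have "(\<Sum>m\<in>insert 0 {1..D}. r ^ m * (\<Sum>\<alpha>\<in>homog n m. cmod (a \<alpha>))) =
        c0 + (\<Sum>m=1..D. r ^ m * (\<Sum>\<alpha>\<in>homog n m. cmod (a \<alpha>)))"
      by (simp add: hom0 a_def c0_def monomial_def)
    also have "(\<Sum>m=1..D. r ^ m * (\<Sum>\<alpha>\<in>homog n m. cmod (a \<alpha>))) \<le> 2 * (B - c0) / 2"
      by (rule l1) (rule tb)
    finally have "(\<Sum>\<alpha>\<in>F. g \<alpha>) \<le> B" by (simp add: field_simps)
    then show "(\<Sum>\<alpha>\<in>F. ennreal (cmod (taylor_coeff n f \<alpha> * monomial n \<alpha> z))) \<le> ennreal B"
      unfolding g_def[symmetric] by (subst sum_ennreal) (auto simp: g_def intro: ennreal_leI)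
  qed
qed

text \<open>The existence statement shows that the set under the supremum is nonempty, without which
  an upper bound for its elements would not bound \<open>bohr_radius\<close>.\<close>

lemma (in seq_lattice) eventually_bohr_radius_ge:
  assumes eps: "0 < \<epsilon>" "\<epsilon> < 1"
  shows "\<forall>\<^sub>F n in sequentially. (\<exists>r. 0 < r \<and> r < 1 \<and> bohr_property nX n J r) \<and>
    (1 - \<epsilon>) * sqrt (ln (real n) / real n) \<le> bohr_radius nX n J"
proof -
  have "\<forall>\<^sub>F n in sequentially. 0 < ln (real n) / real n" by real_asymp
  moreover have "\<forall>\<^sub>F n in sequentially. sqrt (ln (real n) / real n) < 1" by real_asymp
  ultimately show ?thesis
    using eventually_weighted_l1_sum_le[OF eps]
  proof eventually_elim
    case (elim n)
    define r where "r = (1 - \<epsilon>) * sqrt (ln (real n) / real n)"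
    have r0: "0 < r" using elim eps by (simp add: r_def)
    have "r \<le> 1 * sqrt (ln (real n) / real n)"
      unfolding r_def using elim eps by (intro mult_right_mono) auto
    then have r1: "r < 1" using elim(2) by linarith
    have bp: "bohr_property nX n J r"
      by (rule bohr_property_of_l1_bound[OF r0]) (use elim(3) in \<open>simp add: r_def\<close>)
    then have "r \<le> bohr_radius nX n J"
      unfolding bohr_radius_eq using r0 r1 by (intro cSup_upper) (auto intro!: bdd_aboveI[of _ 1])
    then show ?case using r0 r1 bp by (auto simp: r_def)
  qed
qed

section \<open>Random polynomials on the Euclidean ball\<close>

lemma power_add_ge_linear:
  fixes s y :: real
  assumes "0 \<le> s" "0 \<le> y"
  shows "s ^ Suc m + real (Suc m) * y * s ^ m \<le> (s + y) ^ Suc m"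
proof (induction m)
  case (Suc m)
  have "s ^ Suc (Suc m) + real (Suc (Suc m)) * y * s ^ Suc m \<le> (s ^ Suc m + real (Suc m) * y * s ^ m) * (s + y)"
    using assms by (simp add: algebra_simps)
  also have "\<dots> \<le> (s + y) ^ Suc m * (s + y)"
    using assms by (intro mult_right_mono Suc) auto
  finally show ?case by (simp add: mult.commute)
qed (use assms in simp)

text \<open>The left side is the squarefree part of the multinomial expansion of the right side. For
  squares of moduli on the Euclidean unit ball it bounds the variance of a random squarefree
  polynomial by 1 / m!.\<close>

lemma sum_subsets_prod_le:
  fixes y :: "'a \<Rightarrow> real"
  assumes "finite V" "\<And>k. 0 \<le> y k"
  shows "fact m * (\<Sum>S | S \<subseteq> V \<and> card S = m. \<Prod>k\<in>S. y k) \<le> (\<Sum>k\<in>V. y k) ^ m"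
  using assms(1)
proof (induction V arbitrary: m rule: finite_induct)
  case empty
  have e: "{S. S \<subseteq> {} \<and> card S = m} = (if m = 0 then {{}} else {})" by auto
  show ?case unfolding e by simp
next
  case (insert v V)
  define s where "s = (\<Sum>k\<in>V. y k)"
  have s: "0 \<le> s" using assms(2) by (simp add: s_def sum_nonneg)
  show ?case
  proof (cases m)
    case 0
    have "{S. S \<subseteq> insert v V \<and> card S = 0} = {{}}"
      using insert.hyps by (auto simp: card_eq_0_iff intro: finite_subset)
    then show ?thesis using 0 by simp
  next
    case (Suc m')
    define \<A> where "\<A> j = {S. S \<subseteq> V \<and> card S = j}" for j
    have fin: "finite (\<A> j)" for j using insert.hyps by (simp add: \<A>_def)
    have fS: "finite S \<and> v \<notin> S" if "S \<in> \<A> j" for S j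
      using that insert.hyps by (auto simp: \<A>_def intro: finite_subset)
    have eq: "{S. S \<subseteq> insert v V \<and> card S = m} = \<A> m \<union> insert v ` \<A> m'"
    proof (intro equalityI subsetI)
      fix S assume S: "S \<in> {S. S \<subseteq> insert v V \<and> card S = m}"
      then have fin: "finite S" using insert.hyps by (auto intro: finite_subset)
      show "S \<in> \<A> m \<union> insert v ` \<A> m'"
      proof (cases "v \<in> S")
        case True
        then have "S - {v} \<in> \<A> m'" "S = insert v (S - {v})"
          using S fin Suc by (auto simp: \<A>_def)
        then show ?thesis by blast
      next
        case False
        then show ?thesis using S by (auto simp: \<A>_def)
      qed
    next
      fix S assume "S \<in> \<A> m \<union> insert v ` \<A> m'"
      then consider "S \<in> \<A> m" | S' where "S' \<in> \<A> m'" "S = insert v S'" by blast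
      then show "S \<in> {S. S \<subseteq> insert v V \<and> card S = m}"
      proof cases
        case 1
        then show ?thesis by (auto simp: \<A>_def)
      next
        case (2 S')
        then show ?thesis using fS[OF 2(1)] Suc by (auto simp: \<A>_def)
      qed
    qed
    have inj: "inj_on (insert v) (\<A> m')"
      by (rule inj_onI) (metis fS insert_ident)
    have "(\<Sum>S | S \<subseteq> insert v V \<and> card S = m. \<Prod>k\<in>S. y k) =
        (\<Sum>S\<in>\<A> m. \<Prod>k\<in>S. y k) + (\<Sum>S\<in>insert v ` \<A> m'. \<Prod>k\<in>S. y k)"
      unfolding eq using fin fS by (intro sum.union_disjoint) auto
    also have "(\<Sum>S\<in>insert v ` \<A> m'. \<Prod>k\<in>S. y k) = (\<Sum>S\<in>\<A> m'. y v * (\<Prod>k\<in>S. y k))"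
      using fS by (subst sum.reindex[OF inj]) (auto intro!: sum.cong)
    finally have "fact m * (\<Sum>S | S \<subseteq> insert v V \<and> card S = m. \<Prod>k\<in>S. y k) =
        fact m * (\<Sum>S\<in>\<A> m. \<Prod>k\<in>S. y k) + real m * y v * (fact m' * (\<Sum>S\<in>\<A> m'. \<Prod>k\<in>S. y k))"
      using Suc by (simp add: sum_distrib_left[symmetric] algebra_simps)
    also have "\<dots> \<le> s ^ m + real m * y v * s ^ m'"
      using insert.IH assms(2) by (intro add_mono mult_left_mono) (auto simp: \<A>_def s_def)
    also have "\<dots> \<le> (s + y v) ^ m"
      using power_add_ge_linear[OF s assms(2), of m' v] Suc by simp
    also have "s + y v = (\<Sum>k\<in>insert v V. y k)"
      using insert.hyps by (simp add: s_def add.commute)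
    finally show ?thesis .
  qed
qed

section \<open>Exponential moments of random signs\<close>

lemma cosh_le_exp_square:
  fixes x :: real
  shows "(exp x + exp (- x)) / 2 \<le> exp (x\<^sup>2)"
proof -
  have pos: "(exp x + exp (- x)) / 2 \<le> exp (x\<^sup>2)" if x: "0 \<le> x" for x :: real
  proof (cases "x \<le> 1")
    case True
    have "exp x \<le> 1 + x + x\<^sup>2" using x True by (rule exp_bound)
    moreover have "exp (- x) \<le> 1 - x + x\<^sup>2"
    proof -
      have "1 \<le> 1 + x ^ 3" using x by simp
      also have "\<dots> = (1 - x + x\<^sup>2) * (1 + x)"
        by (simp add: power2_eq_square power3_eq_cube algebra_simps)
      also have "\<dots> \<le> (1 - x + x\<^sup>2) * exp x"
        using exp_ge_add_one_self[of x] True by (intro mult_left_mono) auto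
      finally show ?thesis by (simp add: exp_minus field_simps)
    qed
    ultimately have "(exp x + exp (- x)) / 2 \<le> 1 + x\<^sup>2" by simp
    also have "\<dots> \<le> exp (x\<^sup>2)" by (rule exp_ge_add_one_self)
    finally show ?thesis .
  next
    case False
    then have "x \<le> x\<^sup>2" by (simp add: power2_eq_square)
    then have "exp x \<le> exp (x\<^sup>2)" "exp (- x) \<le> exp (x\<^sup>2)" using x by auto
    then have "(exp x + exp (- x)) / 2 \<le> (exp (x\<^sup>2) + exp (x\<^sup>2)) / 2"
      by (intro divide_right_mono add_mono) auto
    also have "\<dots> = exp (x\<^sup>2)" by simp
    finally show ?thesis .
  qed
  show ?thesis
    using pos[of x] pos[of "- x"] by (cases "0 \<le> x") (auto simp: add.commute)
qed

definition rsign :: "'a set \<Rightarrow> 'a \<Rightarrow> real" where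
  "rsign E s = (if s \<in> E then - 1 else 1)"

text \<open>Independence factors the exponential moment into one hyperbolic cosine per sign. The
  exponent \<open>(b s)\<^sup>2\<close> instead of half of it only affects constants, and these
  disappear in the m-th root.\<close>

lemma cube_mean_exp_le:
  fixes b :: "'a \<Rightarrow> real"
  assumes "finite V"
  shows "cube_mean V (\<lambda>E. exp (\<Sum>s\<in>V. rsign E s * b s)) \<le> exp (\<Sum>s\<in>V. (b s)\<^sup>2)"
  using assms
proof (induction V rule: finite_induct)
  case empty
  then show ?case by simp
next
  case (insert v V)
  have split: "(exp (\<Sum>s\<in>insert v V. rsign E s * b s) + exp (\<Sum>s\<in>insert v V. rsign (insert v E) s * b s)) / 2 =
      (exp (b v) + exp (- b v)) / 2 * exp (\<Sum>s\<in>V. rsign E s * b s)" if "E \<subseteq> V" for E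
  proof -
    have "v \<notin> E" using that insert.hyps by auto
    moreover have "(\<Sum>s\<in>V. rsign (insert v E) s * b s) = (\<Sum>s\<in>V. rsign E s * b s)"
      using insert.hyps by (intro sum.cong) (auto simp: rsign_def)
    ultimately have 1: "(\<Sum>s\<in>insert v V. rsign E s * b s) = b v + (\<Sum>s\<in>V. rsign E s * b s)"
      and 2: "(\<Sum>s\<in>insert v V. rsign (insert v E) s * b s) = - b v + (\<Sum>s\<in>V. rsign E s * b s)"
      using insert.hyps by (simp_all add: rsign_def)
    show ?thesis unfolding 1 2 exp_add by (simp add: field_simps)
  qed
  have "cube_mean (insert v V) (\<lambda>E. exp (\<Sum>s\<in>insert v V. rsign E s * b s)) =
      (exp (b v) + exp (- b v)) / 2 * cube_mean V (\<lambda>E. exp (\<Sum>s\<in>V. rsign E s * b s))"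
    unfolding cube_mean_insert[OF insert.hyps] cube_mean_cmult[symmetric]
    by (intro cube_mean_cong split)
  also have "\<dots> \<le> exp ((b v)\<^sup>2) * exp (\<Sum>s\<in>V. (b s)\<^sup>2)"
    by (intro mult_mono insert.IH cosh_le_exp_square) (auto intro: cube_mean_nonneg)
  also have "\<dots> = exp (\<Sum>s\<in>insert v V. (b s)\<^sup>2)"
    using insert.hyps by (simp add: exp_add)
  finally show ?case .
qed

lemma exists_le_cube_mean:
  assumes "finite V"
  shows "\<exists>E\<subseteq>V. f E \<le> cube_mean V f"
proof (rule ccontr)
  assume "\<not> ?thesis"
  then have *: "cube_mean V f < f E" if "E \<in> Pow V" for E
    using that by (meson PowD not_le)
  have "(\<Sum>E\<in>Pow V. cube_mean V f) < (\<Sum>E\<in>Pow V. f E)"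
  proof (rule sum_strict_mono)
    show "finite (Pow V)" "Pow V \<noteq> {}" using assms by auto
  qed (rule *)
  also have "(\<Sum>E\<in>Pow V. f E) = 2 ^ card V * cube_mean V f"
    by (simp add: cube_mean_def)
  finally show False
    using assms by (simp add: card_Pow)
qed

text \<open>Rounding towards zero keeps the rounded point inside the ball.\<close>
lemma exists_round:
  fixes x :: real
  assumes x: "\<bar>x\<bar> \<le> 1" and H: "0 < H"
  obtains t :: int where "t \<in> {- int H..int H}" "\<bar>of_int t / real H\<bar> \<le> \<bar>x\<bar>" "\<bar>x - of_int t / real H\<bar> \<le> 1 / real H"
proof -
  have pos: "\<exists>t::int. 0 \<le> t \<and> t \<le> int H \<and> of_int t / real H \<le> y \<and> y - of_int t / real H \<le> 1 / real H"
    if y: "0 \<le> y" "y \<le> 1" for y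
  proof (intro exI conjI)
    show "0 \<le> \<lfloor>y * real H\<rfloor>" using y by simp
    have "y * real H \<le> real H" using y by (simp add: mult_left_le_one_le)
    then show "\<lfloor>y * real H\<rfloor> \<le> int H" by linarith
    show "of_int \<lfloor>y * real H\<rfloor> / real H \<le> y"
      using H by (simp add: pos_divide_le_eq)
    have "y * real H - of_int \<lfloor>y * real H\<rfloor> \<le> 1" by linarith
    then have "(y * real H - of_int \<lfloor>y * real H\<rfloor>) / real H \<le> 1 / real H"
      by (intro divide_right_mono) auto
    then show "y - of_int \<lfloor>y * real H\<rfloor> / real H \<le> 1 / real H"
      using H by (simp add: diff_divide_distrib)
  qed
  obtain t where t: "0 \<le> t" "t \<le> int H" "of_int t / real H \<le> \<bar>x\<bar>" "\<bar>x\<bar> - of_int t / real H \<le> 1 / real H"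
    using pos[of "\<bar>x\<bar>"] x by auto
  have t0: "0 \<le> of_int t / real H" using t(1) by simp
  show thesis
  proof (cases "0 \<le> x")
    case True
    then show thesis using t t0 by (intro that[of t]) (simp_all add: abs_le_iff)
  next
    case False
    then show thesis using t t0 by (intro that[of "- t"]) (simp_all add: abs_le_iff)
  qed
qed

lemma norm_le_1_of_sum_squares:
  fixes u :: "nat \<Rightarrow> complex"
  assumes "(\<Sum>k<n. (cmod (u k))\<^sup>2) \<le> 1" "k < n"
  shows "cmod (u k) \<le> 1"
proof -
  have "(cmod (u k))\<^sup>2 \<le> (\<Sum>k<n. (cmod (u k))\<^sup>2)"
    using assms by (intro member_le_sum) auto
  then have "(cmod (u k))\<^sup>2 \<le> 1\<^sup>2" using assms by simp
  then show ?thesis by (rule power2_le_imp_le) simp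
qed

text \<open>A union bound over a finite net of the ball. At each net point the random sum has
  variance at most 1 / m!, so with signs chosen well it is at most of order sqrt (ln Q / m!) at all
  net points at once. The mesh is so fine that passing to an arbitrary point of the ball costs no
  more than 1 / sqrt (m!).\<close>

theorem random_signs_l2_ball:
  fixes n m :: nat
  assumes n: "1 \<le> n" and m: "1 \<le> m"
  defines "H \<equiv> 2 * m * n ^ m * fact m"
  shows "\<exists>e :: nat set \<Rightarrow> real. (\<forall>S. \<bar>e S\<bar> = 1) \<and>
    (\<forall>u. (\<Sum>k<n. (cmod (u k))\<^sup>2) \<le> 1 \<longrightarrow>
      cmod (\<Sum>S | S \<subseteq> {..<n} \<and> card S = m. of_real (e S) * (\<Prod>k\<in>S. u k)) \<le>
      (1 + 4 * sqrt (ln (4 * real ((2 * H + 1) ^ (2 * n))))) / sqrt (fact m))"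
proof -
  define \<S> where "\<S> = {S. S \<subseteq> {..<n} \<and> card S = m}"
  have fin\<S>: "finite \<S>" by (simp add: \<S>_def)
  have H0: "0 < H" using n m by (simp add: H_def)
  define Gr where "Gr = (\<lambda>(s :: int, t :: int). Complex (of_int s / real H) (of_int t / real H)) `
      ({- int H..int H} \<times> {- int H..int H})"
  have finGr: "finite Gr" by (simp add: Gr_def)
  have cardGr: "card Gr \<le> (2 * H + 1)\<^sup>2"
  proof -
    have "card Gr \<le> card ({- int H..int H} \<times> {- int H..int H})"
      unfolding Gr_def by (intro card_image_le) auto
    also have "\<dots> = (2 * H + 1)\<^sup>2"
    proof -
      have "card {- int H..int H} = nat (int H - - int H + 1)" by (rule card_atLeastAtMost_int)
      also have "\<dots> = 2 * H + 1" by linarith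
      finally show ?thesis by (simp only: card_cartesian_product power2_eq_square)
    qed
    finally show ?thesis .
  qed
  define \<N> where "\<N> = {v \<in> PiE {..<n} (\<lambda>_. Gr). (\<Sum>k<n. (cmod (v k))\<^sup>2) \<le> 1}"
  have fin\<N>: "finite \<N>" using finGr by (simp add: \<N>_def finite_PiE)
  have "card \<N> \<le> card (PiE {..<n} (\<lambda>_. Gr))"
    unfolding \<N>_def using finGr by (intro card_mono finite_PiE) auto
  also have "\<dots> = card Gr ^ n" by (simp add: card_PiE)
  also have "\<dots> \<le> ((2 * H + 1)\<^sup>2) ^ n" by (intro power_mono cardGr) simp
  also have "\<dots> = (2 * H + 1) ^ (2 * n)" by (simp add: power_mult)
  finally have card\<N>: "card \<N> \<le> (2 * H + 1) ^ (2 * n)" .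
  define Q where "Q = 4 * real ((2 * H + 1) ^ (2 * n))"
  have Q: "1 < Q"
  proof -
    have "1 \<le> (2 * H + 1) ^ (2 * n)" by simp
    then have "1 \<le> real ((2 * H + 1) ^ (2 * n))" by (simp only: real_of_nat_ge_one_iff)
    then show ?thesis unfolding Q_def by linarith
  qed
  define \<sigma> where "\<sigma> = 1 / sqrt (fact m)"
  have \<sigma>: "0 < \<sigma>" by (simp add: \<sigma>_def)
  \<comment> \<open>Chosen so that the exponent of the sub-Gaussian bound, at most
    \<open>t\<^sup>2 * \<sigma>\<^sup>2\<close>, equals ln Q.\<close>
  define t where "t = sqrt (ln Q) / \<sigma>"
  have t: "0 < t" using Q \<sigma> by (simp add: t_def)
  have t2: "t\<^sup>2 * \<sigma>\<^sup>2 = ln Q" using Q \<sigma> by (simp add: t_def power_divide)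
  define b where "b v c S = t * Re (c * (\<Prod>k\<in>S. v k))" for v :: "nat \<Rightarrow> complex" and c S
  define P where "P E v = (\<Sum>S\<in>\<S>. of_real (rsign E S) * (\<Prod>k\<in>S. v k))" for E and v :: "nat \<Rightarrow> complex"
  \<comment> \<open>The four directions control real and imaginary part from both sides, so that
    one-sided exponential moments suffice.\<close>
  define U :: "complex set" where "U = {1, - 1, \<i>, - \<i>}"
  have U: "finite U" "card U \<le> 4" "\<And>c. c \<in> U \<Longrightarrow> cmod c = 1"
    by (auto simp: U_def card_insert_if)
  have bP: "(\<Sum>S\<in>\<S>. rsign E S * b v c S) = t * Re (c * P E v)" for E v c
    unfolding b_def P_def sum_distrib_left Re_sum by (intro sum.cong refl) (simp add: algebra_simps)
  have bsq: "(\<Sum>S\<in>\<S>. (b v c S)\<^sup>2) \<le> ln Q" if v: "v \<in> \<N>" and c: "c \<in> U" for v c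
  proof -
    have "(\<Sum>S\<in>\<S>. (b v c S)\<^sup>2) \<le> (\<Sum>S\<in>\<S>. t\<^sup>2 * (\<Prod>k\<in>S. (cmod (v k))\<^sup>2))"
    proof (intro sum_mono)
      fix S
      have "\<bar>Re (c * (\<Prod>k\<in>S. v k))\<bar> \<le> cmod (c * (\<Prod>k\<in>S. v k))" by (rule abs_Re_le_cmod)
      also have "\<dots> = (\<Prod>k\<in>S. cmod (v k))" using U(3)[OF c] by (simp add: norm_mult prod_norm)
      finally have "(Re (c * (\<Prod>k\<in>S. v k)))\<^sup>2 \<le> (\<Prod>k\<in>S. cmod (v k))\<^sup>2"
        by (rule abs_le_square_iff[THEN iffD1, OF order_trans]) simp
      then show "(b v c S)\<^sup>2 \<le> t\<^sup>2 * (\<Prod>k\<in>S. (cmod (v k))\<^sup>2)"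
        by (simp add: b_def power_mult_distrib prod_power_distrib mult_left_mono)
    qed
    also have "\<dots> = t\<^sup>2 * (\<Sum>S\<in>\<S>. \<Prod>k\<in>S. (cmod (v k))\<^sup>2)" by (simp add: sum_distrib_left)
    also have "\<dots> \<le> t\<^sup>2 * \<sigma>\<^sup>2"
    proof (intro mult_left_mono)
      have "fact m * (\<Sum>S\<in>\<S>. \<Prod>k\<in>S. (cmod (v k))\<^sup>2) \<le> (\<Sum>k<n. (cmod (v k))\<^sup>2) ^ m"
        unfolding \<S>_def by (rule sum_subsets_prod_le) auto
      also have "\<dots> \<le> 1"
        using v by (intro power_le_one) (auto simp: \<N>_def sum_nonneg)
      finally show "(\<Sum>S\<in>\<S>. \<Prod>k\<in>S. (cmod (v k))\<^sup>2) \<le> \<sigma>\<^sup>2"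
        by (simp add: \<sigma>_def power_divide field_simps)
    qed auto
    finally show ?thesis by (simp add: t2)
  qed
  \<comment> \<open>The union bound in one sum: there are at most \<open>Q\<close> pairs of a net
    point and a direction, each with mean at most \<open>Q\<close>. Some sign pattern keeps the
    whole sum, and so every exponential in it, below \<open>Q * Q\<close>.\<close>
  define \<Phi> where "\<Phi> E = (\<Sum>v\<in>\<N>. \<Sum>c\<in>U. exp (\<Sum>S\<in>\<S>. rsign E S * b v c S))" for E
  obtain E where E: "\<Phi> E \<le> cube_mean \<S> \<Phi>"
    using exists_le_cube_mean[OF fin\<S>] by blast
  have "cube_mean \<S> \<Phi> = (\<Sum>v\<in>\<N>. \<Sum>c\<in>U. cube_mean \<S> (\<lambda>E. exp (\<Sum>S\<in>\<S>. rsign E S * b v c S)))"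
    unfolding \<Phi>_def by (simp only: cube_mean_sum)
  also have "\<dots> \<le> (\<Sum>v\<in>\<N>. \<Sum>c\<in>U. Q)"
  proof (intro sum_mono)
    fix v c assume vc: "v \<in> \<N>" "c \<in> U"
    have "cube_mean \<S> (\<lambda>E. exp (\<Sum>S\<in>\<S>. rsign E S * b v c S)) \<le> exp (\<Sum>S\<in>\<S>. (b v c S)\<^sup>2)"
      by (rule cube_mean_exp_le[OF fin\<S>])
    also have "\<dots> \<le> exp (ln Q)" using bsq[OF vc] by simp
    also have "\<dots> = Q" using Q by simp
    finally show "cube_mean \<S> (\<lambda>E. exp (\<Sum>S\<in>\<S>. rsign E S * b v c S)) \<le> Q" .
  qed
  also have "\<dots> = real (card \<N> * card U) * Q" by simp
  also have "\<dots> \<le> Q * Q"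
  proof (intro mult_right_mono)
    have "card \<N> * card U \<le> (2 * H + 1) ^ (2 * n) * 4"
      using card\<N> U by (intro mult_mono) auto
    then have "real (card \<N> * card U) \<le> real ((2 * H + 1) ^ (2 * n) * 4)"
      by (rule of_nat_mono)
    then show "real (card \<N> * card U) \<le> Q" by (simp add: Q_def)
  qed (use Q in auto)
  finally have EQ: "\<Phi> E \<le> Q * Q" using E by simp
  have dir: "Re (c * P E v) \<le> 2 * sqrt (ln Q) * \<sigma>" if vc: "v \<in> \<N>" "c \<in> U" for v c
  proof -
    have "exp (t * Re (c * P E v)) \<le> (\<Sum>c\<in>U. exp (\<Sum>S\<in>\<S>. rsign E S * b v c S))"
      unfolding bP using vc U by (intro member_le_sum[where f = "\<lambda>c. exp (t * Re (c * P E v))"]) auto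
    also have "\<dots> \<le> \<Phi> E"
      unfolding \<Phi>_def using vc fin\<N> by (intro member_le_sum) (auto intro: sum_nonneg)
    also have "\<dots> \<le> Q * Q" by (rule EQ)
    also have "\<dots> = exp (2 * ln Q)" using Q by (simp add: exp_double power2_eq_square)
    finally have "t * Re (c * P E v) \<le> 2 * ln Q" by simp
    also have "\<dots> = t * (2 * sqrt (ln Q) * \<sigma>)" using Q \<sigma> by (simp add: t_def)
    finally show ?thesis using t by simp
  qed
  have net: "cmod (P E v) \<le> 4 * sqrt (ln Q) * \<sigma>" if v: "v \<in> \<N>" for v
  proof -
    have "\<bar>Re (P E v)\<bar> \<le> 2 * sqrt (ln Q) * \<sigma>"
      using dir[OF v, of 1] dir[OF v, of "- 1"] by (auto simp: U_def abs_le_iff)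
    moreover have "\<bar>Im (P E v)\<bar> \<le> 2 * sqrt (ln Q) * \<sigma>"
      using dir[OF v, of \<i>] dir[OF v, of "- \<i>"] by (auto simp: U_def abs_le_iff)
    ultimately show ?thesis using cmod_le[of "P E v"] by linarith
  qed
  have all: "cmod (P E u) \<le> (1 + 4 * sqrt (ln Q)) * \<sigma>" if u: "(\<Sum>k<n. (cmod (u k))\<^sup>2) \<le> 1" for u
  proof -
    have u1: "cmod (u k) \<le> 1" if "k < n" for k using norm_le_1_of_sum_squares[OF u that] .
    have "\<exists>w\<in>Gr. cmod w \<le> cmod (u k) \<and> cmod (u k - w) \<le> 2 / real H" if k: "k < n" for k
    proof -
      have "\<bar>Re (u k)\<bar> \<le> 1" "\<bar>Im (u k)\<bar> \<le> 1"
        using u1[OF k] abs_Re_le_cmod[of "u k"] abs_Im_le_cmod[of "u k"] by linarith+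
      then obtain s t :: int where s: "s \<in> {- int H..int H}" "\<bar>of_int s / real H\<bar> \<le> \<bar>Re (u k)\<bar>" "\<bar>Re (u k) - of_int s / real H\<bar> \<le> 1 / real H"
        and t: "t \<in> {- int H..int H}" "\<bar>of_int t / real H\<bar> \<le> \<bar>Im (u k)\<bar>" "\<bar>Im (u k) - of_int t / real H\<bar> \<le> 1 / real H"
        using exists_round[OF _ H0] by metis
      define w where "w = Complex (of_int s / real H) (of_int t / real H)"
      have "w \<in> Gr" using s t by (auto simp: Gr_def w_def)
      moreover have "cmod w \<le> cmod (u k)"
      proof -
        have "(of_int s / real H)\<^sup>2 \<le> (Re (u k))\<^sup>2" "(of_int t / real H)\<^sup>2 \<le> (Im (u k))\<^sup>2"
          using s(2) t(2) by (simp_all only: abs_le_square_iff)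
        then show ?thesis
          unfolding cmod_def w_def complex.sel by (intro real_sqrt_le_mono add_mono)
      qed
      moreover have "cmod (u k - w) \<le> 2 / real H"
        using cmod_le[of "u k - w"] s t by (simp add: w_def)
      ultimately show ?thesis by blast
    qed
    then obtain v0 where v0: "\<And>k. k < n \<Longrightarrow> v0 k \<in> Gr \<and> cmod (v0 k) \<le> cmod (u k) \<and> cmod (u k - v0 k) \<le> 2 / real H"
      by metis
    define v where "v = restrict v0 {..<n}"
    have v: "v k = v0 k" if "k < n" for k using that by (simp add: v_def)
    have "(\<Sum>k<n. (cmod (v k))\<^sup>2) \<le> (\<Sum>k<n. (cmod (u k))\<^sup>2)"
      using v0 v by (intro sum_mono power_mono) auto
    then have v\<N>: "v \<in> \<N>" using u v0 by (auto simp: \<N>_def v_def)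
    have "cmod (P E u - P E v) \<le> (\<Sum>S\<in>\<S>. real m * (2 / real H))"
      unfolding P_def sum_subtractf[symmetric] right_diff_distrib[symmetric]
    proof (rule sum_norm_le)
      fix S assume S: "S \<in> \<S>"
      then have Sn: "k < n" if "k \<in> S" for k using that by (auto simp: \<S>_def)
      have "cmod (of_real (rsign E S) * ((\<Prod>k\<in>S. u k) - (\<Prod>k\<in>S. v k))) = cmod ((\<Prod>k\<in>S. u k) - (\<Prod>k\<in>S. v k))"
        by (simp add: norm_mult rsign_def)
      also have "\<dots> \<le> (\<Sum>k\<in>S. cmod (u k - v k))"
        using Sn u1 v0 v by (intro norm_prod_diff) (auto intro: order_trans)
      also have "\<dots> \<le> (\<Sum>k\<in>S. 2 / real H)"
        using Sn v0 v by (intro sum_mono) auto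
      also have "\<dots> = real m * (2 / real H)" using S by (simp add: \<S>_def)
      finally show "cmod (of_real (rsign E S) * ((\<Prod>k\<in>S. u k) - (\<Prod>k\<in>S. v k))) \<le> real m * (2 / real H)" .
    qed
    also have "\<dots> = real (card \<S>) * (real m * (2 / real H))" by simp
    also have "\<dots> \<le> real (n ^ m) * (real m * (2 / real H))"
    proof (intro mult_right_mono)
      have "card \<S> = n choose m" unfolding \<S>_def using n_subsets[of "{..<n}" m] by simp
      also have "\<dots> \<le> n ^ m"
      proof (cases "m \<le> n")
        case True
        then show ?thesis by (rule binomial_le_pow)
      qed (simp add: binomial_eq_0)
      finally show "real (card \<S>) \<le> real (n ^ m)" by simp
    qed auto
    \<comment> \<open>This identity dictates the value of \<open>H\<close>.\<close>
    also have "\<dots> = 1 / fact m" using n m by (simp add: H_def field_simps)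
    also have "\<dots> \<le> \<sigma>"
    proof -
      have "sqrt (fact m) \<le> fact m"
        by (rule real_le_lsqrt) (auto simp: power2_eq_square fact_ge_1)
      then show ?thesis unfolding \<sigma>_def by (intro divide_left_mono) auto
    qed
    finally have "cmod (P E u - P E v) \<le> \<sigma>" .
    then show ?thesis
      using net[OF v\<N>] norm_triangle_sub[of "P E u" "P E v"] by (simp add: algebra_simps)
  qed
  show ?thesis
    using all by (intro exI[of _ "rsign E"]) (auto simp: rsign_def P_def \<S>_def Q_def \<sigma>_def)
qed

section \<open>The upper bound\<close>

lemma pderiv_k_cong:
  assumes "\<And>z. z \<in> Cn n \<Longrightarrow> f z = g z" "k < n" "z \<in> Cn n"
  shows "pderiv_k k f z = pderiv_k k g z"
proof -
  have "(\<lambda>t. f (z(k := t))) = (\<lambda>t. g (z(k := t)))"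
    using assms by (intro ext assms(1)) (auto simp: Cn_def)
  then show ?thesis by (simp only: pderiv_k_def)
qed

lemma pderiv_k_funpow_cong:
  assumes "\<And>z. z \<in> Cn n \<Longrightarrow> f z = g z" "k < n"
  shows "z \<in> Cn n \<Longrightarrow> (pderiv_k k ^^ b) f z = (pderiv_k k ^^ b) g z"
proof (induction b arbitrary: z)
  case (Suc b)
  have "pderiv_k k ((pderiv_k k ^^ b) f) z = pderiv_k k ((pderiv_k k ^^ b) g) z"
    by (rule pderiv_k_cong[OF Suc.IH assms(2) Suc.prems])
  then show ?case by simp
qed (use assms in simp)

text \<open>Derivatives at 0 in the first \<open>n\<close> coordinates never leave
  \<open>Cn n\<close>. This matters because an iterated derivative of a polynomial is identified as
  a polynomial in fewer variables only on that set.\<close>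

lemma taylor_coeff_cong:
  assumes "\<And>z. z \<in> Cn n \<Longrightarrow> f z = g z"
  shows "taylor_coeff n f \<alpha> = taylor_coeff n g \<alpha>"
proof -
  have "foldr (\<lambda>k g. (pderiv_k k ^^ \<alpha> k) g) xs f z = foldr (\<lambda>k g. (pderiv_k k ^^ \<alpha> k) g) xs g z"
    if "set xs \<subseteq> {..<n}" "z \<in> Cn n" for xs z
    using that
  proof (induction xs arbitrary: z)
    case (Cons x xs)
    show ?case
      unfolding foldr.simps comp_apply
      by (rule pderiv_k_funpow_cong[OF Cons.IH]) (use Cons.prems in auto)
  qed (use assms in simp)
  from this[of "[0..<n]" "\<lambda>k. 0"] show ?thesis
    by (simp add: taylor_coeff_def pderiv_multi_def Cn_def atLeast0LessThan)
qed

lemma higher_deriv_sum_powers: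
  fixes C :: "'a \<Rightarrow> complex"
  assumes "finite F"
  shows "(deriv ^^ b) (\<lambda>t. \<Sum>\<alpha>\<in>F. C \<alpha> * t ^ e \<alpha>) 0 = fact b * (\<Sum>\<alpha> | \<alpha> \<in> F \<and> e \<alpha> = b. C \<alpha>)"
proof (induction b arbitrary: C e)
  case 0
  have "(\<Sum>\<alpha>\<in>F. C \<alpha> * 0 ^ e \<alpha>) = (\<Sum>\<alpha>\<in>F. if e \<alpha> = 0 then C \<alpha> else 0)"
    by (intro sum.cong) auto
  then show ?case using assms by (simp add: sum.inter_filter[symmetric])
next
  case (Suc b)
  have "deriv (\<lambda>t. \<Sum>\<alpha>\<in>F. C \<alpha> * t ^ e \<alpha>) = (\<lambda>t. \<Sum>\<alpha>\<in>F. (C \<alpha> * of_nat (e \<alpha>)) * t ^ (e \<alpha> - 1))"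
    by (rule ext, rule DERIV_imp_deriv) (auto intro!: derivative_eq_intros sum.cong simp: mult_ac)
  then have "(deriv ^^ Suc b) (\<lambda>t. \<Sum>\<alpha>\<in>F. C \<alpha> * t ^ e \<alpha>) 0 =
      (deriv ^^ b) (\<lambda>t. \<Sum>\<alpha>\<in>F. (C \<alpha> * of_nat (e \<alpha>)) * t ^ (e \<alpha> - 1)) 0"
    by (simp only: funpow_Suc_right comp_apply)
  also have "\<dots> = fact b * (\<Sum>\<alpha> | \<alpha> \<in> F \<and> e \<alpha> - 1 = b. C \<alpha> * of_nat (e \<alpha>))"
    by (rule Suc.IH)
  also have "(\<Sum>\<alpha> | \<alpha> \<in> F \<and> e \<alpha> - 1 = b. C \<alpha> * of_nat (e \<alpha>)) = (\<Sum>\<alpha> | \<alpha> \<in> F \<and> e \<alpha> = Suc b. C \<alpha> * of_nat (e \<alpha>))"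
    using assms by (intro sum.mono_neutral_right) auto
  also have "\<dots> = of_nat (Suc b) * (\<Sum>\<alpha> | \<alpha> \<in> F \<and> e \<alpha> = Suc b. C \<alpha>)"
    unfolding sum_distrib_left by (intro sum.cong) auto
  finally show ?case by (simp add: mult_ac)
qed

text \<open>Peeling off the last variable, the b-th derivative at 0 keeps the indices with last
  entry \<open>b\<close> and multiplies them by \<open>fact b\<close>, which the normalisation in
  \<open>taylor_coeff_Suc\<close> divides out.\<close>

lemma taylor_coeff_polynomial:
  assumes "finite F" "F \<subseteq> MI n" "\<beta> \<in> MI n"
  shows "taylor_coeff n (\<lambda>z. \<Sum>\<alpha>\<in>F. a \<alpha> * monomial n \<alpha> z) \<beta> = (if \<beta> \<in> F then a \<beta> else 0)"
  using assms
proof (induction n arbitrary: F a \<beta>)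
  case 0
  then have "F = {} \<or> F = {\<beta>}" by (auto simp: MI_0)
  then show ?case
    by (elim disjE) (simp_all add: taylor_coeff_def pderiv_multi_def monomial_def)
next
  case (Suc n)
  define f where "f z = (\<Sum>\<alpha>\<in>F. a \<alpha> * monomial (Suc n) \<alpha> z)" for z
  define b where "b = \<beta> n"
  define \<beta>' where "\<beta>' = \<beta>(n := 0)"
  have \<beta>': "\<beta>' \<in> MI n" "\<beta>'(n := b) = \<beta>" using Suc.prems by (auto simp: \<beta>'_def b_def MI_def)
  define F' where "F' = (\<lambda>\<alpha>. \<alpha>(n := 0)) ` {\<alpha> \<in> F. \<alpha> n = b}"
  define a' where "a' \<gamma> = fact b * a (\<gamma>(n := b))" for \<gamma>
  have F': "finite F'" "F' \<subseteq> MI n" using Suc.prems by (auto simp: F'_def MI_def)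
  have inj: "inj_on (\<lambda>\<alpha>. \<alpha>(n := 0)) {\<alpha> \<in> F. \<alpha> n = b}"
    by (rule inj_onI) (auto simp: fun_eq_iff, metis)
  have "(pderiv_k n ^^ b) f z = (\<Sum>\<gamma>\<in>F'. a' \<gamma> * monomial n \<gamma> z)" if z: "z \<in> Cn n" for z
  proof -
    have zn: "z n = 0" "z(n := 0) = z" using z by (auto simp: Cn_def)
    have "(\<lambda>t. f (z(n := t))) = (\<lambda>t. \<Sum>\<alpha>\<in>F. (a \<alpha> * monomial n (\<alpha>(n := 0)) z) * t ^ \<alpha> n)"
      by (simp add: f_def monomial_Suc zn mult_ac)
    then have "(pderiv_k n ^^ b) f z = (deriv ^^ b) (\<lambda>t. \<Sum>\<alpha>\<in>F. (a \<alpha> * monomial n (\<alpha>(n := 0)) z) * t ^ \<alpha> n) 0"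
      by (simp only: pderiv_k_funpow zn)
    also have "\<dots> = fact b * (\<Sum>\<alpha> | \<alpha> \<in> F \<and> \<alpha> n = b. a \<alpha> * monomial n (\<alpha>(n := 0)) z)"
      using Suc.prems(1) by (rule higher_deriv_sum_powers)
    also have "\<dots> = (\<Sum>\<gamma>\<in>F'. a' \<gamma> * monomial n \<gamma> z)"
      unfolding F'_def sum_distrib_left sum.reindex[OF inj] comp_apply
      by (intro sum.cong refl) (auto simp: a'_def mult_ac)
    finally show ?thesis .
  qed
  then have "taylor_coeff n ((pderiv_k n ^^ b) f) \<beta>' = taylor_coeff n (\<lambda>z. \<Sum>\<gamma>\<in>F'. a' \<gamma> * monomial n \<gamma> z) \<beta>'"
    by (rule taylor_coeff_cong)
  also have "\<dots> = (if \<beta>' \<in> F' then a' \<beta>' else 0)"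
    by (rule Suc.IH[OF F' \<beta>'(1)])
  finally have "taylor_coeff (Suc n) f \<beta> = (if \<beta>' \<in> F' then a \<beta> else 0)"
    unfolding taylor_coeff_Suc[OF Suc.prems(3)] using \<beta>'(2) by (simp add: b_def[symmetric] \<beta>'_def[symmetric] a'_def)
  moreover have "\<beta>' \<in> F' \<longleftrightarrow> \<beta> \<in> F"
  proof
    assume "\<beta>' \<in> F'"
    then obtain \<alpha> where "\<alpha> \<in> F" "\<alpha> n = b" "\<beta>' = \<alpha>(n := 0)" by (auto simp: F'_def)
    then show "\<beta> \<in> F" using \<beta>'(2) by (metis fun_upd_triv fun_upd_upd)
  qed (auto simp: F'_def \<beta>'_def b_def)
  ultimately show ?case by (simp add: f_def[abs_def])
qed

lemma holo_n_polynomial: "holo_n n U (\<lambda>z. \<Sum>\<alpha>\<in>F. a \<alpha> * monomial n \<alpha> z)"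
  unfolding holo_n_def
proof (intro conjI ballI allI impI)
  have coord: "continuous_on U (\<lambda>z. z k)" for k :: nat and U :: "(nat \<Rightarrow> complex) set"
    by (rule continuous_on_product_then_coordinatewise[OF continuous_on_id])
  show "continuous_on U (\<lambda>z. \<Sum>\<alpha>\<in>F. a \<alpha> * monomial n \<alpha> z)"
    unfolding monomial_def by (intro continuous_intros coord)
  fix z :: "nat \<Rightarrow> complex" and k :: nat
  have upd: "(\<lambda>t. (z(k := t)) j) holomorphic_on UNIV" for j
    by (cases "j = k") (auto intro: holomorphic_intros)
  have "(\<lambda>t. \<Sum>\<alpha>\<in>F. a \<alpha> * monomial n \<alpha> (z(k := t))) holomorphic_on UNIV"
    unfolding monomial_def by (intro holomorphic_intros upd)
  then show "(\<lambda>t. \<Sum>\<alpha>\<in>F. a \<alpha> * monomial n \<alpha> (z(k := t))) field_differentiable at (z k)"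
    by (rule holomorphic_on_imp_differentiable_at) auto
qed

lemma monomial_sqf:
  assumes "S \<subseteq> {..<n}"
  shows "monomial n (sqf S) z = (\<Prod>k\<in>S. z k)"
proof -
  have "monomial n (sqf S) z = (\<Prod>k<n. if k \<in> S then z k else 1)"
    unfolding monomial_def by (intro prod.cong) (auto simp: sqf_def)
  then show ?thesis
    using assms by (simp add: prod.inter_restrict[symmetric] Int_absorb1)
qed

section \<open>The constant vector and the test polynomial\<close>

context seq_lattice
begin

lemma cmod_le_of_normXn_le_1: "normXn nX n z \<le> 1 \<Longrightarrow> k < n \<Longrightarrow> cmod (z k) \<le> 1 / nX (unitv k)"
  using normXn_ge_coord[of k n z] unitv_pos[of k] by (simp add: pos_le_divide_eq)

lemma sum_cmod_le_id_norm_l1: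
  assumes "z \<in> Cn n" "normXn nX n z \<le> 1"
  shows "(\<Sum>k<n. cmod (z k)) \<le> id_norm_l1 nX n"
  unfolding id_norm_l1_def
proof (rule cSUP_upper)
  show "bdd_above ((\<lambda>z. \<Sum>k<n. cmod (z k)) ` {z \<in> Cn n. normXn nX n z \<le> 1})"
    by (rule bdd_aboveI2[of _ _ "\<Sum>k<n. 1 / nX (unitv k)"]) (auto intro!: sum_mono cmod_le_of_normXn_le_1)
qed (use assms in auto)

lemma l2_le_id_norm_l2:
  assumes "z \<in> Cn n" "normXn nX n z \<le> 1"
  shows "sqrt (\<Sum>k<n. (cmod (z k))\<^sup>2) \<le> id_norm_l2 nX n"
  unfolding id_norm_l2_def
proof (rule cSUP_upper)
  show "bdd_above ((\<lambda>z. sqrt (\<Sum>k<n. (cmod (z k))\<^sup>2)) ` {z \<in> Cn n. normXn nX n z \<le> 1})"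
  proof (rule bdd_aboveI2)
    fix z assume z: "z \<in> {z \<in> Cn n. normXn nX n z \<le> 1}"
    have "sqrt (\<Sum>k<n. (cmod (z k))\<^sup>2) \<le> (\<Sum>k<n. cmod (z k))"
      using L2_set_le_sum[of "{..<n}" "\<lambda>k. cmod (z k)"] by (simp add: L2_set_def)
    also have "\<dots> \<le> id_norm_l1 nX n" using z by (intro sum_cmod_le_id_norm_l1) auto
    finally show "sqrt (\<Sum>k<n. (cmod (z k))\<^sup>2) \<le> id_norm_l1 nX n" .
  qed
qed (use assms in auto)

lemma id_norm_l1_pos:
  assumes "1 \<le> n"
  shows "0 < id_norm_l1 nX n"
proof -
  define c where "c = 1 / nX (unitv 0)"
  have c: "c > 0" using unitv_pos[of 0] by (simp add: c_def)
  define z where "z = (\<lambda>k. of_real c * unitv 0 k)"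
  have "normXn nX n z \<le> (\<Sum>k<n. cmod (z k) * nX (unitv k))" by (rule normXn_le_sum)
  also have "\<dots> = (\<Sum>k<n. if k = 0 then 1 else 0)"
  proof (intro sum.cong refl)
    fix k
    have "cmod (z k) = (if k = 0 then c else 0)" using c by (simp add: z_def unitv_def)
    moreover have "c * nX (unitv 0) = 1" using unitv_pos[of 0] by (simp add: c_def)
    ultimately show "cmod (z k) * nX (unitv k) = (if k = 0 then 1 else 0)" by auto
  qed
  also have "\<dots> \<le> 1" by (simp add: sum.delta')
  finally have "(\<Sum>k<n. cmod (z k)) \<le> id_norm_l1 nX n"
    using assms by (intro sum_cmod_le_id_norm_l1) (auto simp: z_def Cn_def unitv_def)
  moreover have "cmod (z 0) \<le> (\<Sum>k<n. cmod (z k))"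
    using assms by (intro member_le_sum) auto
  moreover have "cmod (z 0) = c" using c by (simp add: z_def unitv_def)
  ultimately show ?thesis using c by linarith
qed

text \<open>A vector almost attaining the \<open>\<ell>\<^sub>1\<close> norm is nearly constant, by the equality case of
  Cauchy--Schwarz.\<close>
lemma constant_vector_in_ball:
  assumes n: "1 \<le> n" and l2: "id_norm_l2 nX n \<le> id_norm_l1 nX n / sqrt (real n)"
  shows "id_norm_l1 nX n / real n * normXn nX n (\<lambda>k. 1) \<le> 1"
proof (rule ccontr)
  define L where "L = id_norm_l1 nX n"
  define c where "c = L / real n"
  define N where "N = normXn nX n (\<lambda>k. 1)"
  have L: "L > 0" using id_norm_l1_pos[OF n] by (simp add: L_def)
  have c: "c > 0" using L n by (simp add: c_def)
  assume "\<not> ?thesis"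
  then have cN: "1 < c * N" by (simp add: c_def N_def L_def)
  then have N: "N > 0" using c by (metis less_trans zero_less_mult_pos zero_less_one)
  \<comment> \<open>Half of the excess of c N over 1, relative to N, so that c N at most 1 +
    \<open>\<eta>\<close> N is contradictory. \<open>\<delta>\<close> is then fitted so that the
    quadratic deviation bound 2 c \<open>\<delta>\<close> equals \<open>\<eta>\<^sup>2\<close>; an
    approximate maximiser is enough.\<close>
  define \<eta> where "\<eta> = (c * N - 1) / (2 * N)"
  have \<eta>: "\<eta> > 0" using cN N by (simp add: \<eta>_def)
  define \<delta> where "\<delta> = \<eta>\<^sup>2 / (2 * c)"
  have \<delta>: "\<delta> > 0" using \<eta> c by (simp add: \<delta>_def)
  have ne: "{z \<in> Cn n. normXn nX n z \<le> 1} \<noteq> {}"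
    using zero_in_ball[of n] by (auto simp: ballXn_def intro: less_imp_le)
  have "\<exists>z\<in>{z \<in> Cn n. normXn nX n z \<le> 1}. L - \<delta> < (\<Sum>k<n. cmod (z k))"
  proof (rule ccontr)
    assume "\<not> ?thesis"
    then have "id_norm_l1 nX n \<le> L - \<delta>"
      unfolding id_norm_l1_def using ne by (intro cSUP_least) auto
    then show False using \<delta> by (simp add: L_def)
  qed
  then obtain z where z: "z \<in> Cn n" "normXn nX n z \<le> 1" "L - \<delta> < (\<Sum>k<n. cmod (z k))" by auto
  have "sqrt (\<Sum>k<n. (cmod (z k))\<^sup>2) \<le> L / sqrt (real n)"
    using l2_le_id_norm_l2[OF z(1,2)] l2 by (simp add: L_def)
  then have "(sqrt (\<Sum>k<n. (cmod (z k))\<^sup>2))\<^sup>2 \<le> (L / sqrt (real n))\<^sup>2"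
    by (intro power_mono) (auto simp: sum_nonneg)
  then have sq: "(\<Sum>k<n. (cmod (z k))\<^sup>2) \<le> c * L"
    by (simp add: sum_nonneg power_divide c_def power2_eq_square)
  have "(\<Sum>k<n. (cmod (z k) - c)\<^sup>2) = (\<Sum>k<n. (cmod (z k))\<^sup>2) - 2 * c * (\<Sum>k<n. cmod (z k)) + real n * c\<^sup>2"
    by (simp add: power2_diff sum.distrib sum_subtractf sum_distrib_left mult_ac)
  also have "real n * c\<^sup>2 = c * L" using n by (simp add: c_def power2_eq_square)
  also have "(\<Sum>k<n. (cmod (z k))\<^sup>2) - 2 * c * (\<Sum>k<n. cmod (z k)) + c * L \<le> c * L - 2 * c * (L - \<delta>) + c * L"
    using sq z(3) c by (intro add_mono diff_mono mult_left_mono) auto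
  also have "\<dots> = \<eta>\<^sup>2" using c by (simp add: \<delta>_def right_diff_distrib)
  finally have sqd: "(\<Sum>k<n. (cmod (z k) - c)\<^sup>2) \<le> \<eta>\<^sup>2" .
  have near: "c \<le> cmod (z k) + \<eta>" if "k < n" for k
  proof -
    have "(cmod (z k) - c)\<^sup>2 \<le> (\<Sum>k<n. (cmod (z k) - c)\<^sup>2)"
      using that by (intro member_le_sum) auto
    then have "(cmod (z k) - c)\<^sup>2 \<le> \<eta>\<^sup>2" using sqd by linarith
    then have "\<bar>cmod (z k) - c\<bar> \<le> \<eta>" using \<eta> by (metis abs_le_square_iff abs_of_pos)
    then show ?thesis by linarith
  qed
  have "c * N = normXn nX n (\<lambda>k. of_real c)" using c by (simp add: N_def normXn_const)
  also have "\<dots> \<le> normXn nX n (\<lambda>k. of_real (cmod (z k)) + of_real \<eta>)"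
  proof (rule normXn_mono)
    fix k assume "k < n"
    then show "cmod (of_real c) \<le> cmod (of_real (cmod (z k)) + of_real \<eta>)"
      using near[of k] c \<eta> by (simp flip: of_real_add)
  qed
  also have "\<dots> \<le> normXn nX n (\<lambda>k. of_real (cmod (z k))) + normXn nX n (\<lambda>k. of_real \<eta>)"
    by (rule normXn_triangle)
  also have "normXn nX n (\<lambda>k. of_real (cmod (z k))) = normXn nX n z"
    by (simp add: normXn_def cong: if_cong)
  also have "normXn nX n (\<lambda>k. of_real \<eta>) = \<eta> * N" using \<eta> by (simp add: N_def normXn_const)
  finally have "c * N \<le> 1 + \<eta> * N" using z(2) by linarith
  moreover have "2 * (\<eta> * N) = c * N - 1" using N by (simp add: \<eta>_def)
  ultimately show False using cN by linarith
qed

text \<open>The Bohr inequality is tested with the random polynomial near the vector with all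
  entries r L / n. Each of its coefficients has modulus 1 and contributes (r L / n)^m, while on the
  ball the polynomial is at most (L / sqrt n)^m times its bound on the Euclidean unit ball. The norm
  L cancels, so the result no longer depends on the lattice.\<close>

lemma bohr_property_upper:
  fixes n m :: nat
  assumes n: "1 \<le> n" and m: "1 \<le> m" and l2: "id_norm_l2 nX n \<le> id_norm_l1 nX n / sqrt (real n)"
    and J: "Lambda_T \<subseteq> J" and r: "0 < r" "bohr_property nX n J r"
  shows "real (n choose m) * r ^ m \<le> sqrt (real n) ^ m *
    ((1 + 4 * sqrt (ln (4 * real ((2 * (2 * m * n ^ m * fact m) + 1) ^ (2 * n))))) / sqrt (fact m))"
proof -
  define W where "W = (1 + 4 * sqrt (ln (4 * real ((2 * (2 * m * n ^ m * fact m) + 1) ^ (2 * n))))) / sqrt (fact m)"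
  define L where "L = id_norm_l1 nX n"
  define c where "c = L / real n"
  define R where "R = L / sqrt (real n)"
  have L: "L > 0" using id_norm_l1_pos[OF n] by (simp add: L_def)
  have c: "c > 0" using L n by (simp add: c_def)
  have R: "R > 0" using L n by (simp add: R_def)
  define \<S> where "\<S> = {S. S \<subseteq> {..<n} \<and> card S = m}"
  have fin\<S>: "finite \<S>" by (simp add: \<S>_def)
  obtain e :: "nat set \<Rightarrow> real" where e: "\<And>S. \<bar>e S\<bar> = 1"
    and e_bd: "\<And>u. (\<Sum>k<n. (cmod (u k))\<^sup>2) \<le> 1 \<Longrightarrow> cmod (\<Sum>S\<in>\<S>. of_real (e S) * (\<Prod>k\<in>S. u k)) \<le> W"
    using random_signs_l2_ball[OF n m] unfolding \<S>_def W_def by blast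
  \<comment> \<open>Extends the signs from sets to all multi-indices; only the values at
    \<open>sqf S\<close>, where the set read off is \<open>S\<close> itself, are used.\<close>
  define a where "a \<alpha> = complex_of_real (e {j. \<alpha> j = 1})" for \<alpha> :: "nat \<Rightarrow> nat"
  have a_sqf: "a (sqf S) = of_real (e S)" for S
    unfolding a_def sqf_def by (rule arg_cong[where f = "\<lambda>S. of_real (e S)"]) auto
  define F where "F = sqf ` \<S>"
  have F: "finite F" "F \<subseteq> MI n"
    using fin\<S> sqf_homog by (auto simp: F_def \<S>_def homog_def)
  define f where "f z = (\<Sum>\<alpha>\<in>F. a \<alpha> * monomial n \<alpha> z)" for z
  have f: "f z = (\<Sum>S\<in>\<S>. of_real (e S) * (\<Prod>k\<in>S. z k))" for z
    unfolding f_def F_def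
    by (subst sum.reindex[OF inj_on_subset[OF inj_sqf]]) (auto simp: a_sqf monomial_sqf \<S>_def)
  have coeff: "taylor_coeff n f \<beta> = (if \<beta> \<in> F then a \<beta> else 0)" if "\<beta> \<in> MI n" for \<beta>
    unfolding f_def[abs_def] by (rule taylor_coeff_polynomial[OF F that])
  have FJ: "F \<subseteq> J"
  proof -
    have "sqf S \<in> Lambda_T" if "S \<in> \<S>" for S
    proof -
      have "{k. sqf S k \<noteq> 0} = S" by (auto simp: sqf_def)
      moreover have "finite S" using that by (auto simp: \<S>_def intro: finite_subset)
      ultimately show ?thesis by (auto simp: Lambda_T_def multi_indices_def sqf_def)
    qed
    then show ?thesis using J by (auto simp: F_def)
  qed
  have fM: "cmod (f z) \<le> R ^ m * W" if z: "z \<in> ballXn nX n" for z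
  proof -
    define u where "u k = z k / of_real R" for k
    have "sqrt (\<Sum>k<n. (cmod (z k))\<^sup>2) \<le> R"
      using l2_le_id_norm_l2[of z n] l2 z by (auto simp: ballXn_def R_def L_def)
    then have "(sqrt (\<Sum>k<n. (cmod (z k))\<^sup>2))\<^sup>2 \<le> R\<^sup>2"
      by (intro power_mono) (auto simp: sum_nonneg)
    then have "(\<Sum>k<n. (cmod (z k))\<^sup>2) \<le> R\<^sup>2" by (simp add: sum_nonneg)
    then have "(\<Sum>k<n. (cmod (u k))\<^sup>2) \<le> 1"
      using R by (simp add: u_def norm_divide power_divide sum_divide_distrib[symmetric])
    then have "cmod (f u) \<le> W" unfolding f by (rule e_bd)
    moreover have "f z = of_real R ^ m * f u"
      unfolding f sum_distrib_left
    proof (intro sum.cong refl)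
      fix S assume "S \<in> \<S>"
      then have "(\<Prod>k\<in>S. z k) = of_real R ^ m * (\<Prod>k\<in>S. u k)"
        using R by (simp add: u_def prod_dividef \<S>_def)
      then show "of_real (e S) * (\<Prod>k\<in>S. z k) = of_real R ^ m * (of_real (e S) * (\<Prod>k\<in>S. u k))" by simp
    qed
    ultimately show ?thesis using R by (simp add: norm_mult norm_power mult_left_mono)
  qed
  have fH: "f \<in> H_inf_J nX n J"
  proof -
    have "bounded (f ` ballXn nX n)"
      using fM by (auto simp: bounded_iff)
    moreover have "holo_n n (ballXn nX n) f"
      unfolding f_def[abs_def] by (rule holo_n_polynomial)
    ultimately show ?thesis
      using FJ coeff by (auto simp: H_inf_J_def)
  qed
  have supf: "(SUP w \<in> ballXn nX n. cmod (f w)) \<le> R ^ m * W"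
    using zero_in_ball fM by (intro cSUP_least) auto
  have RW: "0 \<le> R ^ m * W"
    using fM[OF zero_in_ball] norm_ge_zero order_trans by blast
  \<comment> \<open>The constant vector is only known to lie in the closed ball, hence the factor s
    < 1, removed afterwards by letting s tend to 1.\<close>
  have key: "real (card \<S>) * (r * (s * c)) ^ m \<le> R ^ m * W" if s: "0 < s" "s < 1" for s
  proof -
    define w where "w k = (if k < n then complex_of_real (s * c) else 0)" for k
    have "normXn nX n w = normXn nX n (\<lambda>k. of_real (s * c))"
      by (simp add: normXn_def w_def cong: if_cong)
    also have "\<dots> = s * (c * normXn nX n (\<lambda>k. 1))"
      using s c by (subst normXn_const) auto
    also have "\<dots> \<le> s * 1"
      using constant_vector_in_ball[OF n l2] s by (intro mult_left_mono) (auto simp: c_def L_def)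
    finally have w: "w \<in> ballXn nX n" using s by (simp add: ballXn_def Cn_def w_def)
    define z where "z = (\<lambda>k. of_real r * w k)"
    have coeff_z: "cmod (taylor_coeff n f \<alpha> * monomial n \<alpha> z) = (r * (s * c)) ^ m" if "\<alpha> \<in> F" for \<alpha>
    proof -
      obtain S where S: "S \<in> \<S>" "\<alpha> = sqf S" using \<open>\<alpha> \<in> F\<close> by (auto simp: F_def)
      have "monomial n \<alpha> z = (\<Prod>k\<in>S. z k)" using S by (simp add: monomial_sqf \<S>_def)
      also have "\<dots> = (\<Prod>k\<in>S. of_real (r * (s * c)))"
        using S by (intro prod.cong) (auto simp: z_def w_def \<S>_def)
      also have "\<dots> = of_real (r * (s * c)) ^ m" using S by (simp add: \<S>_def)
      finally have "cmod (monomial n \<alpha> z) = (r * (s * c)) ^ m"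
        using r s c by (simp add: norm_power norm_mult)
      moreover have "taylor_coeff n f \<alpha> = of_real (e S)"
        using coeff[of \<alpha>] F that S a_sqf by auto
      ultimately show ?thesis by (simp add: norm_mult e)
    qed
    have "ennreal (real (card \<S>) * (r * (s * c)) ^ m) = (\<Sum>\<alpha>\<in>F. ennreal (cmod (taylor_coeff n f \<alpha> * monomial n \<alpha> z)))"
    proof -
      have "card F = card \<S>" unfolding F_def by (rule card_image[OF inj_on_subset[OF inj_sqf]]) simp
      moreover have "0 \<le> (r * (s * c)) ^ m" using r s c by simp
      ultimately show ?thesis by (simp add: coeff_z ennreal_mult ennreal_of_nat_eq_real_of_nat)
    qed
    also have "\<dots> \<le> (\<Sum>\<^sub>\<infinity>\<alpha>\<in>J \<inter> MI n. ennreal (cmod (taylor_coeff n f \<alpha> * monomial n \<alpha> z)))"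
      using F FJ by (subst nonneg_infsum_complete) (auto intro!: SUP_upper)
    also have "\<dots> \<le> (SUP z \<in> (\<lambda>w k. complex_of_real r * w k) ` ballXn nX n.
           (\<Sum>\<^sub>\<infinity>\<alpha>\<in>J \<inter> MI n. ennreal (cmod (taylor_coeff n f \<alpha> * monomial n \<alpha> z))))"
      using w by (intro SUP_upper) (auto simp: z_def)
    also have "\<dots> \<le> ennreal (SUP w \<in> ballXn nX n. cmod (f w))"
      using r(2) fH by (simp only: bohr_property_def)
    also have "\<dots> \<le> ennreal (R ^ m * W)" by (rule ennreal_leI[OF supf])
    finally show ?thesis using RW by (simp add: ennreal_le_iff)
  qed
  have "((\<lambda>s. real (card \<S>) * (r * (s * c)) ^ m) \<longlongrightarrow> real (card \<S>) * (r * (1 * c)) ^ m) (at_left 1)"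
    by (intro tendsto_intros)
  moreover have "\<forall>\<^sub>F s in at_left (1::real). 0 < s \<and> s < 1"
    using eventually_at_left_real[of 0 1] by simp
  ultimately have "real (card \<S>) * (r * (1 * c)) ^ m \<le> R ^ m * W"
    by (intro tendsto_upperbound[of _ _ "at_left 1"]) (auto elim!: eventually_mono intro: key)
  then have "real (card \<S>) * r ^ m * c ^ m \<le> sqrt (real n) ^ m * W * c ^ m"
  proof -
    have "R = sqrt (real n) * c" using n by (simp add: R_def c_def real_div_sqrt field_simps)
    then show ?thesis
      using \<open>real (card \<S>) * (r * (1 * c)) ^ m \<le> R ^ m * W\<close> by (simp add: power_mult_distrib mult_ac)
  qed
  then have "real (card \<S>) * r ^ m \<le> sqrt (real n) ^ m * W" using c by simp
  moreover have "card \<S> = n choose m" unfolding \<S>_def using n_subsets[of "{..<n}" m] by simp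
  ultimately show ?thesis by (simp add: W_def)
qed

end

section \<open>Asymptotics of the upper bound\<close>

lemma fact_le_power_exp:
  assumes "1 \<le> m"
  shows "fact m \<le> exp 1 * real m * (real m / exp 1) ^ m"
  using assms
proof (induction m rule: dec_induct)
  case (step m)
  have m: "0 < real m" using step by simp
  have "exp 1 \<le> ((real m + 1) / real m) ^ Suc m"
  proof -
    have "ln (real m / (real m + 1)) \<le> real m / (real m + 1) - 1"
      using m by (intro ln_le_minus_one) auto
    then have "1 \<le> (real m + 1) * ln ((real m + 1) / real m)"
      using m by (simp add: ln_div field_simps)
    then have "exp 1 \<le> exp ((real m + 1) * ln ((real m + 1) / real m))" by simp
    also have "\<dots> = ((real m + 1) / real m) powr real (Suc m)"
      using m by (simp add: powr_def add.commute)
    also have "\<dots> = ((real m + 1) / real m) ^ Suc m"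
      using m by (intro powr_realpow) auto
    finally show ?thesis .
  qed
  then have "exp 1 * real m ^ Suc m \<le> ((real m + 1) / real m) ^ Suc m * real m ^ Suc m"
    by (intro mult_right_mono) auto
  also have "\<dots> = (real m + 1) ^ Suc m"
    using m by (simp only: power_mult_distrib[symmetric]) simp
  finally have *: "exp 1 * real m ^ Suc m \<le> (real m + 1) ^ Suc m" .
  have "(fact (Suc m) :: real) = (real m + 1) * fact m" by simp
  also have "\<dots> \<le> (real m + 1) * (exp 1 * real m * (real m / exp 1) ^ m)"
    using step by (intro mult_left_mono) auto
  also have "\<dots> = (real m + 1) / exp 1 ^ m * (exp 1 * real m ^ Suc m)"
    by (simp add: power_divide)
  also have "\<dots> \<le> (real m + 1) / exp 1 ^ m * (real m + 1) ^ Suc m"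
    using * by (intro mult_left_mono) auto
  also have "\<dots> = exp 1 * real (Suc m) * (real (Suc m) / exp 1) ^ Suc m"
    by (simp add: power_divide add.commute)
  finally show ?case .
qed simp

lemma power_mult_fact_le: "d ^ m * fact d \<le> (fact (d + m) :: nat)"
proof (induction m)
  case (Suc m)
  have "d ^ Suc m * fact d = d * (d ^ m * fact d)" by simp
  also have "\<dots> \<le> (d + Suc m) * fact (d + m)" using Suc by (intro mult_mono) auto
  finally show ?case by simp
qed simp

lemma binomial_mult_fact_ge:
  assumes "m \<le> n"
  shows "real (n - m) ^ m \<le> real (n choose m) * fact m"
proof -
  have "(n - m) ^ m * fact (n - m) \<le> fact n"
    using power_mult_fact_le[of "n - m" m] assms by simp
  also have "fact n = (n choose m) * fact m * fact (n - m)"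
    using binomial_fact_lemma[OF assms] by (simp add: mult_ac)
  finally have "(n - m) ^ m \<le> (n choose m) * fact m" by simp
  then have "real ((n - m) ^ m) \<le> real ((n choose m) * fact m)" by (rule of_nat_mono)
  then show ?thesis by simp
qed

text \<open>\<open>2 * H + 1\<close> is at most n^(2m+2), so the logarithm of the net size is of
  order n m ln n, hence of order n m^2 because ln n is at most m. What matters is the power
  \<open>sqrt n\<close>; the factor in m is harmless after an m-th root.\<close>

lemma net_size_bound:
  fixes n m :: nat
  assumes m: "1 \<le> m" "2 * m \<le> n" and n: "3 \<le> n" and ln: "ln (real n) \<le> real m"
  shows "1 + 4 * sqrt (ln (4 * real ((2 * (2 * m * n ^ m * fact m) + 1) ^ (2 * n)))) \<le> 21 * sqrt (real n) * real m"
proof -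
  define H where "H = 2 * m * n ^ m * fact m"
  have H1: "1 \<le> H" using m n by (simp add: H_def Suc_le_eq)
  have "fact m \<le> m ^ m" using fact_le_power[of m, where 'a = nat] by simp
  also have "\<dots> \<le> n ^ m" using m by (intro power_mono) auto
  finally have Hle: "H \<le> n * n ^ m * n ^ m"
    unfolding H_def using m by (intro mult_mono) auto
  have "2 * H + 1 \<le> 3 * H" using H1 by simp
  also have "\<dots> \<le> n * (n * n ^ m * n ^ m)" using n by (intro mult_mono Hle) auto
  also have "\<dots> = n ^ (2 * m + 2)" by (simp add: power_add mult_2 power2_eq_square)
  finally have "real (2 * H + 1) \<le> real (n ^ (2 * m + 2))" by (rule of_nat_mono)
  then have "ln (real (2 * H + 1)) \<le> ln (real n ^ (2 * m + 2))" using n by simp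
  also have "\<dots> = real (2 * m + 2) * ln (real n)" by (rule ln_realpow)
  also have "\<dots> \<le> (4 * real m) * real m" using m ln n by (intro mult_mono) auto
  finally have lnH: "ln (real (2 * H + 1)) \<le> 4 * (real m)\<^sup>2" by (simp add: power2_eq_square)
  have nm: "1 \<le> real n * (real m)\<^sup>2"
  proof -
    have "1 * 1 \<le> real n * (real m)\<^sup>2" using m n by (intro mult_mono one_le_power) auto
    then show ?thesis by simp
  qed
  have "ln (4 * real ((2 * H + 1) ^ (2 * n))) = ln 4 + real (2 * n) * ln (real (2 * H + 1))"
  proof -
    have "ln (4 * real ((2 * H + 1) ^ (2 * n))) = ln 4 + ln (real (2 * H + 1) ^ (2 * n))"
      unfolding of_nat_power by (rule ln_mult_pos) auto
    then show ?thesis by (simp only: ln_realpow)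
  qed
  also have "\<dots> \<le> 3 + real (2 * n) * (4 * (real m)\<^sup>2)"
    using ln_le_minus_one[of "4 :: real"] lnH by (intro add_mono mult_left_mono) auto
  \<comment> \<open>The constant is rounded up generously to a perfect square.\<close>
  also have "\<dots> \<le> 25 * (real n * (real m)\<^sup>2)" using nm by simp
  finally have "sqrt (ln (4 * real ((2 * H + 1) ^ (2 * n)))) \<le> sqrt (25 * (real n * (real m)\<^sup>2))"
    by (rule real_sqrt_le_mono)
  also have "\<dots> = 5 * (sqrt (real n) * real m)"
    by (simp add: real_sqrt_mult real_sqrt_unique[of 5 25])
  finally have "1 + 4 * sqrt (ln (4 * real ((2 * H + 1) ^ (2 * n)))) \<le> 1 + 20 * (sqrt (real n) * real m)" by linarith
  also have "1 \<le> sqrt (real n) * real m"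
  proof -
    have "1 * 1 \<le> sqrt (real n) * real m" using m n by (intro mult_mono) auto
    then show ?thesis by simp
  qed
  finally show ?thesis by (simp add: H_def mult_ac)
qed

text \<open>After clearing denominators the right side contains sqrt (m!), which Stirling bounds by
  (m / e)^(m/2) up to a polynomial in m. The net contributes \<open>sqrt n\<close>, and as ln n is
  at most m this is absorbed by e^(m/2). A smaller degree would leave a power of n, a larger one
  would increase sqrt m; the best degree is therefore near ln n. The 63 is 3 times 21, from Stirling
  and the net.\<close>

lemma radius_bound_of_random_polynomial:
  fixes n m :: nat and r :: real
  assumes m: "1 \<le> m" "2 * m \<le> n" and n: "3 \<le> n" and ln: "ln (real n) \<le> real m" and r: "0 < r"
    and bd: "real (n choose m) * r ^ m \<le> sqrt (real n) ^ m *
      ((1 + 4 * sqrt (ln (4 * real ((2 * (2 * m * n ^ m * fact m) + 1) ^ (2 * n))))) / sqrt (fact m))"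
  shows "r \<le> sqrt (real n) / (real n - real m) * sqrt (real m) * exp (ln (63 * (real m)\<^sup>2) / real m)"
proof -
  have m0: "0 < real m" using m by simp
  have "m < n" using m by linarith
  then have d: "0 < real n - real m" by simp
  define W where "W = 1 + 4 * sqrt (ln (4 * real ((2 * (2 * m * n ^ m * fact m) + 1) ^ (2 * n))))"
  have W: "W \<le> 21 * sqrt (real n) * real m" unfolding W_def by (rule net_size_bound[OF m n ln])
  define D where "D = sqrt (real n) / (real n - real m) * sqrt (real m)"
  have D: "0 < D" using d m0 n by (simp add: D_def)
  have sf: "sqrt (fact m) > 0" by simp
  have "(real n - real m) ^ m * r ^ m \<le> (real (n choose m) * fact m) * r ^ m"
    using binomial_mult_fact_ge[of m n] \<open>m < n\<close> r by (intro mult_right_mono) (auto simp: of_nat_diff)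
  also have "\<dots> = fact m * (real (n choose m) * r ^ m)" by simp
  also have "\<dots> \<le> fact m * (sqrt (real n) ^ m * (W / sqrt (fact m)))"
    using bd unfolding W_def by (intro mult_left_mono) auto
  also have "\<dots> = sqrt (real n) ^ m * (sqrt (fact m) * W)"
    by (simp add: real_div_sqrt field_simps)
  also have "\<dots> \<le> sqrt (real n) ^ m * ((3 * real m * sqrt (real m / exp 1) ^ m) * (21 * sqrt (real n) * real m))"
  proof (intro mult_left_mono mult_mono W)
    have "sqrt (fact m) \<le> sqrt (exp 1 * real m * (real m / exp 1) ^ m)"
      using fact_le_power_exp[OF m(1)] by (rule real_sqrt_le_mono)
    also have "\<dots> = sqrt (exp 1 * real m) * sqrt (real m / exp 1) ^ m"
      by (simp add: real_sqrt_mult real_sqrt_power)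
    also have "\<dots> \<le> 3 * real m * sqrt (real m / exp 1) ^ m"
    proof (intro mult_right_mono)
      have "exp 1 * real m \<le> 9 * (real m * real m)"
        using exp_le m by (intro mult_mono) auto
      then show "sqrt (exp 1 * real m) \<le> 3 * real m"
        by (intro real_le_lsqrt) (auto simp: power2_eq_square)
    qed auto
    finally show "sqrt (fact m) \<le> 3 * real m * sqrt (real m / exp 1) ^ m" .
    show "0 \<le> W"
    proof -
      have "1 \<le> (2 * (2 * m * n ^ m * fact m) + 1) ^ (2 * n)" by simp
      then have "1 \<le> real ((2 * (2 * m * n ^ m * fact m) + 1) ^ (2 * n))" by (simp only: real_of_nat_ge_one_iff)
      then have "0 \<le> ln (4 * real ((2 * (2 * m * n ^ m * fact m) + 1) ^ (2 * n)))" by (intro ln_ge_zero) linarith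
      then show ?thesis unfolding W_def by simp
    qed
  qed auto
  also have "\<dots> = sqrt (real n) ^ m * sqrt (real m) ^ m * (63 * (real m)\<^sup>2) * (sqrt (real n) / sqrt (exp 1) ^ m)"
    by (simp add: real_sqrt_divide power_divide power2_eq_square)
  also have "\<dots> \<le> sqrt (real n) ^ m * sqrt (real m) ^ m * (63 * (real m)\<^sup>2) * 1"
  proof (intro mult_left_mono)
    have "real n = exp (ln (real n))" using n by simp
    also have "\<dots> \<le> exp (real m)" using ln by simp
    also have "\<dots> = exp 1 ^ m" by (simp add: exp_of_nat_mult[symmetric])
    finally have "sqrt (real n) \<le> sqrt (exp 1 ^ m)" by (rule real_sqrt_le_mono)
    then show "sqrt (real n) / sqrt (exp 1) ^ m \<le> 1" by (simp add: real_sqrt_power)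
  qed auto
  also have "\<dots> = sqrt (real n) ^ m * sqrt (real m) ^ m * exp (ln (63 * (real m)\<^sup>2) / real m) ^ m"
    using m0 by (simp add: exp_of_nat_mult[symmetric])
  also have "\<dots> = (real n - real m) ^ m * (D * exp (ln (63 * (real m)\<^sup>2) / real m)) ^ m"
    using d by (simp add: D_def power_mult_distrib power_divide)
  finally have "r ^ m \<le> (D * exp (ln (63 * (real m)\<^sup>2) / real m)) ^ m"
    using d by simp
  then have "r \<le> D * exp (ln (63 * (real m)\<^sup>2) / real m)"
    using D m by (subst (asm) power_mono_iff) (use r in auto)
  then show ?thesis by (simp add: D_def)
qed

lemma (in seq_lattice) eventually_bohr_radius_le:
  assumes l2: "\<forall>n. id_norm_l2 nX n \<le> id_norm_l1 nX n / sqrt (real n)" and J: "Lambda_T \<subseteq> J" and eps: "0 < \<epsilon>"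
  shows "\<forall>\<^sub>F n in sequentially. \<forall>r. 0 < r \<longrightarrow> bohr_property nX n J r \<longrightarrow>
    r \<le> (1 + \<epsilon>) * sqrt (ln (real n) / real n)"
proof -
  \<comment> \<open>The bound for r divided by sqrt (ln n / n), with the degree replaced by ln n or
    ln n + 1, whichever is worse in each factor. The exponential is the m-th root of a polynomial in
    m and tends to 1.\<close>
  define Q where "Q n = real n / (real n - (ln (real n) + 1)) * sqrt ((ln (real n) + 1) / ln (real n)) *
    exp (ln (63 * (ln (real n) + 1)\<^sup>2) / ln (real n))" for n :: nat
  have "Q \<longlonglongrightarrow> 1" unfolding Q_def by real_asymp
  then have "\<forall>\<^sub>F n in sequentially. Q n < 1 + \<epsilon>" by (rule order_tendstoD) (use eps in auto)
  moreover have "\<forall>\<^sub>F n in sequentially. 1 \<le> ln (real n)" by real_asymp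
  moreover have "\<forall>\<^sub>F n in sequentially. 2 * (ln (real n) + 1) \<le> real n" by real_asymp
  moreover have "\<forall>\<^sub>F n in sequentially. 3 \<le> n" by (rule eventually_ge_at_top)
  ultimately show ?thesis
  proof eventually_elim
    case (elim n)
    show ?case
    proof (intro allI impI)
      fix r assume r: "0 < r" "bohr_property nX n J r"
      define l where "l = ln (real n)"
      \<comment> \<open>The smallest integer satisfying the hypothesis that ln n is at most
        m.\<close>
      define m where "m = nat \<lceil>l\<rceil>"
      have l: "1 \<le> l" "2 * (l + 1) \<le> real n" using elim by (auto simp: l_def)
      have m: "l \<le> real m" "real m \<le> l + 1" "1 \<le> m"
        using l unfolding m_def by linarith+
      have "real (2 * m) \<le> real n" using m(2) l(2) by simp
      then have mn: "2 * m \<le> n" by (simp only: of_nat_le_iff)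
      have "l + 1 < 2 * (l + 1)" using l(1) by simp
      then have d: "0 < real n - (l + 1)" using l(2) by simp
      have "r \<le> sqrt (real n) / (real n - real m) * sqrt (real m) * exp (ln (63 * (real m)\<^sup>2) / real m)"
      proof (rule radius_bound_of_random_polynomial[OF m(3) mn elim(4) _ r(1)])
        show "ln (real n) \<le> real m" using m by (simp add: l_def)
        show "real (n choose m) * r ^ m \<le> sqrt (real n) ^ m *
          ((1 + 4 * sqrt (ln (4 * real ((2 * (2 * m * n ^ m * fact m) + 1) ^ (2 * n))))) / sqrt (fact m))"
          using elim(4) m l2 J r by (intro bohr_property_upper) auto
      qed
      also have "\<dots> \<le> sqrt (real n) / (real n - (l + 1)) * sqrt (l + 1) * exp (ln (63 * (l + 1)\<^sup>2) / l)"
      proof (intro mult_mono)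
        show "sqrt (real n) / (real n - real m) \<le> sqrt (real n) / (real n - (l + 1))"
          using m d by (intro divide_left_mono mult_pos_pos) auto
        have le: "63 * (real m)\<^sup>2 \<le> 63 * (l + 1)\<^sup>2"
          using m by (intro mult_left_mono power_mono) auto
        have "1 * 1 \<le> 63 * (real m)\<^sup>2" using m by (intro mult_mono one_le_power) auto
        then have ge: "1 \<le> 63 * (real m)\<^sup>2" by (simp only: mult_1)
        have "ln (63 * (real m)\<^sup>2) \<le> ln (63 * (l + 1)\<^sup>2)"
          by (rule ln_mono[OF le]) (rule less_le_trans[OF zero_less_one ge])
        moreover have "0 \<le> ln (63 * (l + 1)\<^sup>2)" by (rule ln_ge_zero[OF order_trans[OF ge le]])
        ultimately show "exp (ln (63 * (real m)\<^sup>2) / real m) \<le> exp (ln (63 * (l + 1)\<^sup>2) / l)"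
          unfolding exp_le_cancel_iff using m(1) l(1) by (intro frac_le) auto
      qed (use m d l in auto)
      also have "\<dots> = Q n * sqrt (l / real n)"
      proof -
        define E where "E = exp (ln (63 * (l + 1)\<^sup>2) / l)"
        have 1: "sqrt ((l + 1) / l) * sqrt (l / real n) = sqrt (l + 1) / sqrt (real n)"
          using l(1) by (simp add: real_sqrt_mult[symmetric] real_sqrt_divide[symmetric])
        have "Q n * sqrt (l / real n) = real n / (real n - (l + 1)) * E * (sqrt ((l + 1) / l) * sqrt (l / real n))"
          by (simp only: Q_def l_def[symmetric] E_def[symmetric] mult_ac)
        also have "\<dots> = (real n / sqrt (real n)) / (real n - (l + 1)) * sqrt (l + 1) * E"
          unfolding 1 by (simp add: mult_ac)
        finally show ?thesis by (simp only: real_div_sqrt[OF of_nat_0_le_iff] E_def)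
      qed
      also have "\<dots> \<le> (1 + \<epsilon>) * sqrt (l / real n)"
        using elim(1) l by (intro mult_right_mono) auto
      finally show "r \<le> (1 + \<epsilon>) * sqrt (ln (real n) / real n)" by (simp add: l_def)
    qed
  qed
qed

theorem theorem2p34:
  fixes X :: "(nat \<Rightarrow> complex) set" and nX :: "(nat \<Rightarrow> complex) \<Rightarrow> real"
    and J :: "(nat \<Rightarrow> nat) set"
  assumes "banach_seq_lattice X nX"
    and "\<exists>C. \<forall>n. phiX nX n * phiX_dual X nX n \<le> C * real n"
    and "\<forall>n. id_norm_l2 nX n \<le> id_norm_l1 nX n / sqrt (real n)"
    and "J \<subseteq> multi_indices" and "Lambda_T \<subseteq> J"
  shows "(\<lambda>n. bohr_radius nX n J / sqrt (ln (real n) / real n)) \<longlonglongrightarrow> 1"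
proof (rule LIMSEQ_I)
  interpret seq_lattice X nX by unfold_locales (rule assms(1))
  fix e :: real assume e: "0 < e"
  define \<epsilon> where "\<epsilon> = min (e / 2) (1 / 2)"
  have eps: "0 < \<epsilon>" "\<epsilon> < 1" "\<epsilon> < e" using e by (auto simp: \<epsilon>_def)
  have "\<forall>\<^sub>F n in sequentially. 0 < ln (real n) / real n" by real_asymp
  then have "\<forall>\<^sub>F n in sequentially. norm (bohr_radius nX n J / sqrt (ln (real n) / real n) - 1) < e"
    using eventually_bohr_radius_ge[OF eps(1,2), of J] eventually_bohr_radius_le[OF assms(3,5) eps(1)]
  proof eventually_elim
    case (elim n)
    define s where "s = sqrt (ln (real n) / real n)"
    have s: "0 < s" using elim(1) by (simp add: s_def)
    have "bohr_radius nX n J \<le> (1 + \<epsilon>) * s"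
      unfolding bohr_radius_eq using elim(2,3) by (intro cSup_least) (auto simp: s_def)
    moreover have "(1 - \<epsilon>) * s \<le> bohr_radius nX n J" using elim(2) by (simp add: s_def)
    ultimately have "1 - \<epsilon> \<le> bohr_radius nX n J / s" "bohr_radius nX n J / s \<le> 1 + \<epsilon>"
      using s by (simp_all add: pos_le_divide_eq pos_divide_le_eq)
    then show ?case using eps(3) unfolding s_def real_norm_def by linarith
  qed
  then show "\<exists>N. \<forall>n\<ge>N. norm (bohr_radius nX n J / sqrt (ln (real n) / real n) - 1) < e"
    by (simp add: eventually_sequentially)
qed

end
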